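(* Let $\mathfrak r_*\in\mathfrak R$ satisfy $|\mathfrak r_*|=P-1$, let $i(\mathfrak r_* )$ denote the index of the unique coordinate of $\mathfrak r_*$ that equals zero, and let $c$ be the constant in the standing condition (S) on $\hat{\mathfrak r}$ (stated in the context) corresponding to $\mathfrak r_*$. Suppose that $AQ^{-1}e_{i(\mathfrak r_* )}\ne0$, where $e_{i(\mathfrak r_* )}$ denotes the $i(\mathfrak r_* )$th standard basis vector in $\mathbf{R}^P$ (i.e. $A\tilde\theta(\mathfrak r_{\rm full})$ and $\tilde\theta_{i(\mathfrak r_* )}(\mathfrak r_{\rm full})$ are asymptotically correlated). Then for every $\theta\in M_{\mathfrak r_*}$ which has exactly $P-1$ nonzero coordinates, for each $0<\sigma<\infty$ and each $t\in\mathbf{R}^k$, the following holds. There exist $\delta_0>0$ and $0<\rho_0<\infty$ such that any estimator $\hat K_n(t|\hat{\mathfrak r})$ of $K_{n,\theta,\sigma}(t|\hat{\mathfrak r})$ satisfying $$P_{n,\theta,\sigma}\big(|\hat K_n(t|\hat{\mathfrak r})-K_{n,\theta,\sigma}(t|\hat{\mathfrak r})|>\delta\big)\xrightarrow{n\to\infty}0\quad\text{for each }\delta>0$$ also satisfies $$\liminf_{n\to\infty}\ \sup_{\substack{\vartheta\in\mathbf{R}^P\\ \|\vartheta-\theta\|<\rho_0/\sqrt n}}P_{n,\vartheta,\sigma}\big(|\hat K_n(t|\hat{\mathfrak r})-K_{n,\vartheta,\sigma}(t|\hat{\mathfrak r})|>\delta_0\big)\ \ge\ 2(1-\Phi(c))>0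 .$$ The constants $\delta_0$ and $\rho_0$ may be chosen in such a way that they depend only on $t,Q,A,\sigma$ and $c$. Moreover, $$\liminf_{n\to\infty}\ \inf_{\hat K_n(t|\hat{\mathfrak r})}\ \sup_{\substack{\vartheta\in\mathbf{R}^P\\ \|\vartheta-\theta\|<\rho_0/\sqrt n}}P_{n,\vartheta,\sigma}\big(|\hat K_n(t|\hat{\mathfrak r})-K_{n,\vartheta,\sigma}(t|\hat{\mathfrak r})|>\delta_0\big)>0$$ and $$\sup_{\delta>0}\ \liminf_{n\to\infty}\ \inf_{\hat K_n(t|\hat{\mathfrak r})}\ \sup_{\substack{\vartheta\in\mathbf{R}^P\\ \|\vartheta-\theta\|<\rho_0/\sqrt n}}P_{n,\vartheta,\sigma}\big(|\hat K_n(t|\hat{\mathfrak r})-K_{n,\vartheta,\sigma}(t|\hat{\mathfrak r})|>\delta\big)\ \ge\ 1-\Phi(c)>0$$ hold, where the infima extend over all estimators $\hat K_n(t|\hat{\mathfrak r})$ of $K_{n,\theta,\sigma}(t|\hat{\mathfrak r})$ at sample size $n$. Furthermore, $2(1-\Phi(c))=\lim_{n\to\infty}P_{n,\theta,\sigma}(\hat{\mathfrak r}=\mathfrak r_{\rm full})$.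
   Context: Model. For each $n>P\ge1$ let $Y=X\theta+u$, where $X$ is a nonstochastic $n\times P$ matrix of rank $P$ (its elements may depend on $n$), $u\sim N(0,\sigma^2I_n)$, $\theta\in\mathbf{R}^P$, $0<\sigma<\infty$. Assume that $Q=\lim_{n\to\infty}X'X/n$ exists and is nonsingular. $P_{n,\theta,\sigma}$ denotes the probability measure corresponding to a sample of size $n$ from this model. $\|\cdot\|$ is the Euclidean norm, inequalities between vectors are componentwise, $\Phi$ is the standard normal c.d.f. Candidate models. For $\mathfrak r\in\{0,1\}^P$, $M_{\mathfrak r}=\{\theta\in\mathbf{R}^P:\theta_i(1-\mathfrak r_i)=0,\ 1\le i\le P\}$, and $|\mathfrak r|$ is the number of nonzero coordinates of $\mathfrak r$. $\mathfrak R\subseteq\{0,1\}^P$ is a fixed set containing $\mathfrak r_{\rm full}=(1,\dots,1)$ and at least one element $\mathfrak r_*$ with $|\mathfrak r_*|=P-1$. $\tilde\theta(\mathfrak r)\in\mathbf{R}^P$ is the restricted least-squares estimator of $\theta$ obtained from model $M_{\mathfrak r}$ ($\tilde\theta(\mathfrak r)=0$ if $\mathfrak r=(0,\dots,0)$). Model selection procedure. $\hat{\mathfrak r}=\hat{\mathfrak r}(Y,X)$ is a random variable with values in $\mathfrak R$ satisfying the standing condition (S): for every $\mathfrak r_*\in\mathfrak R$ with $|\mathfrak r_*|=P-1$ there is a constant $0<c<\infty$ (possibly depending on $\mathfrak r_*$) such that for every $\theta\in M_{\mathfrak r_*}$ with exactly $P-1$ nonzero coordinates and every $0<\sigma<\infty$,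 $$\lim_{n\to\infty}P_{n,\theta,\sigma}\big(\{\hat{\mathfrak r}=\mathfrak r_{\rm full}\}\,\triangle\,\{|T_{\mathfrak r_*}|\ge c\}\big)=\lim_{n\to\infty}P_{n,\theta,\sigma}\big(\{\hat{\mathfrak r}=\mathfrak r_*\}\,\triangle\,\{|T_{\mathfrak r_*}|<c\}\big)=0 .$$ Here $\triangle$ is symmetric difference and $T_{\mathfrak r_*}$ is the usual $t$-statistic for testing $\theta_{i(\mathfrak r_* )}=0$ in the full model, i.e. $T_{\mathfrak r_*}=\sqrt n\,\tilde\theta_{i}(\mathfrak r_{\rm full})/\big(\hat\sigma\,[((X'X/n)^{-1})_{i,i}]^{1/2}\big)$ with $i=i(\mathfrak r_* )$ the index of the unique zero coordinate of $\mathfrak r_*$ and $\hat\sigma^2=(n-P)^{-1}\|Y-X\tilde\theta(\mathfrak r_{\rm full})\|^2$. Target. $A$ is a fixed nonstochastic $k\times P$ matrix of rank $k$, $1\le k\le P$. $\bar\theta=\sum_{\mathfrak r\in\mathfrak R}\tilde\theta(\mathfrak r)\mathbf 1(\hat{\mathfrak r}=\mathfrak r)$ is the post-model-selection estimator. For $t\in\mathbf{R}^k$, $K_{n,\theta,\sigma}(t|\mathfrak r)=P_{n,\theta,\sigma}(\sqrt nA(\bar\theta-\theta)\le t\,|\,\hat{\mathfrak r}=\mathfrak r)$ (defined as the c.d.f. of point-mass at zero in $\mathbf{R}^k$ if $P_{n,\theta,\sigma}(\hat{\mathfrak r}=\mathfrak r)=0$), and $K_{n,\theta,\sigma}(t|\hat{\mathfrak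 r})=\sum_{\mathfrak r\in\mathfrak R}K_{n,\theta,\sigma}(t|\mathfrak r)\mathbf 1(\hat{\mathfrak r}=\mathfrak r)$. An estimator of this quantity (at fixed $t$) at sample size $n$ is any real-valued random variable that is a (measurable) function of $(Y,X)$. Outside the infima, $\hat K_n(t|\hat{\mathfrak r})$ stands for a sequence of such estimators. *)

theory Defs
  imports "HOL-Probability.Probability"
begin

text \<open>
  The number of parameters \<open>P\<close> and the number of rows \<open>k\<close> of the target matrix are the
  cardinalities of the index types \<open>'p\<close> and \<open>'k\<close>. The sample size \<open>n\<close> varies, so observation
  vectors are functions \<open>nat \<Rightarrow> real\<close> on the index set \<open>{..<n}\<close>, and a design matrix \<open>D\<close> with
  \<open>n\<close> rows is given by its rows \<open>D m :: real ^ 'p\<close> for \<open>m < n\<close>.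
\<close>

definition sample_space :: "nat \<Rightarrow> (nat \<Rightarrow> real) measure" where
  "sample_space n = PiM {..<n} (\<lambda>_. borel)"

text \<open>The law of \<open>Y = X \<theta> + u\<close> with \<open>u\<close> distributed as \<open>N(0, \<sigma>\<^sup>2 I\<^sub>n)\<close>.\<close>

definition sample_law ::
  "nat \<Rightarrow> (nat \<Rightarrow> real ^ 'p) \<Rightarrow> real ^ 'p \<Rightarrow> real \<Rightarrow> (nat \<Rightarrow> real) measure" where
  "sample_law n D \<theta> \<sigma> =
     distr (PiM {..<n} (\<lambda>_. density lborel (\<lambda>x. ennreal (normal_density 0 \<sigma> x))))
           (sample_space n)
           (\<lambda>u. \<lambda>m\<in>{..<n}. D m \<bullet> \<theta> + u m)"

definition gram :: "nat \<Rightarrow> (nat \<Rightarrow> real ^ 'p) \<Rightarrow> real ^ 'p ^ 'p" where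
  "gram n D = (\<chi> i j. \<Sum>m<n. D m $ i * D m $ j)"

text \<open>
  The rank of the design matrix is its row rank, in accordance with the library constant
  \<^const>\<open>rank\<close>, which is only available for matrices with type-indexed rows.
\<close>

definition regular_design :: "(nat \<Rightarrow> nat \<Rightarrow> real ^ 'p) \<Rightarrow> real ^ 'p ^ 'p \<Rightarrow> bool" where
  "regular_design X Q \<longleftrightarrow>
     (\<forall>n > CARD('p). dim (X n ` {..<n}) = CARD('p)) \<and>
     (\<lambda>n. (1 / real n) *\<^sub>R gram n (X n)) \<longlonglongrightarrow> Q \<and>
     invertible Q"

text \<open>Elements of \<open>{0,1}\<^sup>P\<close> are represented as Boolean vectors.\<close>

definition submodel :: "bool ^ 'p \<Rightarrow> (real ^ 'p) set" where
  "submodel r = {\<theta>. \<forall>i. \<theta> $ i * (1 - of_bool (r $ i)) = 0}"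

definition model_size :: "bool ^ 'p \<Rightarrow> nat" where
  "model_size r = card {i. r $ i}"

definition full_model :: "bool ^ 'p" where
  "full_model = (\<chi> i. True)"

text \<open>Only used for models with exactly one zero coordinate.\<close>

definition zero_index :: "bool ^ 'p \<Rightarrow> 'p" where
  "zero_index r = (THE i. \<not> r $ i)"

definition num_nonzero :: "real ^ 'p \<Rightarrow> nat" where
  "num_nonzero \<theta> = card {i. \<theta> $ i \<noteq> 0}"

definition ssr :: "nat \<Rightarrow> (nat \<Rightarrow> real ^ 'p) \<Rightarrow> (nat \<Rightarrow> real) \<Rightarrow> real ^ 'p \<Rightarrow> real" where
  "ssr n D Y b = (\<Sum>m<n. (Y m - D m \<bullet> b)\<^sup>2)"

text \<open>The minimizer is unique when \<open>D\<close> has full column rank.\<close>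

definition restricted_lse ::
  "nat \<Rightarrow> (nat \<Rightarrow> real ^ 'p) \<Rightarrow> bool ^ 'p \<Rightarrow> (nat \<Rightarrow> real) \<Rightarrow> real ^ 'p" where
  "restricted_lse n D r Y = arg_min_on (ssr n D Y) (submodel r)"

definition sigma_hat :: "nat \<Rightarrow> (nat \<Rightarrow> real ^ 'p) \<Rightarrow> (nat \<Rightarrow> real) \<Rightarrow> real" where
  "sigma_hat n D Y =
     sqrt (ssr n D Y (restricted_lse n D full_model Y) / (real n - real CARD('p)))"

definition t_statistic ::
  "nat \<Rightarrow> (nat \<Rightarrow> real ^ 'p) \<Rightarrow> 'p \<Rightarrow> (nat \<Rightarrow> real) \<Rightarrow> real" where
  "t_statistic n D i Y =
     sqrt (real n) * restricted_lse n D full_model Y $ i /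
     (sigma_hat n D Y * sqrt (matrix_inv ((1 / real n) *\<^sub>R gram n D) $ i $ i))"

text \<open>
  A selection procedure for a given sequence of designs: \<open>rhat n Y\<close> is the model selected at
  sample size \<open>n\<close>. Since the designs are nonstochastic, dependence on \<open>X\<close> is subsumed in the
  dependence on \<open>n\<close>.
\<close>

definition selection_procedure ::
  "(bool ^ 'p) set \<Rightarrow> (nat \<Rightarrow> (nat \<Rightarrow> real) \<Rightarrow> bool ^ 'p) \<Rightarrow> bool" where
  "selection_procedure R rhat \<longleftrightarrow>
     (\<forall>n > CARD('p). rhat n \<in> measurable (sample_space n) (count_space R))"

text \<open>The requirement that the standing condition imposes on the constant \<open>c\<close> belonging to \<open>r\<close>.\<close>

definition selection_constant ::
  "(nat \<Rightarrow> nat \<Rightarrow> real ^ 'p) \<Rightarrow> (nat \<Rightarrow> (nat \<Rightarrow> real) \<Rightarrow> bool ^ 'p) \<Rightarrow>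
   bool ^ 'p \<Rightarrow> real \<Rightarrow> bool" where
  "selection_constant X rhat r c \<longleftrightarrow>
     0 < c \<and>
     (\<forall>\<theta> \<in> submodel r. num_nonzero \<theta> = CARD('p) - 1 \<longrightarrow> (\<forall>\<sigma> > 0.
        (\<lambda>n. measure (sample_law n (X n) \<theta> \<sigma>)
               (sym_diff {Y \<in> space (sample_space n). rhat n Y = full_model}
                         {Y \<in> space (sample_space n).
                            \<bar>t_statistic n (X n) (zero_index r) Y\<bar> \<ge> c})) \<longlonglongrightarrow> 0 \<and>
        (\<lambda>n. measure (sample_law n (X n) \<theta> \<sigma>)
               (sym_diff {Y \<in> space (sample_space n). rhat n Y = r}
                         {Y \<in> space (sample_space n).
                            \<bar>t_statistic n (X n) (zero_index r) Y\<bar> < c})) \<longlonglongrightarrow> 0))"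

definition standing_condition ::
  "(nat \<Rightarrow> nat \<Rightarrow> real ^ 'p) \<Rightarrow> (bool ^ 'p) set \<Rightarrow>
   (nat \<Rightarrow> (nat \<Rightarrow> real) \<Rightarrow> bool ^ 'p) \<Rightarrow> bool" where
  "standing_condition X R rhat \<longleftrightarrow>
     (\<forall>r \<in> R. model_size r = CARD('p) - 1 \<longrightarrow> (\<exists>c. selection_constant X rhat r c))"

text \<open>From here on \<open>rh\<close> is the selector at one fixed sample size \<open>n\<close>.\<close>

definition pms_estimator ::
  "nat \<Rightarrow> (nat \<Rightarrow> real ^ 'p) \<Rightarrow> (bool ^ 'p) set \<Rightarrow> ((nat \<Rightarrow> real) \<Rightarrow> bool ^ 'p) \<Rightarrow>
   (nat \<Rightarrow> real) \<Rightarrow> real ^ 'p" where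
  "pms_estimator n D R rh Y = (\<Sum>r\<in>R. of_bool (rh Y = r) *\<^sub>R restricted_lse n D r Y)"

text \<open>The order on \<open>real ^ 'k\<close> is the componentwise one.\<close>

definition cond_cdf ::
  "nat \<Rightarrow> (nat \<Rightarrow> real ^ 'p) \<Rightarrow> (bool ^ 'p) set \<Rightarrow> ((nat \<Rightarrow> real) \<Rightarrow> bool ^ 'p) \<Rightarrow>
   real ^ 'p ^ 'k \<Rightarrow> real ^ 'p \<Rightarrow> real \<Rightarrow> real ^ 'k \<Rightarrow> bool ^ 'p \<Rightarrow> real" where
  "cond_cdf n D R rh A \<theta> \<sigma> t r =
     (if \<P>(Y in sample_law n D \<theta> \<sigma>. rh Y = r) = 0 then of_bool (0 \<le> t)
      else \<P>(Y in sample_law n D \<theta> \<sigma>.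
                sqrt (real n) *\<^sub>R (A *v (pms_estimator n D R rh Y - \<theta>)) \<le> t \<bar> rh Y = r))"

definition cond_cdf_selected ::
  "nat \<Rightarrow> (nat \<Rightarrow> real ^ 'p) \<Rightarrow> (bool ^ 'p) set \<Rightarrow> ((nat \<Rightarrow> real) \<Rightarrow> bool ^ 'p) \<Rightarrow>
   real ^ 'p ^ 'k \<Rightarrow> real ^ 'p \<Rightarrow> real \<Rightarrow> real ^ 'k \<Rightarrow> (nat \<Rightarrow> real) \<Rightarrow> real" where
  "cond_cdf_selected n D R rh A \<theta> \<sigma> t Y =
     (\<Sum>r\<in>R. cond_cdf n D R rh A \<theta> \<sigma> t r * of_bool (rh Y = r))"

text \<open>
  Estimators at sample size \<open>n\<close>; they must not involve the unknown parameters, and for a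
  given nonstochastic design the measurable functions of \<open>(Y, X)\<close> are those of \<open>Y\<close>.
\<close>

definition estimators :: "nat \<Rightarrow> ((nat \<Rightarrow> real) \<Rightarrow> real) set" where
  "estimators n = borel_measurable (sample_space n)"

definition miss_prob ::
  "nat \<Rightarrow> (nat \<Rightarrow> real ^ 'p) \<Rightarrow> (bool ^ 'p) set \<Rightarrow> ((nat \<Rightarrow> real) \<Rightarrow> bool ^ 'p) \<Rightarrow>
   real ^ 'p ^ 'k \<Rightarrow> real ^ 'p \<Rightarrow> real \<Rightarrow> real ^ 'k \<Rightarrow> ((nat \<Rightarrow> real) \<Rightarrow> real) \<Rightarrow> real \<Rightarrow> real"
  where
  "miss_prob n D R rh A \<theta> \<sigma> t K \<delta> =
     \<P>(Y in sample_law n D \<theta> \<sigma>. \<bar>K Y - cond_cdf_selected n D R rh A \<theta> \<sigma> t Y\<bar> > \<delta>)"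

text \<open>Extended reals, so that suprema, infima and lower limits are unconditionally meaningful.\<close>

definition local_max_miss_prob ::
  "nat \<Rightarrow> (nat \<Rightarrow> real ^ 'p) \<Rightarrow> (bool ^ 'p) set \<Rightarrow> ((nat \<Rightarrow> real) \<Rightarrow> bool ^ 'p) \<Rightarrow>
   real ^ 'p ^ 'k \<Rightarrow> real ^ 'p \<Rightarrow> real \<Rightarrow> real ^ 'k \<Rightarrow> real \<Rightarrow>
   ((nat \<Rightarrow> real) \<Rightarrow> real) \<Rightarrow> real \<Rightarrow> ereal" where
  "local_max_miss_prob n D R rh A \<theta> \<sigma> t \<rho> K \<delta> =
     (SUP \<theta>' \<in> {\<theta>'. norm (\<theta>' - \<theta>) < \<rho> / sqrt (real n)}.
        ereal (miss_prob n D R rh A \<theta>' \<sigma> t K \<delta>))"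

abbreviation std_normal_cdf :: "real \<Rightarrow> real" where
  "std_normal_cdf \<equiv> cdf std_normal_distribution"

end

theory Submission
  imports Defs
begin

text \<open>
  Let \<open>i\<close> be the coordinate that the given submodel sets to zero, and consider the parameters
  \<open>\<theta>\<^sub>n(g) = \<theta> + (g / sqrt n) e\<^sub>i\<close> for real \<open>g\<close>. They approach \<open>\<theta>\<close> so fast that the laws
  of the sample at different \<open>g\<close> are mutually contiguous: the likelihood ratios have second moments bounded in \<open>n\<close>,
  and the total variation distance between the laws at \<open>g\<close> and \<open>g'\<close> is small when \<open>g\<close> and \<open>g'\<close>
  are close (\<open>sample_law_diff_le\<close>). No statistic can therefore identify \<open>g\<close> with certainty, even in the limit. The conditional
  distribution function given selection of the full model, however, does depend on \<open>g\<close> asymptotically.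

  To see this, put \<open>W\<close> for the scaled error of least squares, \<open>sqrt n\<close> times the estimate minus the
  true parameter. For every \<open>\<theta>\<^sub>n(g)\<close> it is exactly normal with precision matrix
  \<open>X'X / (n \<sigma>\<^sup>2)\<close> (\<open>lse_normal\<close>). The standing condition describes the selector at \<open>\<theta>\<close> itself;
  contiguity carries it over to \<open>\<theta>\<^sub>n(g)\<close>, where the full model is selected, up to events of
  vanishing probability, exactly when \<open>\<bar>W\<^sub>i + g\<bar> \<ge> c \<tau>\<close> with \<open>\<tau>\<^sup>2 = \<sigma>\<^sup>2 (Q\<inverse>)\<^sub>i\<^sub>i\<close>
  (\<open>full_selected_approx\<close>). Hence the conditional distribution function given the full model
  converges to \<open>H(g)\<close>, the probability of \<open>A W \<le> t\<close> given \<open>\<bar>W\<^sub>i + g\<bar> \<ge> c \<tau>\<close> under the normal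
  law with precision \<open>Q / \<sigma>\<^sup>2\<close> (\<open>full_cdf_tendsto\<close>), and the probability of selecting the full
  model converges to a value that is at least \<open>2 (1 - \<Phi>(c))\<close>, with equality at \<open>g = 0\<close>.

  The function \<open>H\<close> is not constant (\<open>limit_cond_cdf_not_constant\<close>): conditioning on
  \<open>\<bar>W\<^sub>i + g\<bar> \<ge> c \<tau>\<close> removes a slab, and since \<open>A W\<close> and \<open>W\<^sub>i\<close> are correlated, a slab far out on
  one side contains almost nothing of the event \<open>A W \<le> t\<close>.

  An estimator that is consistent at \<open>\<theta>\<close> still estimates \<open>H(0)\<close> under \<open>\<theta>\<^sub>n(g)\<close> by contiguity, so
  it misses \<open>H(g) \<noteq> H(0)\<close> whenever the full model is selected (\<open>consistent_estimator_fails\<close>). For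
  an arbitrary estimator take two values \<open>a\<close> and \<open>b\<close> with \<open>H(a) \<noteq> H(b)\<close>: the estimator misses at
  least one of the two targets, which costs a factor two and the total variation distance between
  the two laws (\<open>every_estimator_fails\<close>). As \<open>H\<close> is not constant on a bounded interval, such pairs
  exist at every scale (\<open>neighbours_differ\<close>), so this distance can be made as small as desired.

  The normal law of least squares is obtained without characteristic functions. A shift of the
  parameter both translates the law of the estimate and multiplies it by an exponential density;
  this formula of Cameron and Martin determines the law, because it says that the quotient by the
  Gaussian weight is invariant under translations (\<open>cameron_martin_imp_gaussian\<close>).
\<close>

section \<open>Gaussian measures through the Cameron--Martin formula\<close>

text \<open>
  Let \<open>\<lambda>\<close> be Lebesgue measure. In the product of \<open>\<nu>\<close> and \<open>\<lambda>\<close>, shift the second coordinate by the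
  first and then the first by the second; as both measures are invariant, Fubini's theorem gives
  \<open>\<nu>(A) \<lambda>(B) = \<nu>(B) \<lambda>(A)\<close>. Testing with the unit cube identifies \<open>\<nu>\<close>.
\<close>

lemma translation_invariant_measure_eq_scaled_lborel:
  fixes \<nu> :: "'a::euclidean_space measure"
  assumes sigma: "sigma_finite_measure \<nu>" and sets: "sets \<nu> = sets borel"
    and inv: "\<And>h. distr \<nu> borel (\<lambda>x. x + h) = \<nu>"
  shows "\<exists>C. \<nu> = density lborel (\<lambda>_. C)"
proof -
  interpret N: sigma_finite_measure \<nu> by (rule sigma)
  interpret NL: pair_sigma_finite \<nu> lborel by standard
  have meas[measurable_cong]: "sets \<nu> = sets borel" by (rule sets)
  define U :: "'a set" where "U = cbox 0 One"
  have U[measurable]: "U \<in> sets borel" by (simp add: U_def)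
  have lU: "emeasure lborel U = 1"
    unfolding U_def by (subst emeasure_lborel_cbox) (auto simp: inner_Basis)
  have swap: "emeasure \<nu> A * emeasure lborel B = emeasure \<nu> B * emeasure lborel A"
    if A[measurable]: "A \<in> sets borel" and B[measurable]: "B \<in> sets borel" for A B :: "'a set"
  proof -
    have "emeasure \<nu> A * emeasure lborel B = (\<integral>\<^sup>+x. \<integral>\<^sup>+y. indicator A x * indicator B y \<partial>lborel \<partial>\<nu>)"
      using A B by (simp add: nn_integral_cmult nn_integral_multc sets)
    also have "\<dots> = (\<integral>\<^sup>+x. \<integral>\<^sup>+y. indicator A x * indicator B (x + y) \<partial>lborel \<partial>\<nu>)"
    proof (rule nn_integral_cong)
      fix x :: 'a
      show "(\<integral>\<^sup>+y. indicator A x * indicator B y \<partial>lborel) = (\<integral>\<^sup>+y. indicator A x * indicator B (x + y) \<partial>lborel)"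
        by (subst lborel_distr_plus[of x, symmetric], subst nn_integral_distr) auto
    qed
    also have "\<dots> = (\<integral>\<^sup>+y. \<integral>\<^sup>+x. indicator A x * indicator B (x + y) \<partial>\<nu> \<partial>lborel)"
      by (rule NL.Fubini'[symmetric]) measurable
    also have "\<dots> = (\<integral>\<^sup>+y. \<integral>\<^sup>+x. indicator A (x - y) * indicator B x \<partial>\<nu> \<partial>lborel)"
    proof (rule nn_integral_cong)
      fix y :: 'a
      have "(\<integral>\<^sup>+x. indicator A (x - y) * indicator B x \<partial>\<nu>)
          = (\<integral>\<^sup>+x. indicator A (x - y) * indicator B x \<partial>distr \<nu> borel (\<lambda>x. x + y))"
        by (simp add: inv)
      also have "\<dots> = (\<integral>\<^sup>+x. indicator A x * indicator B (x + y) \<partial>\<nu>)"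
        by (subst nn_integral_distr) auto
      finally show "(\<integral>\<^sup>+x. indicator A x * indicator B (x + y) \<partial>\<nu>)
          = (\<integral>\<^sup>+x. indicator A (x - y) * indicator B x \<partial>\<nu>)" by simp
    qed
    also have "\<dots> = (\<integral>\<^sup>+x. \<integral>\<^sup>+y. indicator A (x - y) * indicator B x \<partial>lborel \<partial>\<nu>)"
      by (rule NL.Fubini') measurable
    also have "\<dots> = (\<integral>\<^sup>+x. emeasure lborel A * indicator B x \<partial>\<nu>)"
    proof (rule nn_integral_cong)
      fix x :: 'a
      have "(\<integral>\<^sup>+y. indicator A (x - y) * indicator B x \<partial>lborel)
          = (\<integral>\<^sup>+y. indicator A (x - y) \<partial>lborel) * indicator B x"
        by (subst nn_integral_multc) auto
      also have "(\<integral>\<^sup>+y. indicator A (x - y) \<partial>lborel) = (\<integral>\<^sup>+y. indicator A y \<partial>distr lborel borel (\<lambda>y. x - y))"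
        by (subst nn_integral_distr) auto
      also have "distr lborel borel (\<lambda>y. x - y) = lborel"
        by (subst (2) lborel_affine[of "-1" x]) (simp_all add: density_1)
      finally show "(\<integral>\<^sup>+y. indicator A (x - y) * indicator B x \<partial>lborel)
          = emeasure lborel A * indicator B x" using A by simp
    qed
    also have "\<dots> = emeasure \<nu> B * emeasure lborel A"
      using B by (subst nn_integral_cmult_indicator) (auto simp: sets mult.commute)
    finally show ?thesis .
  qed
  have "\<nu> = density lborel (\<lambda>_. emeasure \<nu> U)"
  proof (rule measure_eqI)
    show "sets \<nu> = sets (density lborel (\<lambda>_. emeasure \<nu> U))" by (simp add: sets)
    fix A assume "A \<in> sets \<nu>"
    then have A: "A \<in> sets borel" by (simp add: sets)
    show "emeasure \<nu> A = emeasure (density lborel (\<lambda>_. emeasure \<nu> U)) A"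
      using swap[OF A U] A by (simp add: lU emeasure_density_const)
  qed
  then show ?thesis by blast
qed

definition gaussian_weight :: "('a::euclidean_space \<Rightarrow> 'a) \<Rightarrow> 'a \<Rightarrow> real" where
  "gaussian_weight L x = exp (- (x \<bullet> L x) / 2)"

text \<open>
  The argument \<open>L\<close> is the precision operator, that is, the inverse of the covariance. The
  normalizing constant stays an integral, so that no determinant enters.
\<close>

definition gaussian :: "('a::euclidean_space \<Rightarrow> 'a) \<Rightarrow> 'a measure" where
  "gaussian L = density lborel (\<lambda>x. ennreal (gaussian_weight L x / (LINT y|lborel. gaussian_weight L y)))"

text \<open>
  This is the form in which the linear model supplies information about the law of an estimator:
  a shift of the parameter translates the estimator and acts on the sample by a likelihood ratio.
\<close>

definition cameron_martin :: "('a::euclidean_space \<Rightarrow> 'a) \<Rightarrow> 'a measure \<Rightarrow> bool" where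
  "cameron_martin L \<mu> \<longleftrightarrow>
     (\<forall>h. distr \<mu> borel (\<lambda>x. x + h) = density \<mu> (\<lambda>x. ennreal (exp (h \<bullet> L x - h \<bullet> L h / 2))))"

lemma borel_measurable_linear:
  fixes L :: "'a::euclidean_space \<Rightarrow> 'b::euclidean_space"
  assumes "linear L"
  shows "L \<in> borel_measurable borel"
  using assms linear_continuous_on[of L UNIV]
  by (intro borel_measurable_continuous_onI) (auto simp: linear_conv_bounded_linear)

lemma gaussian_weight_measurable [measurable]:
  assumes [measurable]: "L \<in> borel_measurable borel"
  shows "gaussian_weight L \<in> borel_measurable borel"
  unfolding gaussian_weight_def[abs_def] by measurable

lemma gaussian_weight_pos: "0 < gaussian_weight L x"
  by (simp add: gaussian_weight_def)

lemma inner_linear_add_square: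
  fixes L :: "'a::euclidean_space \<Rightarrow> 'a"
  assumes L: "linear L" and sym: "\<And>x y. x \<bullet> L y = L x \<bullet> y"
  shows "(x + h) \<bullet> L (x + h) = x \<bullet> L x + 2 * (h \<bullet> L x) + h \<bullet> L h"
proof -
  have "x \<bullet> L h = h \<bullet> L x" using sym[of x h] by (simp add: inner_commute)
  then show ?thesis by (simp add: linear_add[OF L] inner_add_left inner_add_right)
qed

text \<open>
  Divide \<open>\<mu>\<close> by the Gaussian weight. Completing the square shows that the quotient is invariant under
  translations, hence a multiple of Lebesgue measure. The argument is the same in every dimension and
  uses no square root of the covariance.
\<close>

theorem cameron_martin_imp_gaussian:
  fixes \<mu> :: "'a::euclidean_space measure"
  assumes prob: "prob_space \<mu>" and sets: "sets \<mu> = sets borel"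
    and L: "linear L" and sym: "\<And>x y. x \<bullet> L y = L x \<bullet> y"
    and cm: "cameron_martin L \<mu>"
  shows "\<mu> = gaussian L" "integrable lborel (gaussian_weight L)"
proof -
  interpret prob_space \<mu> by (rule prob)
  have [measurable]: "L \<in> borel_measurable borel" by (rule borel_measurable_linear[OF L])
  have meas[measurable_cong]: "sets \<mu> = sets borel" by (rule sets)
  define w where "w = gaussian_weight L"
  have w[measurable]: "w \<in> borel_measurable borel" and wpos: "w x > 0" for x
    by (auto simp: w_def gaussian_weight_pos)
  have nz: "w x \<noteq> 0" for x using wpos[of x] by simp
  define \<nu> where "\<nu> = density \<mu> (\<lambda>x. ennreal (1 / w x))"
  have "\<exists>C. \<nu> = density lborel (\<lambda>_. C)"
  proof (rule translation_invariant_measure_eq_scaled_lborel)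
    show "sigma_finite_measure \<nu>"
      unfolding \<nu>_def by (subst sigma_finite_iff_density_finite) (measurable; simp)+
    show "sets \<nu> = sets borel" by (simp add: \<nu>_def sets)
    fix h
    have "distr \<nu> borel (\<lambda>x. x + h) = density (distr \<mu> borel (\<lambda>x. x + h)) (\<lambda>x. ennreal (1 / w (x - h)))"
      unfolding \<nu>_def by (subst density_distr) auto
    also have "\<dots> = density (density \<mu> (\<lambda>x. ennreal (exp (h \<bullet> L x - h \<bullet> L h / 2)))) (\<lambda>x. ennreal (1 / w (x - h)))"
      using cm by (simp add: cameron_martin_def)
    also have "\<dots> = density \<mu> (\<lambda>x. ennreal (exp (h \<bullet> L x - h \<bullet> L h / 2)) * ennreal (1 / w (x - h)))"
      by (rule density_density_eq) measurable
    also have "(\<lambda>x. ennreal (exp (h \<bullet> L x - h \<bullet> L h / 2)) * ennreal (1 / w (x - h))) = (\<lambda>x. ennreal (1 / w x))"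
    proof
      fix x
      have "x \<bullet> L x = ((x - h) + h) \<bullet> L ((x - h) + h)" by simp
      also have "\<dots> = (x - h) \<bullet> L (x - h) + 2 * (h \<bullet> L (x - h)) + h \<bullet> L h"
        by (rule inner_linear_add_square[OF L sym])
      finally have eq: "x \<bullet> L x = (x - h) \<bullet> L (x - h) + 2 * (h \<bullet> L x) - h \<bullet> L h"
        by (simp add: linear_diff[OF L] inner_diff_right)
      have "exp (h \<bullet> L x - h \<bullet> L h / 2) * (1 / w (x - h)) = 1 / w x"
        unfolding w_def gaussian_weight_def
        by (simp add: exp_minus field_simps flip: exp_add) (simp add: eq)
      then show "ennreal (exp (h \<bullet> L x - h \<bullet> L h / 2)) * ennreal (1 / w (x - h)) = ennreal (1 / w x)"
        using wpos by (simp add: less_imp_le flip: ennreal_mult)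
    qed
    finally show "distr \<nu> borel (\<lambda>x. x + h) = \<nu>" by (simp add: \<nu>_def)
  qed
  then obtain C where C: "\<nu> = density lborel (\<lambda>_. C)" by blast
  have "\<mu> = density \<nu> (\<lambda>x. ennreal (w x))"
    unfolding \<nu>_def using wpos
    by (subst density_density_eq) (auto simp: less_imp_le nz density_1 simp flip: ennreal_mult)
  also have "\<dots> = density lborel (\<lambda>x. C * ennreal (w x))"
    unfolding C by (rule density_density_eq) auto
  finally have mu: "\<mu> = density lborel (\<lambda>x. C * ennreal (w x))" .
  define Z where "Z = (\<integral>\<^sup>+x. ennreal (w x) \<partial>lborel)"
  have "emeasure \<mu> (space \<mu>) = C * Z"
    unfolding Z_def by (subst mu, subst emeasure_density) (auto simp: nn_integral_cmult mu)
  then have CZ: "C * Z = 1" by (simp add: emeasure_space_1)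
  have Z_fin: "Z \<noteq> \<infinity>" using CZ by (cases "C = 0") (auto simp: ennreal_mult_top)
  have C_fin: "C \<noteq> \<infinity>" using CZ by (cases "Z = 0") (auto simp: ennreal_top_mult)
  show int: "integrable lborel (gaussian_weight L)"
    using Z_fin wpos unfolding Z_def w_def
    by (intro integrableI_nonneg) (auto simp: less_imp_le less_top)
  have Zr: "Z = ennreal (LINT y|lborel. w y)"
    unfolding Z_def using int wpos by (subst nn_integral_eq_integral) (auto simp: w_def less_imp_le gaussian_weight_pos)
  define z where "z = (LINT y|lborel. w y)"
  have z0: "z \<ge> 0" unfolding z_def by (intro integral_nonneg_AE) (auto simp: less_imp_le wpos)
  obtain r where r: "C = ennreal r" "r \<ge> 0" using C_fin by (cases C) auto
  have "ennreal (r * z) = ennreal 1" using CZ z0 r by (simp add: Zr z_def ennreal_mult)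
  then have rz: "r * z = 1" using z0 r by (subst (asm) ennreal_inj) auto
  then have "z \<noteq> 0" by auto
  with rz have "r = 1 / z" by (simp add: field_simps)
  then show "\<mu> = gaussian L"
    unfolding mu gaussian_def using r wpos
    by (simp add: w_def z_def less_imp_le field_simps flip: ennreal_mult)
qed

section \<open>Gaussian laws with a positive definite precision matrix\<close>

definition posdef :: "real ^ 'p ^ 'p \<Rightarrow> bool" where
  "posdef S \<longleftrightarrow> transpose S = S \<and> (\<forall>x. x \<noteq> 0 \<longrightarrow> 0 < x \<bullet> (S *v x))"

abbreviation normal_law :: "real ^ 'p ^ 'p \<Rightarrow> (real ^ 'p) measure" where
  "normal_law S \<equiv> gaussian ((*v) S)"

lemma symmetric_inner:
  "transpose S = S \<Longrightarrow> x \<bullet> (S *v y) = (S *v x) \<bullet> y" for S :: "real ^ 'p ^ 'p"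
  by (metis dot_lmul_matrix transpose_matrix_vector)

lemma mult_matrix_measurable [measurable]: "(*v) (S :: real ^ 'p ^ 'q) \<in> borel_measurable borel"
  by (intro borel_measurable_linear) simp

lemma tendsto_matrix_vector_mult:
  fixes S :: "'a \<Rightarrow> real ^ 'p ^ 'q"
  assumes "(S \<longlongrightarrow> T) F" "(v \<longlongrightarrow> w) F"
  shows "((\<lambda>n. S n *v v n) \<longlongrightarrow> T *v w) F"
  unfolding matrix_vector_mult_def
  by (intro vec_tendstoI) (simp, intro tendsto_sum tendsto_mult tendsto_vec_nth assms)

lemma abs_quadratic_form_le:
  fixes S :: "real ^ 'p ^ 'p"
  shows "\<bar>x \<bullet> (S *v x)\<bar> \<le> (\<Sum>i\<in>UNIV. \<Sum>j\<in>UNIV. \<bar>S $ i $ j\<bar>) * (norm x)\<^sup>2"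
proof -
  have "\<bar>x \<bullet> (S *v x)\<bar> = \<bar>\<Sum>i\<in>UNIV. \<Sum>j\<in>UNIV. x $ i * (S $ i $ j * x $ j)\<bar>"
    by (simp add: inner_vec_def matrix_vector_mult_def sum_distrib_left)
  also have "\<dots> \<le> (\<Sum>i\<in>UNIV. \<Sum>j\<in>UNIV. \<bar>x $ i * (S $ i $ j * x $ j)\<bar>)"
    by (intro order.trans[OF sum_abs] sum_mono order.refl)
  also have "\<dots> \<le> (\<Sum>i\<in>UNIV. \<Sum>j\<in>UNIV. \<bar>S $ i $ j\<bar> * (norm x)\<^sup>2)"
  proof (intro sum_mono)
    fix i j
    have "\<bar>x $ i\<bar> * \<bar>x $ j\<bar> \<le> norm x * norm x"
      by (intro mult_mono component_le_norm_cart) auto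
    then have "\<bar>S $ i $ j\<bar> * (\<bar>x $ i\<bar> * \<bar>x $ j\<bar>) \<le> \<bar>S $ i $ j\<bar> * (norm x)\<^sup>2"
      by (intro mult_left_mono) (auto simp: power2_eq_square)
    then show "\<bar>x $ i * (S $ i $ j * x $ j)\<bar> \<le> \<bar>S $ i $ j\<bar> * (norm x)\<^sup>2"
      by (simp add: abs_mult ac_simps)
  qed
  finally show ?thesis by (simp add: sum_distrib_right)
qed

text \<open>
  The quadratic form attains a positive minimum on the unit sphere.
\<close>

lemma posdef_coercive:
  fixes S :: "real ^ 'p ^ 'p"
  assumes S: "posdef S"
  obtains \<kappa> where "\<kappa> > 0" "\<And>x. \<kappa> * (norm x)\<^sup>2 \<le> x \<bullet> (S *v x)"
proof -
  have "continuous_on (sphere 0 1) (\<lambda>x. x \<bullet> (S *v x))"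
    by (intro continuous_intros linear_continuous_on) (simp add: linear_conv_bounded_linear[symmetric])
  moreover have "compact (sphere (0 :: real ^ 'p) 1)" by simp
  moreover have "axis (undefined :: 'p) 1 \<in> sphere (0 :: real ^ 'p) 1" by (simp add: norm_axis_1)
  then have "sphere (0 :: real ^ 'p) 1 \<noteq> {}" by blast
  ultimately obtain a where a: "a \<in> sphere 0 1" "\<And>x. x \<in> sphere 0 1 \<Longrightarrow> a \<bullet> (S *v a) \<le> x \<bullet> (S *v x)"
    using continuous_attains_inf by metis
  have "a \<noteq> 0" using a(1) by auto
  with S have "0 < a \<bullet> (S *v a)" by (simp add: posdef_def)
  moreover have "a \<bullet> (S *v a) * (norm x)\<^sup>2 \<le> x \<bullet> (S *v x)" for x
  proof (cases "x = 0")
    case False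
    have "a \<bullet> (S *v a) \<le> (x /\<^sub>R norm x) \<bullet> (S *v (x /\<^sub>R norm x))"
      using False by (intro a(2)) simp
    also have "\<dots> = (x \<bullet> (S *v x)) / (norm x)\<^sup>2"
      by (simp add: linear_scale[OF matrix_vector_mul_linear] power2_eq_square field_simps)
    finally show ?thesis using False by (simp add: pos_le_divide_eq)
  qed simp
  ultimately show ?thesis using that by blast
qed

text \<open>
  A common constant for the limit and all late members of the sequence yields an integrable majorant
  for the Gaussian weights and a uniform bound for the inverse matrices.
\<close>

lemma posdef_coercive_eventually:
  fixes S :: "nat \<Rightarrow> real ^ 'p ^ 'p"
  assumes T: "posdef T" and lim: "S \<longlonglongrightarrow> T"
  obtains \<kappa> where "\<kappa> > 0" "\<And>x. \<kappa> * (norm x)\<^sup>2 \<le> x \<bullet> (T *v x)"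
    "eventually (\<lambda>n. \<forall>x. \<kappa> * (norm x)\<^sup>2 \<le> x \<bullet> (S n *v x)) sequentially"
proof -
  obtain \<kappa> where k: "\<kappa> > 0" "\<And>x. \<kappa> * (norm x)\<^sup>2 \<le> x \<bullet> (T *v x)"
    using posdef_coercive[OF T] by blast
  define N where "N = (\<lambda>n. \<Sum>i\<in>UNIV. \<Sum>j\<in>UNIV. \<bar>(T - S n) $ i $ j\<bar>)"
  have "N \<longlonglongrightarrow> (\<Sum>i\<in>UNIV. \<Sum>j\<in>UNIV. \<bar>(T - T) $ i $ j\<bar>)"
    unfolding N_def by (intro tendsto_intros lim)
  then have "eventually (\<lambda>n. N n < \<kappa> / 2) sequentially"
    using k(1) by (intro order_tendstoD(2)) auto
  then have "eventually (\<lambda>n. \<forall>x. \<kappa> / 2 * (norm x)\<^sup>2 \<le> x \<bullet> (S n *v x)) sequentially"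
  proof (eventually_elim, safe)
    fix n x assume n: "N n < \<kappa> / 2"
    have "x \<bullet> (T *v x) - x \<bullet> (S n *v x) = x \<bullet> ((T - S n) *v x)"
      by (simp add: matrix_vector_mult_diff_rdistrib inner_diff_right)
    also have "\<dots> \<le> N n * (norm x)\<^sup>2"
      using abs_quadratic_form_le[of x "T - S n"] by (simp add: N_def)
    also have "\<dots> \<le> \<kappa> / 2 * (norm x)\<^sup>2" using n by (intro mult_right_mono) auto
    finally show "\<kappa> / 2 * (norm x)\<^sup>2 \<le> x \<bullet> (S n *v x)" using k(2)[of x] by simp
  qed
  moreover have "\<kappa> / 2 * (norm x)\<^sup>2 \<le> x \<bullet> (T *v x)" for x
  proof -
    have "0 \<le> \<kappa> * (norm x)\<^sup>2" using k(1) by simp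
    then show ?thesis using k(2)[of x] by simp
  qed
  ultimately show ?thesis using that[of "\<kappa> / 2"] k(1) by auto
qed

text \<open>
  The integrand is a product over the standard basis, and each factor is a normal integral.
\<close>

lemma integrable_exp_neg_norm_square:
  assumes "\<kappa> > 0"
  shows "integrable lborel (\<lambda>x :: 'a::euclidean_space. exp (- \<kappa> * (norm x)\<^sup>2 / 2))"
proof (rule integrableI_nonneg)
  define s where "s = 1 / sqrt \<kappa>"
  have s: "s > 0" "\<kappa> = 1 / s\<^sup>2" using assms by (auto simp: s_def power_divide)
  have one: "(\<integral>\<^sup>+t. ennreal (exp (- \<kappa> * t\<^sup>2 / 2)) \<partial>lborel) < \<infinity>"
  proof -
    have "(\<lambda>t. exp (- \<kappa> * t\<^sup>2 / 2)) = (\<lambda>t. sqrt (2 * pi * s\<^sup>2) * normal_density 0 s t)"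
      using s by (auto simp: normal_density_def fun_eq_iff field_simps)
    moreover have "integrable lborel (\<lambda>t. sqrt (2 * pi * s\<^sup>2) * normal_density 0 s t)"
      using s by (intro integrable_mult_right) auto
    ultimately have "integrable lborel (\<lambda>t::real. exp (- \<kappa> * t\<^sup>2 / 2))" by simp
    then show ?thesis by (simp add: integrable_iff_bounded)
  qed
  have "ennreal (exp (- \<kappa> * (norm x)\<^sup>2 / 2)) = (\<Prod>b\<in>Basis. ennreal (exp (- \<kappa> * (x \<bullet> b)\<^sup>2 / 2)))" for x :: 'a
  proof -
    have "- \<kappa> * (norm x)\<^sup>2 / 2 = (\<Sum>b\<in>Basis. - \<kappa> * (x \<bullet> b)\<^sup>2 / 2)"
    proof -
      have "(norm x)\<^sup>2 = (\<Sum>b\<in>Basis. (x \<bullet> b)\<^sup>2)"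
        by (subst power2_norm_eq_inner, subst euclidean_inner) (simp add: power2_eq_square)
      then show ?thesis by (simp only: sum_distrib_left sum_divide_distrib)
    qed
    then show ?thesis by (simp add: exp_sum prod_ennreal)
  qed
  then have "(\<integral>\<^sup>+x. ennreal (exp (- \<kappa> * (norm x)\<^sup>2 / 2)) \<partial>(lborel :: 'a measure))
      = (\<integral>\<^sup>+x. (\<Prod>b\<in>Basis. ennreal (exp (- \<kappa> * (x \<bullet> b)\<^sup>2 / 2))) \<partial>(lborel :: 'a measure))" by simp
  also have "\<dots> = (\<Prod>b\<in>(Basis :: 'a set). \<integral>\<^sup>+t. ennreal (exp (- \<kappa> * t\<^sup>2 / 2)) \<partial>lborel)"
    by (rule nn_integral_lborel_prod) auto
  also have "\<dots> < \<infinity>"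
    using one by (simp add: less_top[symmetric] power_eq_top_ennreal)
  finally show "(\<integral>\<^sup>+x. ennreal (exp (- \<kappa> * (norm x)\<^sup>2 / 2)) \<partial>(lborel :: 'a measure)) < \<infinity>" .
qed auto

lemma gaussian_weight_le:
  assumes "\<kappa> * (norm x)\<^sup>2 \<le> x \<bullet> L x"
  shows "gaussian_weight L x \<le> exp (- \<kappa> * (norm x)\<^sup>2 / 2)"
  using assms by (simp add: gaussian_weight_def)

lemma integrable_gaussian_weight:
  assumes "linear L" "\<kappa> > 0" "\<And>x. \<kappa> * (norm x)\<^sup>2 \<le> x \<bullet> L x"
  shows "integrable lborel (gaussian_weight L)"
  by (rule Bochner_Integration.integrable_bound[OF integrable_exp_neg_norm_square[OF assms(2)]])
     (use borel_measurable_linear[OF assms(1)] gaussian_weight_le[where L = L, OF assms(3)] in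
       \<open>auto simp: less_imp_le[OF gaussian_weight_pos]\<close>)

lemma integral_gaussian_weight_pos:
  fixes L :: "'a::euclidean_space \<Rightarrow> 'a"
  assumes "integrable lborel (gaussian_weight L)"
  shows "0 < (LINT x|lborel. gaussian_weight L x)"
proof -
  have "(LINT x|lborel. gaussian_weight L x) \<noteq> 0"
  proof
    assume "(LINT x|lborel. gaussian_weight L x) = 0"
    then have "AE x in lborel. gaussian_weight L x = 0"
      using assms by (subst (asm) integral_nonneg_eq_0_iff_AE) (auto simp: less_imp_le[OF gaussian_weight_pos])
    then have "AE x in (lborel :: 'a measure). False"
      by eventually_elim (metis gaussian_weight_pos less_irrefl)
    then show False by (simp add: AE_iff_null null_sets_def)
  qed
  moreover have "0 \<le> (LINT x|lborel. gaussian_weight L x)"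
    by (intro integral_nonneg_AE) (auto simp: less_imp_le[OF gaussian_weight_pos])
  ultimately show ?thesis by simp
qed

lemma sets_gaussian [measurable_cong, simp]: "sets (gaussian L) = sets borel"
  and space_gaussian [simp]: "space (gaussian L) = UNIV"
  by (simp_all add: gaussian_def)

lemma measure_gaussian:
  assumes L: "linear L" and int: "integrable lborel (gaussian_weight L)" and B: "B \<in> sets borel"
  shows "measure (gaussian L) B =
    (LINT x|lborel. indicator B x * gaussian_weight L x) / (LINT x|lborel. gaussian_weight L x)"
proof -
  have [measurable]: "L \<in> borel_measurable borel" by (rule borel_measurable_linear[OF L])
  note B[measurable]
  define Z where "Z = (LINT x|lborel. gaussian_weight L x)"
  have Z: "Z > 0" unfolding Z_def by (rule integral_gaussian_weight_pos[OF int])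
  have "measure (gaussian L) B = (LINT x|gaussian L. indicator B x)" using B by simp
  also have "\<dots> = (LINT x|lborel. (gaussian_weight L x / Z) * indicator B x)"
    unfolding gaussian_def Z_def[symmetric]
    by (subst integral_density) (use Z in \<open>auto simp: less_imp_le[OF gaussian_weight_pos]\<close>)
  also have "\<dots> = (LINT x|lborel. indicator B x * gaussian_weight L x / Z)"
    by (simp add: ac_simps)
  finally show ?thesis by (simp add: Z_def)
qed

lemma prob_space_gaussian:
  assumes L: "linear L" and int: "integrable lborel (gaussian_weight L)"
  shows "prob_space (gaussian L)"
proof -
  have [measurable]: "L \<in> borel_measurable borel" by (rule borel_measurable_linear[OF L])
  define Z where "Z = (LINT x|lborel. gaussian_weight L x)"
  have Z: "Z > 0" unfolding Z_def by (rule integral_gaussian_weight_pos[OF int])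
  have "emeasure (gaussian L) UNIV = (\<integral>\<^sup>+x. ennreal (gaussian_weight L x / Z) \<partial>lborel)"
    unfolding gaussian_def Z_def[symmetric] by (subst emeasure_density) auto
  also have "\<dots> = ennreal (LINT x|lborel. gaussian_weight L x / Z)"
    using int Z by (intro nn_integral_eq_integral) (auto simp: less_imp_le[OF gaussian_weight_pos])
  also have "\<dots> = 1" using Z by (simp add: Z_def)
  finally show ?thesis by (intro prob_spaceI) simp
qed

text \<open>
  Besides its role for marginals, this converse allows comparing the masses of two sets that are
  translates of each other.
\<close>

lemma cameron_martin_gaussian:
  assumes L: "linear L" and sym: "\<And>x y. x \<bullet> L y = L x \<bullet> y"
  shows "cameron_martin L (gaussian L)"
  unfolding cameron_martin_def
proof
  fix h
  have [measurable]: "L \<in> borel_measurable borel" by (rule borel_measurable_linear[OF L])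
  define Z where "Z = (LINT x|lborel. gaussian_weight L x)"
  have Z: "Z \<ge> 0" unfolding Z_def
    by (intro integral_nonneg_AE) (auto simp: less_imp_le[OF gaussian_weight_pos])
  have "distr (gaussian L) borel (\<lambda>x. x + h)
      = density (distr lborel borel (\<lambda>x. x + h)) (\<lambda>x. ennreal (gaussian_weight L (x - h) / Z))"
    unfolding gaussian_def Z_def[symmetric] by (subst density_distr) auto
  also have "distr lborel borel (\<lambda>x. x + h) = lborel"
  proof -
    have "(\<lambda>x. x + h) = (+) h" by (auto simp: add.commute)
    then show ?thesis by (simp only: lborel_distr_plus)
  qed
  also have "(\<lambda>x. ennreal (gaussian_weight L (x - h) / Z))
      = (\<lambda>x. ennreal (gaussian_weight L x / Z) * ennreal (exp (h \<bullet> L x - h \<bullet> L h / 2)))"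
  proof
    fix x
    have "x \<bullet> L x = ((x - h) + h) \<bullet> L ((x - h) + h)" by simp
    also have "\<dots> = (x - h) \<bullet> L (x - h) + 2 * (h \<bullet> L (x - h)) + h \<bullet> L h"
      by (rule inner_linear_add_square[OF L sym])
    finally have eq: "x \<bullet> L x = (x - h) \<bullet> L (x - h) + 2 * (h \<bullet> L x) - h \<bullet> L h"
      by (simp add: linear_diff[OF L] inner_diff_right)
    have "gaussian_weight L (x - h) = gaussian_weight L x * exp (h \<bullet> L x - h \<bullet> L h / 2)"
      unfolding gaussian_weight_def by (simp flip: exp_add) (simp add: eq field_simps)
    then have "gaussian_weight L (x - h) / Z = gaussian_weight L x / Z * exp (h \<bullet> L x - h \<bullet> L h / 2)"
      by simp
    then show "ennreal (gaussian_weight L (x - h) / Z)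
        = ennreal (gaussian_weight L x / Z) * ennreal (exp (h \<bullet> L x - h \<bullet> L h / 2))"
      using Z by (simp add: less_imp_le[OF gaussian_weight_pos] flip: ennreal_mult)
  qed
  also have "density lborel \<dots> = density (gaussian L) (\<lambda>x. ennreal (exp (h \<bullet> L x - h \<bullet> L h / 2)))"
    unfolding gaussian_def Z_def[symmetric] by (subst density_density_eq) auto
  finally show "distr (gaussian L) borel (\<lambda>x. x + h)
    = density (gaussian L) (\<lambda>x. ennreal (exp (h \<bullet> L x - h \<bullet> L h / 2)))" .
qed

lemma std_normal_eq_gaussian: "std_normal_distribution = gaussian (\<lambda>x::real. x)"
proof -
  have w: "gaussian_weight (\<lambda>x::real. x) x = sqrt (2 * pi) * std_normal_density x" for x
    by (simp add: gaussian_weight_def std_normal_density_def power2_eq_square)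
  have "(LINT x|lborel. gaussian_weight (\<lambda>x::real. x) x) = sqrt (2 * pi) * (LINT x|lborel. std_normal_density x)"
    unfolding w by simp
  also have "\<dots> = sqrt (2 * pi)" using integral_normal_density[of 1 0] by simp
  finally show ?thesis by (simp add: gaussian_def w)
qed

text \<open>
  A translation along \<open>v\<close> shifts the functional \<open>e\<close> and tilts the law by a density that is a function
  of \<open>e\<close> alone. The law of the functional thus inherits the Cameron--Martin formula, now on the line.
\<close>

lemma gaussian_marginal_std_normal:
  fixes L :: "'a::euclidean_space \<Rightarrow> 'a"
  assumes L: "linear L" and sym: "\<And>x y. x \<bullet> L y = L x \<bullet> y"
    and int: "integrable lborel (gaussian_weight L)"
    and v: "L v = e" and \<tau>: "\<tau> > 0" "\<tau>\<^sup>2 = e \<bullet> v"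
  shows "distr (gaussian L) borel (\<lambda>w. (e \<bullet> w) / \<tau>) = std_normal_distribution"
proof -
  have [measurable]: "L \<in> borel_measurable borel" by (rule borel_measurable_linear[OF L])
  interpret prob_space "gaussian L" by (rule prob_space_gaussian[OF L int])
  let ?f = "\<lambda>w. (e \<bullet> w) / \<tau>"
  have "cameron_martin (\<lambda>x::real. x) (distr (gaussian L) borel ?f)"
    unfolding cameron_martin_def
  proof
    fix h :: real
    define u where "u = (h / \<tau>) *\<^sub>R v"
    have Lu: "u \<bullet> L w = h * ?f w" for w
      using sym[of v w] v by (simp add: u_def field_simps)
    have shift: "?f (w + u) = ?f w + h" for w
      using \<tau>(1) by (simp add: u_def inner_add_right add_divide_distrib power2_eq_square flip: \<tau>(2))
    have uu: "u \<bullet> L u = h * h"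
    proof -
      have "u \<bullet> L u = h * ?f u" by (rule Lu)
      moreover have "?f u = h" using shift[of 0] by simp
      ultimately show ?thesis by simp
    qed
    have "distr (distr (gaussian L) borel ?f) borel (\<lambda>x. x + h) = distr (gaussian L) borel (\<lambda>w. ?f (w + u))"
      by (subst distr_distr) (auto simp: o_def shift)
    also have "\<dots> = distr (distr (gaussian L) borel (\<lambda>w. w + u)) borel ?f"
      by (subst distr_distr) (auto simp: o_def)
    also have "\<dots> = distr (density (gaussian L) (\<lambda>w. ennreal (exp (h * ?f w - h * h / 2)))) borel ?f"
      using cameron_martin_gaussian[OF L sym] by (simp only: cameron_martin_def Lu[symmetric] uu[symmetric])
    also have "\<dots> = density (distr (gaussian L) borel ?f) (\<lambda>x. ennreal (exp (h * x - h * h / 2)))"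
      by (subst density_distr) auto
    finally show "distr (distr (gaussian L) borel ?f) borel (\<lambda>x. x + h)
      = density (distr (gaussian L) borel ?f) (\<lambda>x. ennreal (exp (h \<bullet> x - h \<bullet> h / 2)))"
      by simp
  qed
  then show ?thesis
    unfolding std_normal_eq_gaussian
    by (intro cameron_martin_imp_gaussian prob_space_distr) (auto simp: linear_id[unfolded id_def])
qed

lemma gaussian_open_pos:
  assumes L: "linear L" and int: "integrable lborel (gaussian_weight L)"
    and U: "open U" "U \<noteq> {}"
  shows "0 < measure (gaussian L) U"
proof -
  have [measurable]: "L \<in> borel_measurable borel" by (rule borel_measurable_linear[OF L])
  have Um[measurable]: "U \<in> sets borel" using U by simp
  interpret prob_space "gaussian L" by (rule prob_space_gaussian[OF L int])
  define Z where "Z = (LINT x|lborel. gaussian_weight L x)"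
  have Z: "Z > 0" unfolding Z_def by (rule integral_gaussian_weight_pos[OF int])
  have "emeasure (gaussian L) U \<noteq> 0"
  proof
    assume "emeasure (gaussian L) U = 0"
    then have "AE x in lborel. x \<in> U \<longrightarrow> ennreal (gaussian_weight L x / Z) = 0"
      unfolding gaussian_def Z_def[symmetric] by (subst (asm) emeasure_density) (auto simp: nn_integral_0_iff_AE indicator_def)
    then have "AE x in lborel. x \<notin> U"
    proof eventually_elim
      fix x assume x: "x \<in> U \<longrightarrow> ennreal (gaussian_weight L x / Z) = 0"
      have "gaussian_weight L x / Z > 0" using Z gaussian_weight_pos[of L x] by simp
      with x show "x \<notin> U" by (auto simp: ennreal_eq_0_iff)
    qed
    then have "U \<in> null_sets lborel" by (subst (asm) AE_iff_null_sets[symmetric]) auto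
    then have "negligible U" by (simp add: negligible_iff_null_sets null_sets_completionI)
    then show False using U open_not_negligible by blast
  qed
  then show ?thesis by (simp add: emeasure_eq_measure zero_less_measure_iff)
qed

lemma posdef_scale: "r > 0 \<Longrightarrow> posdef S \<Longrightarrow> posdef (r *\<^sub>R S)" for S :: "real ^ 'p ^ 'p"
  by (auto simp: posdef_def scaleR_matrix_vector_assoc[symmetric] transpose_def vec_eq_iff)

lemma posdef_integrable_weight:
  assumes "posdef S"
  shows "integrable lborel (gaussian_weight ((*v) S))"
  by (rule posdef_coercive[OF assms]) (rule integrable_gaussian_weight, auto)

lemma prob_space_normal_law: "posdef S \<Longrightarrow> prob_space (normal_law S)"
  by (intro prob_space_gaussian posdef_integrable_weight) auto

text \<open>
  The unnormalized densities converge under a common integrable majorant, so the probabilities converge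
  on all Borel sets and not only on continuity sets.
\<close>

lemma normal_law_tendsto:
  fixes S :: "nat \<Rightarrow> real ^ 'p ^ 'p"
  assumes T: "posdef T" and lim: "S \<longlonglongrightarrow> T" and B: "B \<in> sets borel"
  shows "(\<lambda>n. measure (normal_law (S n)) B) \<longlonglongrightarrow> measure (normal_law T) B"
proof -
  obtain \<kappa> where k: "\<kappa> > 0" "\<And>x. \<kappa> * (norm x)\<^sup>2 \<le> x \<bullet> (T *v x)"
    and ev: "eventually (\<lambda>n. \<forall>x. \<kappa> * (norm x)\<^sup>2 \<le> x \<bullet> (S n *v x)) sequentially"
    using posdef_coercive_eventually[OF T lim] by blast
  obtain N where N: "\<And>n x. n \<ge> N \<Longrightarrow> \<kappa> * (norm x)\<^sup>2 \<le> x \<bullet> (S n *v x)"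
    using ev by (auto simp: eventually_sequentially)
  have conv: "(\<lambda>n. LINT x|lborel. indicator B x * gaussian_weight ((*v) (S (n + N))) x)
      \<longlonglongrightarrow> (LINT x|lborel. indicator B x * gaussian_weight ((*v) T) x)"
    if B[measurable]: "B \<in> sets borel" for B
  proof (rule integral_dominated_convergence)
    show "integrable lborel (\<lambda>x :: real ^ 'p. exp (- \<kappa> * (norm x)\<^sup>2 / 2))"
      by (rule integrable_exp_neg_norm_square[OF k(1)])
    show "AE x in lborel. (\<lambda>n. indicator B x * gaussian_weight ((*v) (S (n + N))) x)
        \<longlonglongrightarrow> indicator B x * gaussian_weight ((*v) T) x"
      unfolding gaussian_weight_def
      by (intro AE_I2 tendsto_intros tendsto_matrix_vector_mult LIMSEQ_ignore_initial_segment lim) simp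
    show "AE x in lborel. norm (indicator B x * gaussian_weight ((*v) (S (n + N))) x)
        \<le> exp (- \<kappa> * (norm x)\<^sup>2 / 2)" for n
      using gaussian_weight_le[where L = "(*v) (S (n + N))", OF N[of "n + N"]]
      by (intro AE_I2) (auto simp: indicator_def less_imp_le[OF gaussian_weight_pos])
  qed measurable
  have "(\<lambda>n. measure (normal_law (S (n + N))) B) \<longlonglongrightarrow> measure (normal_law T) B"
  proof -
    have pos: "0 < (LINT x|lborel. gaussian_weight ((*v) T) x)"
      by (intro integral_gaussian_weight_pos posdef_integrable_weight T)
    have int: "integrable lborel (gaussian_weight ((*v) (S (n + N))))" for n
      by (rule integrable_gaussian_weight[OF _ k(1)]) (auto intro: N)
    show ?thesis
      using conv[OF B] conv[of UNIV] pos
      by (simp add: measure_gaussian int posdef_integrable_weight[OF T] B tendsto_divide)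
  qed
  then show ?thesis by (rule LIMSEQ_offset)
qed

section \<open>Likelihood ratios in the linear model\<close>

abbreviation (input) normal_measure :: "real \<Rightarrow> real \<Rightarrow> real measure" where
  "normal_measure \<mu> \<sigma> \<equiv> density lborel (\<lambda>x. ennreal (normal_density \<mu> \<sigma> x))"

lemma sample_space_measurable_cong:
  "(\<And>m. sets (M m) = sets borel) \<Longrightarrow> sets (PiM {..<n} M) = sets (sample_space n)"
  unfolding sample_space_def by (intro sets_PiM_cong) auto

lemma product_prob_space_normal:
  assumes "\<sigma> > 0"
  shows "product_prob_space (\<lambda>m. normal_measure (a m) \<sigma>)"
  by (intro product_prob_spaceI prob_space_normal_density assms)

lemma measurable_component_sample_space [measurable (raw)]:
  "m < n \<Longrightarrow> (\<lambda>Y. Y m) \<in> borel_measurable (sample_space n)"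
  unfolding sample_space_def by (rule measurable_component_singleton) simp

lemma sets_sample_law [measurable_cong, simp]: "sets (sample_law n D \<theta> \<sigma>) = sets (sample_space n)"
  and space_sample_law [simp]: "space (sample_law n D \<theta> \<sigma>) = space (sample_space n)"
  by (simp_all add: sample_law_def)

lemma normal_measure_translate:
  assumes "\<sigma> > 0"
  shows "distr (normal_measure 0 \<sigma>) borel (\<lambda>x. a + x) = normal_measure a \<sigma>"
proof -
  have "distr (normal_measure 0 \<sigma>) borel (\<lambda>x. a + x)
      = density (distr lborel borel (\<lambda>x. a + x)) (\<lambda>x. ennreal (normal_density 0 \<sigma> (x - a)))"
    by (subst density_distr) auto
  also have "distr lborel borel (\<lambda>x. a + x) = lborel" by (rule lborel_distr_plus)
  finally show ?thesis by (simp add: normal_density_def)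
qed

lemma sample_law_eq_PiM:
  assumes s: "\<sigma> > 0"
  shows "sample_law n D \<theta> \<sigma> = PiM {..<n} (\<lambda>m. normal_measure (D m \<bullet> \<theta>) \<sigma>)"
proof -
  interpret N: product_prob_space "\<lambda>m::nat. normal_measure a \<sigma>" for a
    by (rule product_prob_space_normal[OF s])
  interpret F: product_prob_space "\<lambda>m. normal_measure (D m \<bullet> \<theta>) \<sigma>"
    by (rule product_prob_space_normal[OF s])
  show ?thesis
  proof (rule F.PiM_eqI)
    show "sets (sample_law n D \<theta> \<sigma>) = sets (PiM {..<n} (\<lambda>m. normal_measure (D m \<bullet> \<theta>) \<sigma>))"
      by (simp add: sample_space_measurable_cong)
    fix A :: "nat \<Rightarrow> real set"
    assume "\<And>m. m \<in> {..<n} \<Longrightarrow> A m \<in> sets (normal_measure (D m \<bullet> \<theta>) \<sigma>)"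
    then have A: "\<And>m. m < n \<Longrightarrow> A m \<in> sets borel" by simp
    let ?N = "PiM {..<n} (\<lambda>_. normal_measure 0 \<sigma>)"
    let ?f = "\<lambda>u. \<lambda>m\<in>{..<n}. D m \<bullet> \<theta> + u m"
    have f: "?f \<in> measurable ?N (sample_space n)"
      unfolding sample_space_def by measurable
    have AS: "Pi\<^sub>E {..<n} A \<in> sets (sample_space n)"
      unfolding sample_space_def using A by (intro sets_PiM_I_finite) auto
    have "emeasure (sample_law n D \<theta> \<sigma>) (Pi\<^sub>E {..<n} A) = emeasure ?N (?f -` Pi\<^sub>E {..<n} A \<inter> space ?N)"
      unfolding sample_law_def by (rule emeasure_distr[OF f AS])
    also have "?f -` Pi\<^sub>E {..<n} A \<inter> space ?N = Pi\<^sub>E {..<n} (\<lambda>m. (\<lambda>x. D m \<bullet> \<theta> + x) -` A m)"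
      by (auto simp: space_PiM PiE_iff)
    also have "emeasure ?N \<dots> = (\<Prod>m\<in>{..<n}. emeasure (normal_measure 0 \<sigma>) ((\<lambda>x. D m \<bullet> \<theta> + x) -` A m))"
      using A by (intro N.emeasure_PiM) (auto intro!: measurable_sets_borel[OF _ A])
    also have "\<dots> = (\<Prod>m\<in>{..<n}. emeasure (normal_measure (D m \<bullet> \<theta>) \<sigma>) (A m))"
      using A by (intro prod.cong refl, subst normal_measure_translate[OF s, symmetric], subst emeasure_distr) auto
    finally show "emeasure (sample_law n D \<theta> \<sigma>) (Pi\<^sub>E {..<n} A)
      = (\<Prod>m\<in>{..<n}. emeasure (normal_measure (D m \<bullet> \<theta>) \<sigma>) (A m))" .
  qed simp
qed

lemma prob_space_sample_law:
  assumes s: "\<sigma> > 0" shows "prob_space (sample_law n D \<theta> \<sigma>)"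
  unfolding sample_law_eq_PiM[OF s] by (intro prob_space_PiM prob_space_normal_density s)

text \<open>
  The density of the law at \<open>\<theta> + h\<close> relative to the law at \<open>\<theta>\<close>.
\<close>

definition likelihood_ratio ::
  "nat \<Rightarrow> (nat \<Rightarrow> real ^ 'p) \<Rightarrow> real ^ 'p \<Rightarrow> real ^ 'p \<Rightarrow> real \<Rightarrow> (nat \<Rightarrow> real) \<Rightarrow> real" where
  "likelihood_ratio n D \<theta> h \<sigma> Y =
     exp ((\<Sum>m<n. (D m \<bullet> h) * (Y m - D m \<bullet> \<theta>)) / \<sigma>\<^sup>2 - (\<Sum>m<n. (D m \<bullet> h)\<^sup>2) / (2 * \<sigma>\<^sup>2))"

lemma likelihood_ratio_measurable [measurable]:
  "likelihood_ratio n D \<theta> h \<sigma> \<in> borel_measurable (sample_space n)"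
  unfolding likelihood_ratio_def[abs_def] by measurable

lemma sample_law_shift:
  assumes s: "\<sigma> > 0"
  shows "sample_law n D (\<theta> + h) \<sigma> = density (sample_law n D \<theta> \<sigma>) (\<lambda>Y. ennreal (likelihood_ratio n D \<theta> h \<sigma> Y))"
proof -
  define l where "l = (\<lambda>m x. exp ((D m \<bullet> h) * (x - D m \<bullet> \<theta>) / \<sigma>\<^sup>2 - (D m \<bullet> h)\<^sup>2 / (2 * \<sigma>\<^sup>2)))"
  have l[measurable]: "l m \<in> borel_measurable borel" for m unfolding l_def by measurable
  have lpos: "l m x > 0" for m x by (simp add: l_def)
  interpret F0: product_prob_space "\<lambda>m. normal_measure (D m \<bullet> \<theta>) \<sigma>"
    by (rule product_prob_space_normal[OF s])
  interpret F1: product_prob_space "\<lambda>m. normal_measure (D m \<bullet> (\<theta> + h)) \<sigma>"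
    by (rule product_prob_space_normal[OF s])
  have lr: "likelihood_ratio n D \<theta> h \<sigma> Y = (\<Prod>m<n. l m (Y m))" for Y
    by (simp add: likelihood_ratio_def l_def sum_divide_distrib flip: exp_sum sum_subtractf)
  have one: "normal_density (D m \<bullet> (\<theta> + h)) \<sigma> x = normal_density (D m \<bullet> \<theta>) \<sigma> x * l m x" for m x
  proof -
    have "- (x - D m \<bullet> (\<theta> + h))\<^sup>2 / (2 * \<sigma>\<^sup>2)
      = - (x - D m \<bullet> \<theta>)\<^sup>2 / (2 * \<sigma>\<^sup>2) + ((D m \<bullet> h) * (x - D m \<bullet> \<theta>) / \<sigma>\<^sup>2 - (D m \<bullet> h)\<^sup>2 / (2 * \<sigma>\<^sup>2))"
      using s by (simp add: field_simps inner_add_right power2_eq_square)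
    then show ?thesis by (simp add: normal_density_def l_def flip: exp_add)
  qed
  have "density (sample_law n D \<theta> \<sigma>) (\<lambda>Y. ennreal (likelihood_ratio n D \<theta> h \<sigma> Y))
      = PiM {..<n} (\<lambda>m. normal_measure (D m \<bullet> (\<theta> + h)) \<sigma>)"
  proof (rule F1.PiM_eqI)
    show "sets (density (sample_law n D \<theta> \<sigma>) (\<lambda>Y. ennreal (likelihood_ratio n D \<theta> h \<sigma> Y)))
      = sets (PiM {..<n} (\<lambda>m. normal_measure (D m \<bullet> (\<theta> + h)) \<sigma>))"
      by (simp add: sample_space_measurable_cong)
    fix A :: "nat \<Rightarrow> real set"
    assume "\<And>m. m \<in> {..<n} \<Longrightarrow> A m \<in> sets (normal_measure (D m \<bullet> (\<theta> + h)) \<sigma>)"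
    then have A[measurable]: "\<And>m. m < n \<Longrightarrow> A m \<in> sets borel" by simp
    have AS: "Pi\<^sub>E {..<n} A \<in> sets (sample_space n)"
      unfolding sample_space_def using A by (intro sets_PiM_I_finite) auto
    have "emeasure (density (sample_law n D \<theta> \<sigma>) (\<lambda>Y. ennreal (likelihood_ratio n D \<theta> h \<sigma> Y))) (Pi\<^sub>E {..<n} A)
      = (\<integral>\<^sup>+Y. ennreal (likelihood_ratio n D \<theta> h \<sigma> Y) * indicator (Pi\<^sub>E {..<n} A) Y \<partial>sample_law n D \<theta> \<sigma>)"
      using AS by (subst emeasure_density) auto
    also have "\<dots> = (\<integral>\<^sup>+Y. (\<Prod>m<n. ennreal (l m (Y m)) * indicator (A m) (Y m)) \<partial>sample_law n D \<theta> \<sigma>)"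
    proof (rule nn_integral_cong)
      fix Y assume "Y \<in> space (sample_law n D \<theta> \<sigma>)"
      then have Y: "Y \<in> extensional {..<n}" by (simp add: sample_space_def space_PiM PiE_def)
      have "indicator (Pi\<^sub>E {..<n} A) Y = (\<Prod>m<n. indicator (A m) (Y m) :: ennreal)"
      proof (cases "Y \<in> Pi\<^sub>E {..<n} A")
        case False
        then obtain m where "m < n" "Y m \<notin> A m" using Y by (auto simp: PiE_iff)
        then have "(\<Prod>m<n. indicator (A m) (Y m) :: ennreal) = 0"
          by (intro prod_zero bexI[of _ m]) auto
        with False show ?thesis by simp
      qed (auto simp: PiE_iff intro!: prod.neutral[symmetric])
      then show "ennreal (likelihood_ratio n D \<theta> h \<sigma> Y) * indicator (Pi\<^sub>E {..<n} A) Y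
        = (\<Prod>m<n. ennreal (l m (Y m)) * indicator (A m) (Y m))"
        by (simp add: lr prod_ennreal[symmetric] less_imp_le[OF lpos] prod.distrib)
    qed
    also have "\<dots> = (\<Prod>m<n. \<integral>\<^sup>+x. ennreal (l m x) * indicator (A m) x \<partial>normal_measure (D m \<bullet> \<theta>) \<sigma>)"
      unfolding sample_law_eq_PiM[OF s]
      by (rule F0.product_nn_integral_prod) auto
    also have "\<dots> = (\<Prod>m<n. emeasure (normal_measure (D m \<bullet> (\<theta> + h)) \<sigma>) (A m))"
    proof (intro prod.cong refl)
      fix m assume "m \<in> {..<n}"
      then have [measurable]: "A m \<in> sets borel" by simp
      have "(\<integral>\<^sup>+x. ennreal (l m x) * indicator (A m) x \<partial>normal_measure (D m \<bullet> \<theta>) \<sigma>)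
        = (\<integral>\<^sup>+x. ennreal (normal_density (D m \<bullet> \<theta>) \<sigma> x) * (ennreal (l m x) * indicator (A m) x) \<partial>lborel)"
        by (subst nn_integral_density) auto
      also have "\<dots> = (\<integral>\<^sup>+x. ennreal (normal_density (D m \<bullet> (\<theta> + h)) \<sigma> x) * indicator (A m) x \<partial>lborel)"
        by (simp add: one ennreal_mult less_imp_le[OF lpos] mult.assoc)
      also have "\<dots> = emeasure (normal_measure (D m \<bullet> (\<theta> + h)) \<sigma>) (A m)"
        by (subst emeasure_density) auto
      finally show "(\<integral>\<^sup>+x. ennreal (l m x) * indicator (A m) x \<partial>normal_measure (D m \<bullet> \<theta>) \<sigma>)
        = emeasure (normal_measure (D m \<bullet> (\<theta> + h)) \<sigma>) (A m)" .
    qed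
    finally show "emeasure (density (sample_law n D \<theta> \<sigma>) (\<lambda>Y. ennreal (likelihood_ratio n D \<theta> h \<sigma> Y))) (Pi\<^sub>E {..<n} A)
      = (\<Prod>m\<in>{..<n}. emeasure (normal_measure (D m \<bullet> (\<theta> + h)) \<sigma>) (A m))" .
  qed simp
  then show ?thesis by (simp add: sample_law_eq_PiM[OF s, of n D "\<theta> + h"])
qed

text \<open>
  Cauchy--Schwarz for \<open>l - 1\<close> against the indicator of \<open>E\<close>. The factor \<open>sqrt (measure M E)\<close> makes the
  bound a contiguity statement, and bounding that factor by one gives total variation.
\<close>

lemma density_prob_diff_le:
  fixes l :: "'a \<Rightarrow> real"
  assumes M: "prob_space M" and l[measurable]: "l \<in> borel_measurable M" and l0: "\<And>x. l x \<ge> 0"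
    and l1: "(\<integral>\<^sup>+x. ennreal (l x) \<partial>M) = 1" and l2: "(\<integral>\<^sup>+x. ennreal ((l x)\<^sup>2) \<partial>M) = ennreal q"
    and q: "q \<ge> 1" and E[measurable]: "E \<in> sets M"
  shows "\<bar>measure (density M (\<lambda>x. ennreal (l x))) E - measure M E\<bar> \<le> sqrt (q - 1) * sqrt (measure M E)"
proof -
  interpret prob_space M by (rule M)
  have il: "integrable M l" using l0 l1 by (intro integrableI_nonneg) auto
  have ll: "(LINT x|M. l x) = 1" using l0 l1 il by (simp add: nn_integral_eq_integral ennreal_eq_1)
  have il2: "integrable M (\<lambda>x. (l x)\<^sup>2)" using l2 by (intro integrableI_nonneg) auto
  have ll2: "(LINT x|M. (l x)\<^sup>2) = q" using l2 il2 q by (simp add: nn_integral_eq_integral)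
  have sq: "(\<integral>\<^sup>+x. (ennreal \<bar>l x - 1\<bar>)\<^sup>2 \<partial>M) = ennreal (q - 1)"
  proof -
    have "(\<integral>\<^sup>+x. (ennreal \<bar>l x - 1\<bar>)\<^sup>2 \<partial>M) = (\<integral>\<^sup>+x. ennreal ((l x)\<^sup>2 - 2 * l x + 1) \<partial>M)"
    proof (rule nn_integral_cong)
      fix x
      have "\<bar>l x - 1\<bar>\<^sup>2 = (l x)\<^sup>2 - 2 * l x + 1" by (simp add: power2_eq_square algebra_simps)
      then show "(ennreal \<bar>l x - 1\<bar>)\<^sup>2 = ennreal ((l x)\<^sup>2 - 2 * l x + 1)"
        by (simp only: ennreal_power abs_ge_zero)
    qed
    also have "\<dots> = ennreal (LINT x|M. ((l x)\<^sup>2 - 2 * l x + 1))"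
    proof (rule nn_integral_eq_integral)
      show "integrable M (\<lambda>x. (l x)\<^sup>2 - 2 * l x + 1)" using il il2 by auto
      have "(l x)\<^sup>2 - 2 * l x + 1 = (l x - 1)\<^sup>2" for x by (simp add: power2_eq_square algebra_simps)
      then show "AE x in M. 0 \<le> (l x)\<^sup>2 - 2 * l x + 1" by simp
    qed
    also have "(LINT x|M. ((l x)\<^sup>2 - 2 * l x + 1)) = q - 1"
      using il il2 ll ll2 by (simp add: prob_space)
    finally show ?thesis .
  qed
  have "measure (density M (\<lambda>x. ennreal (l x))) E = (LINT x|density M (\<lambda>x. ennreal (l x)). indicator E x)"
    using E by (simp del: E)
  also have "\<dots> = (LINT x|M. l x * indicator E x)"
    by (subst integral_density) (auto simp: l0)
  finally have "measure (density M (\<lambda>x. ennreal (l x))) E - measure M E = (LINT x|M. l x * indicator E x) - (LINT x|M. indicator E x)"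
    by simp
  also have "\<dots> = (LINT x|M. (l x - 1) * indicator E x)"
    using il integrable_const[of 1, THEN integrable_real_mult_indicator[OF E]] by (subst Bochner_Integration.integral_diff[symmetric])
      (auto simp: left_diff_distrib intro: integrable_mult_indicator integrable_real_mult_indicator)
  finally have eq: "measure (density M (\<lambda>x. ennreal (l x))) E - measure M E = (LINT x|M. (l x - 1) * indicator E x)" .
  define d where "d = (LINT x|M. \<bar>(l x - 1) * indicator E x\<bar>)"
  have d: "\<bar>measure (density M (\<lambda>x. ennreal (l x))) E - measure M E\<bar> \<le> d"
    unfolding eq d_def by (rule integral_abs_bound)
  have d0: "d \<ge> 0" unfolding d_def by (intro integral_nonneg_AE) auto
  have "ennreal d = (\<integral>\<^sup>+x. ennreal \<bar>l x - 1\<bar> * indicator E x \<partial>M)"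
    unfolding d_def using il
    by (subst nn_integral_eq_integral[symmetric])
       (auto simp: abs_mult ennreal_mult ennreal_indicator intro!: integrable_real_mult_indicator integrable_abs nn_integral_cong split: split_indicator)
  then have "(ennreal d)\<^sup>2 \<le> (\<integral>\<^sup>+x. (ennreal \<bar>l x - 1\<bar>)\<^sup>2 \<partial>M) * (\<integral>\<^sup>+x. (indicator E x)\<^sup>2 \<partial>M)"
    by (simp only:, intro Cauchy_Schwarz_nn_integral) auto
  also have "(\<integral>\<^sup>+x. (indicator E x)\<^sup>2 \<partial>M) = ennreal (measure M E)"
  proof -
    have "(\<lambda>x. (indicator E x)\<^sup>2) = (indicator E :: 'a \<Rightarrow> ennreal)" by (auto split: split_indicator)
    then show ?thesis by (simp add: emeasure_eq_measure)
  qed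
  finally have "(ennreal d)\<^sup>2 \<le> ennreal (q - 1) * ennreal (measure M E)"
    by (simp only: sq)
  then have "ennreal (d\<^sup>2) \<le> ennreal ((q - 1) * measure M E)"
    using q d0 by (simp add: ennreal_mult ennreal_power)
  then have "d\<^sup>2 \<le> (q - 1) * measure M E" using q by (subst (asm) ennreal_le_iff) auto
  then have "d \<le> sqrt ((q - 1) * measure M E)" by (rule real_le_rsqrt)
  with d show ?thesis by (simp add: real_sqrt_mult)
qed

text \<open>
  The square of the likelihood ratio for \<open>h\<close> is a constant times the likelihood ratio for \<open>2 h\<close>, so its
  mean is that constant.
\<close>

lemma sample_law_diff_le:
  assumes s: "\<sigma> > 0" and E: "E \<in> sets (sample_space n)"
  shows "\<bar>measure (sample_law n D (\<theta> + h) \<sigma>) E - measure (sample_law n D \<theta> \<sigma>) E\<bar>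
    \<le> sqrt (exp ((\<Sum>m<n. (D m \<bullet> h)\<^sup>2) / \<sigma>\<^sup>2) - 1) * sqrt (measure (sample_law n D \<theta> \<sigma>) E)"
proof -
  let ?M = "sample_law n D \<theta> \<sigma>"
  let ?q = "exp ((\<Sum>m<n. (D m \<bullet> h)\<^sup>2) / \<sigma>\<^sup>2)"
  have total: "(\<integral>\<^sup>+Y. ennreal (likelihood_ratio n D \<theta> h' \<sigma> Y) \<partial>?M) = 1" for h'
  proof -
    have "(\<integral>\<^sup>+Y. ennreal (likelihood_ratio n D \<theta> h' \<sigma> Y) \<partial>?M)
      = emeasure (density ?M (\<lambda>Y. ennreal (likelihood_ratio n D \<theta> h' \<sigma> Y))) (space ?M)"
      by (subst emeasure_density) (auto intro!: nn_integral_cong)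
    also have "\<dots> = emeasure (sample_law n D (\<theta> + h') \<sigma>) (space (sample_law n D (\<theta> + h') \<sigma>))"
      by (subst sample_law_shift[OF s]) simp
    also have "\<dots> = 1" by (rule prob_space.emeasure_space_1[OF prob_space_sample_law[OF s]])
    finally show ?thesis .
  qed
  have "(likelihood_ratio n D \<theta> h \<sigma> Y)\<^sup>2 = ?q * likelihood_ratio n D \<theta> (2 *\<^sub>R h) \<sigma> Y" for Y
  proof -
    define a where "a = (\<Sum>m<n. (D m \<bullet> h)\<^sup>2)"
    define b where "b = (\<Sum>m<n. (D m \<bullet> h) * (Y m - D m \<bullet> \<theta>))"
    have 1: "likelihood_ratio n D \<theta> h \<sigma> Y = exp (b / \<sigma>\<^sup>2 - a / (2 * \<sigma>\<^sup>2))"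
      by (simp add: likelihood_ratio_def a_def b_def)
    have 2: "likelihood_ratio n D \<theta> (2 *\<^sub>R h) \<sigma> Y = exp ((2 * b) / \<sigma>\<^sup>2 - (4 * a) / (2 * \<sigma>\<^sup>2))"
      by (simp add: likelihood_ratio_def a_def b_def sum_distrib_left power_mult_distrib mult.assoc)
    show ?thesis
      unfolding 1 2 a_def[symmetric] using s
      by (simp add: field_simps flip: exp_add exp_double)
  qed
  then have two: "(\<integral>\<^sup>+Y. ennreal ((likelihood_ratio n D \<theta> h \<sigma> Y)\<^sup>2) \<partial>?M) = ennreal ?q"
    using total[of "2 *\<^sub>R h"] by (simp add: ennreal_mult nn_integral_cmult likelihood_ratio_def)
  show ?thesis
    unfolding sample_law_shift[OF s]
    by (rule density_prob_diff_le[OF prob_space_sample_law[OF s] _ _ total two])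
       (use E in \<open>auto simp: likelihood_ratio_def[of n D \<theta> h \<sigma>] intro!: sum_nonneg divide_nonneg_nonneg\<close>)
qed

section \<open>Least squares with normal errors\<close>

lemma gram_inner: "x \<bullet> (gram n D *v y) = (\<Sum>m<n. (D m \<bullet> x) * (D m \<bullet> y))"
proof -
  have "x \<bullet> (gram n D *v y) = (\<Sum>i\<in>UNIV. \<Sum>j\<in>UNIV. \<Sum>m<n. (x $ i * D m $ i) * (D m $ j * y $ j))"
    by (simp add: inner_vec_def matrix_vector_mult_def gram_def sum_distrib_left sum_distrib_right mult.assoc)
  also have "\<dots> = (\<Sum>i\<in>UNIV. \<Sum>m<n. \<Sum>j\<in>UNIV. (x $ i * D m $ i) * (D m $ j * y $ j))"
    by (intro sum.cong refl sum.swap)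
  also have "\<dots> = (\<Sum>m<n. \<Sum>i\<in>UNIV. \<Sum>j\<in>UNIV. (x $ i * D m $ i) * (D m $ j * y $ j))"
    by (rule sum.swap)
  also have "\<dots> = (\<Sum>m<n. (D m \<bullet> x) * (D m \<bullet> y))"
    by (simp add: inner_vec_def sum_product mult.commute)
  finally show ?thesis .
qed

lemma transpose_gram [simp]: "transpose (gram n D) = gram n D"
  by (simp add: transpose_def gram_def vec_eq_iff mult.commute)

lemma full_rank_imp_posdef_gram:
  fixes D :: "nat \<Rightarrow> real ^ 'p"
  assumes "dim (D ` {..<n}) = CARD('p)"
  shows "posdef (gram n D)"
  unfolding posdef_def
proof (intro conjI allI impI)
  fix x :: "real ^ 'p" assume x: "x \<noteq> 0"
  have "span (D ` {..<n}) = UNIV" using assms by (simp add: dim_eq_full[symmetric])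
  then have xs: "x \<in> span (D ` {..<n})" by simp
  have "\<exists>m<n. D m \<bullet> x \<noteq> 0"
  proof (rule ccontr)
    assume "\<not> (\<exists>m<n. D m \<bullet> x \<noteq> 0)"
    then have "\<And>y. y \<in> D ` {..<n} \<Longrightarrow> orthogonal x y" by (auto simp: orthogonal_def inner_commute)
    then have "orthogonal x x" using xs orthogonal_to_span by blast
    with x show False by (simp add: orthogonal_self)
  qed
  then obtain m where "m < n" "D m \<bullet> x \<noteq> 0" by blast
  then show "0 < x \<bullet> (gram n D *v x)"
    unfolding gram_inner by (intro sum_pos2[of _ m]) (auto simp: zero_less_mult_iff)
qed simp

lemma posdef_mult_matrix_inv:
  assumes "posdef S"
  shows "S *v (matrix_inv S *v x) = x" "matrix_inv S *v (S *v x) = x"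
proof -
  have "inj ((*v) S)"
  proof (rule injI)
    fix a b assume "S *v a = S *v b"
    then have "(a - b) \<bullet> (S *v (a - b)) = 0" by (simp add: matrix_vector_mult_diff_distrib)
    then show "a = b" using assms by (metis posdef_def less_irrefl right_minus_eq)
  qed
  then have "invertible S" by (simp add: invertible_left_inverse matrix_left_invertible_injective)
  then have "S ** matrix_inv S = mat 1 \<and> matrix_inv S ** S = mat 1"
    unfolding matrix_inv_def invertible_def by (rule someI_ex)
  then show "S *v (matrix_inv S *v x) = x" "matrix_inv S *v (S *v x) = x"
    by (simp_all add: matrix_vector_mul_assoc)
qed

definition lse :: "nat \<Rightarrow> (nat \<Rightarrow> real ^ 'p) \<Rightarrow> (nat \<Rightarrow> real) \<Rightarrow> real ^ 'p" where
  "lse n D Y = matrix_inv (gram n D) *v (\<Sum>m<n. Y m *\<^sub>R D m)"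

lemma lse_measurable [measurable]: "lse n D \<in> borel_measurable (sample_space n)"
proof -
  have "(\<lambda>Y. \<Sum>m<n. Y m *\<^sub>R D m) \<in> borel_measurable (sample_space n)" by measurable
  from measurable_compose[OF this mult_matrix_measurable] show ?thesis by (simp add: lse_def[abs_def])
qed

lemma gram_lse:
  "posdef (gram n D) \<Longrightarrow> gram n D *v lse n D Y = (\<Sum>m<n. Y m *\<^sub>R D m)"
  by (simp add: lse_def posdef_mult_matrix_inv)

text \<open>
  Pythagoras: the residuals at the least squares estimate are orthogonal to the columns of the design.
\<close>

lemma ssr_decomp:
  assumes pd: "posdef (gram n D)"
  shows "ssr n D Y b = ssr n D Y (lse n D Y) + (b - lse n D Y) \<bullet> (gram n D *v (b - lse n D Y))"
proof -
  let ?l = "lse n D Y"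
  let ?d = "b - ?l"
  have "?d \<bullet> (gram n D *v ?l) = (\<Sum>m<n. Y m * (D m \<bullet> ?d))"
    by (simp add: gram_lse[OF pd] inner_sum_right inner_commute)
  then have orth: "(\<Sum>m<n. (D m \<bullet> ?d) * (Y m - D m \<bullet> ?l)) = 0"
    unfolding gram_inner by (simp add: algebra_simps sum_subtractf sum.distrib)
  have "ssr n D Y b = (\<Sum>m<n. (Y m - D m \<bullet> ?l)\<^sup>2 + (D m \<bullet> ?d) * (D m \<bullet> ?d) - 2 * ((D m \<bullet> ?d) * (Y m - D m \<bullet> ?l)))"
    unfolding ssr_def by (intro sum.cong refl) (simp add: inner_diff_right power2_eq_square algebra_simps)
  also have "\<dots> = ssr n D Y ?l + ?d \<bullet> (gram n D *v ?d)"
    using orth by (simp add: ssr_def gram_inner sum.distrib sum_subtractf flip: sum_distrib_left)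
  finally show ?thesis .
qed

lemma restricted_lse_full:
  assumes pd: "posdef (gram n D)"
  shows "restricted_lse n D full_model Y = lse n D Y"
proof -
  have full: "submodel full_model = UNIV" by (auto simp: submodel_def full_model_def)
  have ge: "ssr n D Y (lse n D Y) \<le> ssr n D Y b" for b
    using ssr_decomp[OF pd, of Y b] pd
    by (cases "b = lse n D Y") (auto simp: posdef_def less_imp_le)
  have uniq: "b = lse n D Y" if "is_arg_min (ssr n D Y) (\<lambda>x. x \<in> UNIV) b" for b
  proof (rule ccontr)
    assume "b \<noteq> lse n D Y"
    then have "0 < (b - lse n D Y) \<bullet> (gram n D *v (b - lse n D Y))" using pd by (simp add: posdef_def)
    then have "ssr n D Y (lse n D Y) < ssr n D Y b" using ssr_decomp[OF pd, of Y b] by simp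
    with that show False by (auto simp: is_arg_min_def)
  qed
  have "is_arg_min (ssr n D Y) (\<lambda>x. x \<in> UNIV) (lse n D Y)"
    using ge by (auto simp: is_arg_min_def not_less)
  then show ?thesis
    unfolding restricted_lse_def full arg_min_on_def arg_min_def using uniq by (rule someI2)
qed

lemma lse_add_signal:
  assumes pd: "posdef (gram n D)"
  shows "lse n D (\<lambda>m\<in>{..<n}. D m \<bullet> \<theta> + u m) = \<theta> + lse n D u"
proof -
  have "gram n D *v \<theta> = (\<Sum>m<n. (D m \<bullet> \<theta>) *\<^sub>R D m)"
    by (rule vector_eq_ldot[THEN iffD1], rule allI) (simp add: gram_inner inner_sum_right inner_commute mult.commute)
  then have "(\<Sum>m<n. (\<lambda>m\<in>{..<n}. D m \<bullet> \<theta> + u m) m *\<^sub>R D m) = gram n D *v \<theta> + (\<Sum>m<n. u m *\<^sub>R D m)"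
    by (simp add: scaleR_add_left sum.distrib)
  then show ?thesis
    by (simp add: lse_def matrix_vector_right_distrib posdef_mult_matrix_inv[OF pd])
qed

lemma distr_lse_shift:
  assumes pd: "posdef (gram n D)" and s: "\<sigma> > 0"
    and f: "(f :: real ^ 'p \<Rightarrow> 'b :: {second_countable_topology, t2_space}) \<in> borel_measurable borel"
  shows "distr (sample_law n D (\<theta> + h) \<sigma>) borel (\<lambda>Y. f (lse n D Y))
    = distr (sample_law n D \<theta> \<sigma>) borel (\<lambda>Y. f (lse n D Y + h))"
proof -

  have S[measurable]: "(\<lambda>u. \<lambda>m\<in>{..<n}. D m \<bullet> \<theta> + u m)
      \<in> measurable (PiM {..<n} (\<lambda>_. normal_measure 0 \<sigma>)) (sample_space n)" for \<theta>
    unfolding sample_space_def by measurable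
  let ?N = "PiM {..<n} (\<lambda>_. normal_measure 0 \<sigma>)"
  have push: "distr (sample_law n D \<theta> \<sigma>) borel g = distr ?N borel (\<lambda>u. g (\<lambda>m\<in>{..<n}. D m \<bullet> \<theta> + u m))"
    if "g \<in> borel_measurable (sample_space n)" for g :: "(nat \<Rightarrow> real) \<Rightarrow> 'b" and \<theta>
    unfolding sample_law_def using distr_distr[OF that S] by (simp add: o_def)
  have m1: "(\<lambda>Y. f (lse n D Y)) \<in> borel_measurable (sample_space n)"
    by (rule measurable_compose[OF lse_measurable f])
  have m2: "(\<lambda>Y. f (lse n D Y + h)) \<in> borel_measurable (sample_space n)"
    by (rule measurable_compose[OF _ f]) (intro borel_measurable_add borel_measurable_const lse_measurable)
  have "distr (sample_law n D (\<theta> + h) \<sigma>) borel (\<lambda>Y. f (lse n D Y))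
      = distr ?N borel (\<lambda>u. f (\<theta> + h + lse n D u))"
    by (simp only: push[OF m1] lse_add_signal[OF pd])
  also have "(\<lambda>u. f (\<theta> + h + lse n D u)) = (\<lambda>u. f (\<theta> + lse n D u + h))"
    by (simp add: add.assoc add.commute[of h])
  also have "distr ?N borel \<dots> = distr (sample_law n D \<theta> \<sigma>) borel (\<lambda>Y. f (lse n D Y + h))"
    by (simp only: push[OF m2] lse_add_signal[OF pd])
  finally show ?thesis .
qed

text \<open>
  The likelihood ratio is a function of the least squares estimate alone. Shifting \<open>\<theta>\<close> therefore
  translates the law of the estimate and at the same time tilts it by an exponential function of the
  estimate, which is the Cameron--Martin formula with the stated precision matrix. The factor \<open>r\<close>
  will be \<open>sqrt n\<close>.
\<close>

theorem lse_normal: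
  fixes D :: "nat \<Rightarrow> real ^ 'p"
  assumes pd: "posdef (gram n D)" and s: "\<sigma> > 0" and r: "r > 0"
  shows "distr (sample_law n D \<theta> \<sigma>) borel (\<lambda>Y. r *\<^sub>R (lse n D Y - \<theta>))
    = normal_law ((1 / (r\<^sup>2 * \<sigma>\<^sup>2)) *\<^sub>R gram n D)"
proof -
  let ?S = "(1 / (r\<^sup>2 * \<sigma>\<^sup>2)) *\<^sub>R gram n D"
  let ?P = "\<lambda>\<theta>. sample_law n D \<theta> \<sigma>"
  let ?f = "\<lambda>Y. r *\<^sub>R (lse n D Y - \<theta>)"
  have S: "?S *v x = (1 / (r\<^sup>2 * \<sigma>\<^sup>2)) *\<^sub>R (gram n D *v x)" for x
    by (simp add: scaleR_matrix_vector_assoc)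
  have sym: "x \<bullet> (?S *v y) = (?S *v x) \<bullet> y" for x y
    unfolding S using symmetric_inner[of "gram n D" x y] by simp
  interpret prob_space "?P \<theta>" by (rule prob_space_sample_law[OF s])
  have "cameron_martin ((*v) ?S) (distr (?P \<theta>) borel ?f)"
    unfolding cameron_martin_def
  proof
    fix h :: "real ^ 'p"
    define k where "k = (1 / r) *\<^sub>R h"
    have lr: "likelihood_ratio n D \<theta> k \<sigma> Y = exp (h \<bullet> (?S *v ?f Y) - h \<bullet> (?S *v h) / 2)" for Y
    proof -
      have "(\<Sum>m<n. (D m \<bullet> k) * (Y m - D m \<bullet> \<theta>)) = k \<bullet> (gram n D *v (lse n D Y - \<theta>))"
        by (simp add: matrix_vector_mult_diff_distrib inner_diff_right gram_lse[OF pd])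
           (simp add: gram_inner inner_sum_right algebra_simps sum_subtractf inner_commute)
      moreover have "(\<Sum>m<n. (D m \<bullet> k)\<^sup>2) = k \<bullet> (gram n D *v k)"
        by (simp add: gram_inner power2_eq_square)
      ultimately have eq: "likelihood_ratio n D \<theta> k \<sigma> Y
          = exp (k \<bullet> (gram n D *v (lse n D Y - \<theta>)) / \<sigma>\<^sup>2 - k \<bullet> (gram n D *v k) / (2 * \<sigma>\<^sup>2))"
        by (simp only: likelihood_ratio_def)
      have g: "gram n D *v (c *\<^sub>R x) = c *\<^sub>R (gram n D *v x)" for c x
        by (rule linear_scale) simp
      show ?thesis unfolding eq unfolding S k_def g using r s by (simp add: power2_eq_square field_simps)
    qed
    have "distr (distr (?P \<theta>) borel ?f) borel (\<lambda>x. x + h) = distr (?P \<theta>) borel (\<lambda>Y. r *\<^sub>R (lse n D Y + k - \<theta>))"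
      using r by (subst distr_distr) (auto simp: o_def k_def scaleR_diff_right scaleR_add_right algebra_simps)
    also have "\<dots> = distr (?P (\<theta> + k)) borel ?f"
      by (rule distr_lse_shift[OF pd s, symmetric]) simp
    also have "\<dots> = distr (density (?P \<theta>) (\<lambda>Y. ennreal (likelihood_ratio n D \<theta> k \<sigma> Y))) borel ?f"
      by (simp only: sample_law_shift[OF s])
    also have "\<dots> = density (distr (?P \<theta>) borel ?f) (\<lambda>x. ennreal (exp (h \<bullet> (?S *v x) - h \<bullet> (?S *v h) / 2)))"
      unfolding lr by (subst density_distr) (auto simp del: scaleR_matrix_vector_assoc)
    finally show "distr (distr (?P \<theta>) borel ?f) borel (\<lambda>x. x + h)
      = density (distr (?P \<theta>) borel ?f) (\<lambda>x. ennreal (exp (h \<bullet> (?S *v x) - h \<bullet> (?S *v h) / 2)))" .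
  qed
  then show ?thesis
    by (intro cameron_martin_imp_gaussian prob_space_distr sym) auto
qed

text \<open>
  Chebyshev's inequality: the squared errors are independent with variance \<open>2 \<sigma>\<^sup>4\<close>.
\<close>

lemma noise_square_mean_deviation:
  assumes s: "\<sigma> > 0" and n: "n > 0" and \<epsilon>: "\<epsilon> > 0"
  shows "measure (sample_law n D \<theta> \<sigma>)
      {Y \<in> space (sample_space n). \<epsilon> \<le> \<bar>(\<Sum>m<n. (Y m - D m \<bullet> \<theta>)\<^sup>2) / n - \<sigma>\<^sup>2\<bar>}
    \<le> 2 * \<sigma> ^ 4 / (n * \<epsilon>\<^sup>2)"
proof -
  let ?N = "\<lambda>m. normal_measure (D m \<bullet> \<theta>) \<sigma>"
  let ?P = "PiM {..<n} ?N"
  interpret F: product_prob_space ?N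
    by (rule product_prob_space_normal[OF s])
  interpret P: prob_space ?P by (intro prob_space_PiM prob_space_normal_density s)
  define e where "e = (\<lambda>m x. (x - D m \<bullet> \<theta>)\<^sup>2 - \<sigma>\<^sup>2)"
  have e[measurable]: "e m \<in> borel_measurable borel" for m unfolding e_def by measurable
  have mom2: "has_bochner_integral (?N m) (\<lambda>x. (x - D m \<bullet> \<theta>) ^ 2) (\<sigma>\<^sup>2)" for m
    using normal_moment_even[OF s, of "D m \<bullet> \<theta>" 1] s
    by (intro has_bochner_integral_density) auto
  have mom4: "has_bochner_integral (?N m) (\<lambda>x. (x - D m \<bullet> \<theta>) ^ 4) (3 * \<sigma> ^ 4)" for m
    using normal_moment_even[OF s, of "D m \<bullet> \<theta>" 2] s
    by (intro has_bochner_integral_density) (auto simp: fact_numeral power2_eq_square power4_eq_xxxx field_simps)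
  have one: "has_bochner_integral (?N m) (\<lambda>x. 1) (1 :: real)" for m
    using F.M.prob_space[of m] by (simp add: has_bochner_integral_iff)
  have e1: "has_bochner_integral (?N m) (e m) 0" for m
  proof -
    have "has_bochner_integral (?N m) (\<lambda>x. (x - D m \<bullet> \<theta>)^2 - \<sigma>\<^sup>2 * 1) (\<sigma>\<^sup>2 - \<sigma>\<^sup>2 * 1)"
      by (intro has_bochner_integral_diff has_bochner_integral_mult_right mom2 one)
    then show ?thesis by (simp add: e_def[abs_def])
  qed
  have e2: "has_bochner_integral (?N m) (\<lambda>x. e m x * e m x) (2 * \<sigma> ^ 4)" for m
  proof -
    have "has_bochner_integral (?N m) (\<lambda>x. (x - D m \<bullet> \<theta>) ^ 4 - 2 * \<sigma>\<^sup>2 * (x - D m \<bullet> \<theta>)^2 + \<sigma> ^ 4 * 1)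
      (3 * \<sigma> ^ 4 - 2 * \<sigma>\<^sup>2 * \<sigma>\<^sup>2 + \<sigma> ^ 4 * 1)"
      by (intro has_bochner_integral_add has_bochner_integral_diff has_bochner_integral_mult_right mom2 mom4 one)
    moreover have "(\<lambda>x. (x - D m \<bullet> \<theta>) ^ 4 - 2 * \<sigma>\<^sup>2 * (x - D m \<bullet> \<theta>)^2 + \<sigma> ^ 4 * 1) = (\<lambda>x. e m x * e m x)"
      by (simp add: e_def fun_eq_iff algebra_simps power2_eq_square power4_eq_xxxx)
    ultimately show ?thesis by (simp add: power2_eq_square power4_eq_xxxx mult.assoc)
  qed
  have cross: "has_bochner_integral ?P (\<lambda>Y. e m (Y m) * e l (Y l)) (if m = l then 2 * \<sigma> ^ 4 else 0)"
    if ml: "m < n" "l < n" for m l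
  proof -
    \<comment> \<open>Written as a product over all coordinates, so that the integral over the product measure factors.\<close>
    define g where "g = (\<lambda>j x. (if j = m then e m x else 1) * (if j = l then e l x else 1))"
    have g: "has_bochner_integral (?N j) (g j)
        (if j = m \<and> j = l then 2 * \<sigma> ^ 4 else if j = m \<or> j = l then 0 else 1)" for j
      using e1[of j] e2[of j] one[of j] by (auto simp: g_def)
    have "(\<lambda>Y. e m (Y m) * e l (Y l)) = (\<lambda>Y. \<Prod>j<n. g j (Y j))"
      using ml by (auto simp: g_def prod.distrib fun_eq_iff)
    moreover have "(\<Prod>j<n. integral\<^sup>L (?N j) (g j)) = (if m = l then 2 * \<sigma> ^ 4 else 0)"
    proof (cases "m = l")
      case True
      then have "integral\<^sup>L (?N j) (g j) = (if j = l then 2 * \<sigma> ^ 4 else 1)" for j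
        using g[of j, THEN has_bochner_integral_integral_eq] by simp
      with True ml show ?thesis by simp
    next
      case False
      then have "integral\<^sup>L (?N m) (g m) = 0" using g[of m, THEN has_bochner_integral_integral_eq] by simp
      with False ml show ?thesis by (auto intro!: prod_zero)
    qed
    moreover have "integrable (?N j) (g j)" for j using g by (simp add: has_bochner_integral_iff)
    ultimately show ?thesis
      by (simp add: has_bochner_integral_iff F.product_integrable_prod F.product_integral_prod)
  qed
  define V where "V = (\<lambda>Y :: nat \<Rightarrow> real. (\<Sum>m<n. e m (Y m))\<^sup>2)"
  have V: "has_bochner_integral ?P V (n * (2 * \<sigma> ^ 4))"
  proof -
    have "has_bochner_integral ?P (\<lambda>Y. \<Sum>m<n. \<Sum>l<n. e m (Y m) * e l (Y l))
        (\<Sum>m<n. \<Sum>l<n. if m = l then 2 * \<sigma> ^ 4 else 0)"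
      by (intro has_bochner_integral_sum cross) auto
    then show ?thesis by (simp add: V_def[abs_def] power2_eq_square sum_product)
  qed
  have "measure ?P {Y \<in> space ?P. (n * \<epsilon>)\<^sup>2 \<le> V Y} \<le> (n * (2 * \<sigma> ^ 4)) / (n * \<epsilon>)\<^sup>2"
    using V n \<epsilon> integral_Markov_inequality_measure[of ?P V "{}" "(n * \<epsilon>)\<^sup>2"]
    by (auto simp: has_bochner_integral_iff V_def[abs_def])
  also have "(n * (2 * \<sigma> ^ 4)) / (n * \<epsilon>)\<^sup>2 = 2 * \<sigma> ^ 4 / (n * \<epsilon>\<^sup>2)"
    using n by (simp add: power2_eq_square)
  also have "{Y \<in> space ?P. (n * \<epsilon>)\<^sup>2 \<le> V Y}
      = {Y \<in> space (sample_space n). \<epsilon> \<le> \<bar>(\<Sum>m<n. (Y m - D m \<bullet> \<theta>)\<^sup>2) / n - \<sigma>\<^sup>2\<bar>}"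
  proof -
    have "(n * \<epsilon>)\<^sup>2 \<le> V Y \<longleftrightarrow> \<epsilon> \<le> \<bar>(\<Sum>m<n. (Y m - D m \<bullet> \<theta>)\<^sup>2) / n - \<sigma>\<^sup>2\<bar>" for Y
    proof -
      have "(\<Sum>m<n. e m (Y m)) = n * ((\<Sum>m<n. (Y m - D m \<bullet> \<theta>)\<^sup>2) / n - \<sigma>\<^sup>2)"
        using n by (simp add: e_def sum_subtractf field_simps)
      then have "(n * \<epsilon>)\<^sup>2 \<le> V Y \<longleftrightarrow> \<bar>n * \<epsilon>\<bar> \<le> \<bar>n * ((\<Sum>m<n. (Y m - D m \<bullet> \<theta>)\<^sup>2) / n - \<sigma>\<^sup>2)\<bar>"
        by (simp only: V_def abs_le_square_iff)
      also have "\<dots> \<longleftrightarrow> \<epsilon> \<le> \<bar>(\<Sum>m<n. (Y m - D m \<bullet> \<theta>)\<^sup>2) / n - \<sigma>\<^sup>2\<bar>"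
        using n \<epsilon> by (simp only: abs_mult) simp
      finally show ?thesis .
    qed
    then show ?thesis by (simp add: sample_space_def space_PiM)
  qed
  finally show ?thesis by (simp add: sample_law_eq_PiM[OF s])
qed

section \<open>The limit experiment\<close>

lemma measure_std_normal:
  assumes B: "B \<in> sets borel"
  shows "measure std_normal_distribution B = (LINT x|lborel. std_normal_density x * indicator B x)"
proof -
  have "measure std_normal_distribution B = (LINT x|std_normal_distribution. indicator B x)" using B by simp
  also have "\<dots> = (LINT x|lborel. std_normal_density x * indicator B x)"
    using B by (subst integral_density) auto
  finally show ?thesis .
qed

lemma std_normal_symmetric: "distr std_normal_distribution borel uminus = std_normal_distribution"
proof -
  have "distr std_normal_distribution borel uminus
      = density (distr lborel borel uminus) (\<lambda>x. ennreal (std_normal_density (- x)))"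
    by (subst density_distr) auto
  also have "\<dots> = std_normal_distribution"
    by (simp only: lborel_distr_uminus) (simp add: std_normal_density_def)
  finally show ?thesis .
qed

lemma std_normal_upper_tail_pos: "0 < 1 - std_normal_cdf c"
  and std_normal_two_sided: "c > 0 \<Longrightarrow> measure std_normal_distribution {x. c \<le> \<bar>x\<bar>} = 2 * (1 - std_normal_cdf c)"
proof -
  interpret N: prob_space std_normal_distribution by (rule prob_space_normal_density) simp
  have tail: "1 - std_normal_cdf c = measure std_normal_distribution {c<..}"
  proof -
    have "{c<..} = space std_normal_distribution - {..c}" by auto
    then show ?thesis using N.prob_compl[of "{..c}"] by (simp add: cdf_def)
  qed
  have "0 < measure (gaussian (\<lambda>x::real. x)) {c<..}"
  proof (rule gaussian_open_pos)
    show "integrable lborel (gaussian_weight (\<lambda>x::real. x))"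
      by (rule integrable_gaussian_weight[of _ 1]) (auto simp: linear_id[unfolded id_def] power2_eq_square)
    show "{c<..} \<noteq> {}" using gt_ex by auto
  qed (auto simp: linear_id[unfolded id_def])
  then show "0 < 1 - std_normal_cdf c" by (simp only: tail std_normal_eq_gaussian[symmetric])
  assume c: "c > 0"
  have atom: "measure std_normal_distribution {c..} = measure std_normal_distribution {c<..}"
  proof (rule N.finite_measure_eq_AE)
    have "AE x in lborel. x \<noteq> c" by (rule AE_lborel_singleton)
    then show "AE x in std_normal_distribution. (x \<in> {c..}) = (x \<in> {c<..})"
      by (subst AE_density) (auto elim!: eventually_mono)
  qed auto
  have "measure std_normal_distribution {..- c} = measure (distr std_normal_distribution borel uminus) {..- c}"
    by (simp only: std_normal_symmetric)
  also have "\<dots> = measure std_normal_distribution {c..}"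
    by (subst measure_distr) (auto intro!: arg_cong2[where f = measure])
  finally have lower: "measure std_normal_distribution {..- c} = measure std_normal_distribution {c..}" .
  have "{x. c \<le> \<bar>x\<bar>} = {..- c} \<union> {c..}" using c by auto
  then have "measure std_normal_distribution {x. c \<le> \<bar>x\<bar>}
      = measure std_normal_distribution {..- c} + measure std_normal_distribution {c..}"
    using c by (simp only:, intro N.finite_measure_Union) auto
  then show "measure std_normal_distribution {x. c \<le> \<bar>x\<bar>} = 2 * (1 - std_normal_cdf c)"
    by (simp add: lower atom tail)
qed

text \<open>
  Among all intervals of length \<open>2 c\<close> the centred one has the largest normal mass, because it is the set
  where the density exceeds its value at \<open>c\<close>. Subtracting that value makes the comparison pointwise.
\<close>

lemma std_normal_shifted_two_sided:
  assumes c: "c > 0"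
  shows "2 * (1 - std_normal_cdf c) \<le> measure std_normal_distribution {x. c \<le> \<bar>x + a\<bar>}"
proof -
  interpret N: prob_space std_normal_distribution by (rule prob_space_normal_density) simp
  define I where "I = (\<lambda>a. {- a - c <..< - a + c})"
  have compl: "{x. c \<le> \<bar>x + a\<bar>} = space std_normal_distribution - I a" for a
    by (auto simp: I_def)
  have I[measurable]: "I a \<in> sets borel" for a by (simp add: I_def)
  have int: "integrable lborel (\<lambda>x. std_normal_density x * indicator (I a) x)" for a
    by (rule integrable_real_mult_indicator) (auto simp: I_def)
  have intc: "integrable lborel (\<lambda>x. std_normal_density c * indicator (I a) x :: real)" for a
    using c by (intro integrable_mult_right integrable_real_indicator) (auto simp: I_def)
  have lin: "(LINT x|lborel. (std_normal_density x - std_normal_density c) * indicator (I a) x)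
      = measure std_normal_distribution (I a) - std_normal_density c * (2 * c)" for a
  proof -
    have "(LINT x|lborel. (std_normal_density x - std_normal_density c) * indicator (I a) x)
      = (LINT x|lborel. std_normal_density x * indicator (I a) x) - (LINT x|lborel. std_normal_density c * indicator (I a) x)"
      unfolding left_diff_distrib by (rule Bochner_Integration.integral_diff[OF int intc])
    also have "(LINT x|lborel. std_normal_density c * indicator (I a) x) = std_normal_density c * (2 * c)"
      using c by (simp add: I_def)
    finally show ?thesis by (simp add: measure_std_normal)
  qed
  have "(LINT x|lborel. (std_normal_density x - std_normal_density c) * indicator (I a) x)
      \<le> (LINT x|lborel. (std_normal_density x - std_normal_density c) * indicator (I 0) x)"
  proof (rule integral_mono)
    show "integrable lborel (\<lambda>x. (std_normal_density x - std_normal_density c) * indicator (I a) x)" for a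
      unfolding left_diff_distrib by (rule Bochner_Integration.integrable_diff[OF int intc])
    then show "integrable lborel (\<lambda>x. (std_normal_density x - std_normal_density c) * indicator (I 0) x)" .
    fix x :: real
    have "std_normal_density y \<le> std_normal_density z" if "\<bar>z\<bar> \<le> \<bar>y\<bar>" for y z
      using that by (simp add: std_normal_density_def divide_le_cancel abs_le_square_iff)
    from this[of x c] this[of c x] have "\<bar>x\<bar> < c \<Longrightarrow> std_normal_density c \<le> std_normal_density x"
      and "c \<le> \<bar>x\<bar> \<Longrightarrow> std_normal_density x \<le> std_normal_density c" using c by auto
    moreover have "x \<in> I 0 \<longleftrightarrow> \<bar>x\<bar> < c" by (auto simp: I_def)
    ultimately show "(std_normal_density x - std_normal_density c) * indicator (I a) x
        \<le> (std_normal_density x - std_normal_density c) * indicator (I 0) x"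
      by (cases "\<bar>x\<bar> < c") (auto simp: indicator_def)
  qed
  then have "measure std_normal_distribution (I a) \<le> measure std_normal_distribution (I 0)" by (simp add: lin)
  then have "measure std_normal_distribution {x. c \<le> \<bar>x + 0\<bar>} \<le> measure std_normal_distribution {x. c \<le> \<bar>x + a\<bar>}"
    unfolding compl by (subst (1 2) N.prob_compl) auto
  then show ?thesis using std_normal_two_sided[OF c] by simp
qed

text \<open>
  Rejection by the two-sided test at critical value \<open>s\<close>, where \<open>w\<close> is the scaled error of the estimate
  and \<open>g\<close> the scaled local alternative.
\<close>

definition selected :: "real \<Rightarrow> 'p \<Rightarrow> real \<Rightarrow> (real ^ 'p) set" where
  "selected s i g = {w. s \<le> \<bar>w $ i + g\<bar>}"

definition target_event :: "real ^ 'p ^ 'k \<Rightarrow> real ^ 'k \<Rightarrow> (real ^ 'p) set" where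
  "target_event A t = {w. A *v w \<le> t}"

text \<open>
  The limit, under local alternatives \<open>g\<close>, of the conditional distribution function at \<open>t\<close> given that
  the full model is selected. The matrix \<open>S\<close> is the asymptotic precision.
\<close>

definition limit_cond_cdf ::
  "real ^ 'p ^ 'p \<Rightarrow> real ^ 'p ^ 'k \<Rightarrow> real ^ 'k \<Rightarrow> real \<Rightarrow> 'p \<Rightarrow> real \<Rightarrow> real" where
  "limit_cond_cdf S A t s i g =
     measure (normal_law S) (target_event A t \<inter> selected s i g) / measure (normal_law S) (selected s i g)"

lemma borel_measurable_vec_nth [measurable]: "(\<lambda>w :: real ^ 'p. w $ i) \<in> borel_measurable borel"
  by (intro borel_measurable_continuous_onI continuous_intros)

lemma selected_measurable [measurable]: "selected s i g \<in> sets borel"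
  unfolding selected_def by measurable

lemma target_event_measurable [measurable]: "target_event A t \<in> sets borel"
proof -
  have "closed (target_event A t)"
    unfolding target_event_def less_eq_vec_def
    by (intro closed_Collect_all closed_Collect_le continuous_intros continuous_on_component
        matrix_vector_mult_linear_continuous_on)
  then show ?thesis by simp
qed

lemma axis_inner_eq [simp]: "axis i 1 \<bullet> w = w $ i" for w :: "real ^ 'p"
  by (simp add: inner_axis')

lemma prob_selected:
  fixes S :: "real ^ 'p ^ 'p"
  assumes S: "posdef S" and v: "S *v v = axis i 1" and \<tau>: "\<tau> > 0" "\<tau>\<^sup>2 = v $ i"
  shows "measure (normal_law S) (selected (c * \<tau>) i g) = measure std_normal_distribution {x. c \<le> \<bar>x + g / \<tau>\<bar>}"
proof -
  have sym: "transpose S = S" using S by (simp add: posdef_def)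
  have "std_normal_distribution = distr (normal_law S) borel (\<lambda>w. (axis i 1 \<bullet> w) / \<tau>)"
    by (rule gaussian_marginal_std_normal[symmetric, OF _ _ posdef_integrable_weight[OF S] v \<tau>(1)])
       (use \<tau> symmetric_inner[OF sym] in auto)
  then have "measure std_normal_distribution {x. c \<le> \<bar>x + g / \<tau>\<bar>}
      = measure (distr (normal_law S) borel (\<lambda>w. w $ i / \<tau>)) {x. c \<le> \<bar>x + g / \<tau>\<bar>}" by simp
  also have "\<dots> = measure (normal_law S) ((\<lambda>w. w $ i / \<tau>) -` {x. c \<le> \<bar>x + g / \<tau>\<bar>} \<inter> space (normal_law S))"
    by (rule measure_distr) auto
  also have "(\<lambda>w. w $ i / \<tau>) -` {x. c \<le> \<bar>x + g / \<tau>\<bar>} \<inter> space (normal_law S) = selected (c * \<tau>) i g"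
  proof -
    have "c \<le> \<bar>x / \<tau> + g / \<tau>\<bar> \<longleftrightarrow> c * \<tau> \<le> \<bar>x + g\<bar>" for x
      using \<tau>(1) by (simp add: pos_le_divide_eq flip: add_divide_distrib)
    then show ?thesis by (auto simp: selected_def)
  qed
  finally show ?thesis ..
qed

text \<open>
  A translation by a vector \<open>u\<close> with \<open>u\<^sub>i = 0\<close> maps the slab \<open>\<bar>w\<^sub>i + g\<bar> < s\<close> to itself and changes the
  normal law by the exponential of \<open>S u \<bullet> w\<close>. Take \<open>S u\<close> to be a multiple of the axis \<open>i\<close> minus a row
  \<open>j\<close> of \<open>A\<close> for which \<open>(A v)\<^sub>j\<close> is nonzero; the condition \<open>u\<^sub>i = 0\<close> fixes the multiple to be \<open>b\<close>. On the
  target event the row contributes at least \<open>- t\<^sub>j\<close>, while the axis contributes \<open>b w\<^sub>i\<close>, which is as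
  large as desired on slabs far out on the side where \<open>b w\<^sub>i\<close> is positive.
\<close>

lemma prob_target_inter_slab_le:
  fixes S :: "real ^ 'p ^ 'p" and A :: "real ^ 'p ^ 'k"
  assumes S: "posdef S" and v: "S *v v = axis i 1" and \<tau>: "v $ i > 0" and Av: "A *v v \<noteq> 0" and \<epsilon>: "\<epsilon> > 0"
  shows "\<exists>g. measure (normal_law S) (target_event A t \<inter> - selected s i g) \<le> \<epsilon> * measure (normal_law S) (- selected s i g)"
proof -
  have sym: "x \<bullet> (S *v y) = (S *v x) \<bullet> y" for x y using S symmetric_inner by (auto simp: posdef_def)
  interpret N: prob_space "normal_law S" by (rule prob_space_normal_law[OF S])
  obtain j where j: "(A *v v) $ j \<noteq> 0" using Av by (auto simp: vec_eq_iff)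
  define b where "b = (A *v v) $ j / v $ i"
  have b: "b \<noteq> 0" using j \<tau> by (simp add: b_def)
  define u where "u = matrix_inv S *v (- (A $ j)) + b *\<^sub>R v"
  have Su: "S *v u = - (A $ j) + b *\<^sub>R axis i 1"
    by (simp add: u_def matrix_vector_right_distrib posdef_mult_matrix_inv[OF S] v linear_scale[OF matrix_vector_mul_linear])
  have row: "(A *v w) $ j = A $ j \<bullet> w" for w by (simp add: matrix_vector_mul_component)
  have ui: "u $ i = 0"
  proof -
    have "u $ i = (S *v v) \<bullet> u" by (simp add: v)
    also have "\<dots> = v \<bullet> (S *v u)" using sym[of v u] by simp
    also have "\<dots> = - (A *v v) $ j + b * v $ i" by (simp add: Su inner_diff_right inner_axis row inner_commute)
    also have "\<dots> = 0" using \<tau> by (simp add: b_def)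
    finally show ?thesis .
  qed
  have uS: "u \<bullet> (S *v w) = - (A *v w) $ j + b * w $ i" for w
    using sym[of u w] by (simp add: Su inner_diff_left row)
  define K where "K = u \<bullet> (S *v u) / 2"
  \<comment> \<open>Solves \<open>\<bar>b\<bar> (x - s) - t\<^sub>j - K = ln (1 / \<epsilon>)\<close>: the left-hand side is the least possible exponent on the slab.\<close>
  define x where "x = (- ln \<epsilon> + t $ j + K) / \<bar>b\<bar> + s"
  define g where "g = - sgn b * x"
  define W where "W = - selected s i g"
  have W[measurable]: "W \<in> sets borel" by (simp add: W_def borel_comp)
  have W_shift: "w + u \<in> W \<longleftrightarrow> w \<in> W" for w by (simp add: W_def selected_def ui)
  define B where "B = target_event A t \<inter> W"
  have B[measurable]: "B \<in> sets borel" by (auto simp: B_def)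
  have big: "1 / \<epsilon> \<le> exp (u \<bullet> (S *v w) - K)" if w: "w \<in> B" for w
  proof -
    have "(A *v w) $ j \<le> t $ j" using w by (simp add: B_def target_event_def less_eq_vec_def)
    moreover have "\<bar>w $ i + g\<bar> < s" using w by (simp add: B_def W_def selected_def)
    then have "\<bar>b\<bar> * \<bar>w $ i + g\<bar> \<le> \<bar>b\<bar> * s" by (intro mult_left_mono) auto
    then have "\<bar>b * (w $ i + g)\<bar> \<le> \<bar>b\<bar> * s" by (simp only: abs_mult)
    then have "- (\<bar>b\<bar> * s) - b * g \<le> b * w $ i" by (simp add: distrib_left abs_le_iff)
    moreover have "- b * g = \<bar>b\<bar> * x" by (simp add: g_def abs_sgn mult.assoc)
    moreover have "\<bar>b\<bar> * x = - ln \<epsilon> + t $ j + K + \<bar>b\<bar> * s" using b by (simp add: x_def field_simps)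
    ultimately have "- ln \<epsilon> \<le> u \<bullet> (S *v w) - K" by (simp add: uS)
    then have "exp (- ln \<epsilon>) \<le> exp (u \<bullet> (S *v w) - K)" by simp
    then show ?thesis using \<epsilon> by (simp add: exp_minus inverse_eq_divide)
  qed
  have "emeasure (normal_law S) W = emeasure (distr (normal_law S) borel (\<lambda>w. w + u)) W"
    by (subst emeasure_distr) (auto simp: W_shift intro!: arg_cong2[where f = emeasure])
  also have "\<dots> = (\<integral>\<^sup>+w. ennreal (exp (u \<bullet> (S *v w) - K)) * indicator W w \<partial>normal_law S)"
    using cameron_martin_gaussian[of "(*v) S"] sym
    by (simp add: cameron_martin_def K_def emeasure_density)
  also have "\<dots> \<ge> (\<integral>\<^sup>+w. ennreal (1 / \<epsilon>) * indicator B w \<partial>normal_law S)"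
    using big by (intro nn_integral_mono) (auto split: split_indicator simp: B_def intro!: ennreal_leI)
  finally have "ennreal (1 / \<epsilon>) * emeasure (normal_law S) B \<le> emeasure (normal_law S) W"
    by (subst (asm) nn_integral_cmult_indicator) auto
  then have "ennreal (1 / \<epsilon> * measure (normal_law S) B) \<le> ennreal (measure (normal_law S) W)"
    using \<epsilon> by (subst ennreal_mult) (simp_all only: N.emeasure_eq_measure, auto)
  then have "1 / \<epsilon> * measure (normal_law S) B \<le> measure (normal_law S) W"
    by (subst (asm) ennreal_le_iff) auto
  then have "measure (normal_law S) B \<le> \<epsilon> * measure (normal_law S) W"
    using \<epsilon> by (simp add: field_simps)
  then show ?thesis unfolding B_def W_def by blast
qed

text \<open>
  As \<open>g\<close> tends to infinity the conditioning event exhausts the space, so a constant value could only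
  be the unconditional probability \<open>h\<close> of the target event. This probability is positive because \<open>A\<close>
  is surjective. But removing a slab that carries less than its share \<open>h\<close> of the target event raises the
  conditional probability strictly above \<open>h\<close>.
\<close>

theorem limit_cond_cdf_not_constant:
  fixes S :: "real ^ 'p ^ 'p" and A :: "real ^ 'p ^ 'k"
  assumes S: "posdef S" and v: "S *v v = axis i 1" and \<tau>: "v $ i > 0" and Av: "A *v v \<noteq> 0"
    and A: "rank A = CARD('k)" and s: "s > 0"
  shows "\<exists>g. limit_cond_cdf S A t s i g \<noteq> limit_cond_cdf S A t s i 0"
proof (rule ccontr)
  assume "\<not> ?thesis"
  then have const: "limit_cond_cdf S A t s i g = limit_cond_cdf S A t s i 0" for g by blast
  interpret N: prob_space "normal_law S" by (rule prob_space_normal_law[OF S])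
  let ?N = "measure (normal_law S)"
  let ?B = "target_event A t"
  define h where "h = ?N ?B"
  have open_pos: "?N U > 0" if "open U" "U \<noteq> {}" for U
    by (rule gaussian_open_pos[OF _ posdef_integrable_weight[OF S] that]) simp
  have h: "h > 0"
  proof -
    define U where "U = {w. \<forall>j. (A *v w) $ j < t $ j}"
    have "surj ((*v) A)" using A by (simp add: full_rank_surjective)
    then obtain w0 where "A *v w0 = t - 1" by (metis surj_def)
    then have "w0 \<in> U" by (simp add: U_def)
    moreover have "open U"
      unfolding U_def Collect_all_eq
      by (intro open_INT ballI finite open_Collect_less continuous_intros continuous_on_component
          matrix_vector_mult_linear_continuous_on)
    ultimately have "0 < ?N U" by (intro open_pos) auto
    also have "?N U \<le> ?N ?B"
      by (intro N.finite_measure_mono) (auto simp: U_def target_event_def less_eq_vec_def less_imp_le)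
    finally show ?thesis by (simp add: h_def)
  qed
  have slab_meas[measurable]: "- selected s i g \<in> sets borel" for g by (simp add: borel_comp)
  have slab_pos: "?N (- selected s i g) > 0" for g
  proof (rule open_pos)
    show "open (- selected s i g)"
      unfolding selected_def by (intro open_Compl closed_Collect_le continuous_intros continuous_on_component)
    have "(- g) *\<^sub>R axis i 1 \<in> - selected s i g" using s by (simp add: selected_def)
    then show "- selected s i g \<noteq> {}" by blast
  qed
  have sel_pos: "?N (selected s i g) > 0" for g
  proof -
    define U where "U = {w :: real ^ 'p. s < \<bar>w $ i + g\<bar>}"
    have "open U"
      unfolding U_def by (intro open_Collect_less continuous_intros continuous_on_component)
    moreover have "(s + 1 - g) *\<^sub>R axis i 1 \<in> U" using s by (simp add: U_def)
    ultimately have "0 < ?N U" by (intro open_pos) auto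
    also have "?N U \<le> ?N (selected s i g)"
      by (intro N.finite_measure_mono) (auto simp: U_def selected_def)
    finally show ?thesis .
  qed
  have compl: "?N (selected s i g) = 1 - ?N (- selected s i g)" for g
    using N.prob_compl[of "selected s i g"] by (simp add: Compl_eq_Diff_UNIV)
  have split: "?N (?B \<inter> selected s i g) = h - ?N (?B \<inter> - selected s i g)" for g
    unfolding h_def using N.finite_measure_Diff'[of ?B "- selected s i g"] by (simp add: Diff_eq)
  obtain g1 where g1: "?N (?B \<inter> - selected s i g1) \<le> h / 2 * ?N (- selected s i g1)"
    using prob_target_inter_slab_le[OF S v \<tau> Av, of "h / 2" t s] h by auto
  have above: "limit_cond_cdf S A t s i g1 > h"
  proof -
    have "h / 2 * ?N (- selected s i g1) < h * ?N (- selected s i g1)"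
      using h slab_pos[of g1] by (intro mult_strict_right_mono) auto
    with g1 have "h * ?N (selected s i g1) < ?N (?B \<inter> selected s i g1)"
      unfolding compl split by (simp add: right_diff_distrib)
    then show ?thesis using sel_pos[of g1] by (simp add: limit_cond_cdf_def pos_less_divide_eq)
  qed
  have slab_0: "(\<lambda>n. ?N (- selected s i (real n))) \<longlonglongrightarrow> 0"
  proof -
    define T where "T = (\<lambda>n::nat. {w :: real ^ 'p. w $ i \<le> s - real n})"
    have T: "T n \<in> sets (normal_law S)" for n unfolding T_def by measurable
    have "(\<lambda>n. ?N (T n)) \<longlonglongrightarrow> ?N (\<Inter>n. T n)"
      using T by (intro N.finite_Lim_measure_decseq) (auto simp: decseq_def T_def)
    also have "(\<Inter>n. T n) = {}"
    proof -
      have "\<exists>n. \<not> w $ i \<le> s - real n" for w :: "real ^ 'p"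
        using reals_Archimedean2[of "s - w $ i"] by (auto simp: algebra_simps not_le)
      then show ?thesis by (auto simp: T_def)
    qed
    finally have lim: "(\<lambda>n. ?N (T n)) \<longlonglongrightarrow> 0" by simp
    show ?thesis
    proof (rule tendsto_sandwich[OF _ _ tendsto_const lim])
      show "\<forall>\<^sub>F n in sequentially. ?N (- selected s i (real n)) \<le> ?N (T n)"
        using T by (intro always_eventually allI N.finite_measure_mono) (auto simp: T_def selected_def)
    qed auto
  qed
  have "(\<lambda>n. ?N (?B \<inter> - selected s i (real n))) \<longlonglongrightarrow> 0"
    by (rule tendsto_sandwich[OF _ _ tendsto_const slab_0])
       (auto intro!: always_eventually N.finite_measure_mono)
  then have "(\<lambda>n. limit_cond_cdf S A t s i (real n)) \<longlonglongrightarrow> (h - 0) / (1 - 0)"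
    unfolding limit_cond_cdf_def compl split using slab_0 by (intro tendsto_intros) auto
  moreover have "limit_cond_cdf S A t s i (real n) = limit_cond_cdf S A t s i g1" for n
    using const[of "real n"] const[of g1] by (rule trans[OF _ sym])
  ultimately have "(\<lambda>n::nat. limit_cond_cdf S A t s i g1) \<longlonglongrightarrow> h" by simp
  then have "limit_cond_cdf S A t s i g1 = h" by (simp add: LIMSEQ_const_iff)
  with above show False by simp
qed

text \<open>
  Going from \<open>0\<close> to \<open>x\<close> in equal steps shorter than \<open>\<epsilon>\<close>, the value must change at some step.
\<close>

lemma neighbours_differ:
  fixes f :: "real \<Rightarrow> 'a"
  assumes ne: "f x \<noteq> f 0" and \<epsilon>: "\<epsilon> > 0"
  obtains a b where "\<bar>a\<bar> \<le> \<bar>x\<bar>" "\<bar>b\<bar> \<le> \<bar>x\<bar>" "\<bar>b - a\<bar> < \<epsilon>" "f a \<noteq> f b"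
proof -
  obtain N :: nat where N: "\<bar>x\<bar> / \<epsilon> < N" using reals_Archimedean2 by blast
  have N0: "N > 0" using N \<epsilon> by (metis divide_nonneg_pos abs_ge_zero le_less_trans of_nat_0_less_iff)
  have "\<exists>k<N. f (x * real k / N) \<noteq> f (x * real (Suc k) / N)"
  proof (rule ccontr)
    assume "\<not> ?thesis"
    then have step: "\<And>k. k < N \<Longrightarrow> f (x * real k / N) = f (x * real (Suc k) / N)" by blast
    have "k \<le> N \<Longrightarrow> f (x * real k / N) = f 0" for k
    proof (induction k)
      case (Suc k)
      then show ?case using step[of k] by simp
    qed simp
    from this[of N] show False using ne N0 by simp
  qed
  then obtain k where k: "k < N" "f (x * real k / N) \<noteq> f (x * real (Suc k) / N)" by blast
  have bd: "\<bar>x * real l / N\<bar> \<le> \<bar>x\<bar>" if "l \<le> N" for l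
    using that N0 by (simp add: abs_mult divide_le_eq mult_left_mono)
  have "x * real (Suc k) / N - x * real k / N = x / N"
    by (simp add: add_divide_distrib distrib_left)
  then have "\<bar>x * real (Suc k) / N - x * real k / N\<bar> = \<bar>x\<bar> / N" by (simp only: abs_divide abs_of_nat)
  also have "\<dots> < \<epsilon>" using N N0 \<epsilon> by (simp add: field_simps)
  finally show ?thesis
    using that[OF bd[of k] bd[of "Suc k"]] k by (simp del: of_nat_Suc)
qed

section \<open>Local parameters and consistency of the variance estimate\<close>

text \<open>
  A limit of Gram matrices is symmetric and nonnegative. A nonzero \<open>x\<close> with \<open>x \<bullet> Q x = 0\<close> would minimize
  the form, forcing \<open>Q x = 0\<close> against invertibility.
\<close>

lemma regular_design_posdef:
  assumes "regular_design X Q"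
  shows "posdef Q"
proof -
  have lim: "(\<lambda>n. (1 / real n) *\<^sub>R gram n (X n)) \<longlonglongrightarrow> Q" and inv: "invertible Q"
    using assms by (auto simp: regular_design_def)
  have tr: "transpose Q = Q"
  proof -
    have "Q $ i $ j = Q $ j $ i" for i j
    proof (rule LIMSEQ_unique)
      show "(\<lambda>n. ((1 / real n) *\<^sub>R gram n (X n)) $ i $ j) \<longlonglongrightarrow> Q $ i $ j"
        by (intro tendsto_vec_nth lim)
      have "(\<lambda>n. ((1 / real n) *\<^sub>R gram n (X n)) $ j $ i) \<longlonglongrightarrow> Q $ j $ i"
        by (intro tendsto_vec_nth lim)
      then show "(\<lambda>n. ((1 / real n) *\<^sub>R gram n (X n)) $ i $ j) \<longlonglongrightarrow> Q $ j $ i"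
        by (simp add: gram_def mult.commute)
    qed
    then show ?thesis by (simp add: transpose_def vec_eq_iff)
  qed
  have nonneg: "0 \<le> x \<bullet> (Q *v x)" for x
  proof (rule LIMSEQ_le_const)
    show "(\<lambda>n. x \<bullet> (((1 / real n) *\<^sub>R gram n (X n)) *v x)) \<longlonglongrightarrow> x \<bullet> (Q *v x)"
      by (intro tendsto_intros tendsto_matrix_vector_mult lim)
    have "0 \<le> x \<bullet> (((1 / real n) *\<^sub>R gram n (X n)) *v x)" for n
      by (simp add: scaleR_matrix_vector_assoc[symmetric] gram_inner sum_nonneg)
    then show "\<exists>N. \<forall>n\<ge>N. 0 \<le> x \<bullet> (((1 / real n) *\<^sub>R gram n (X n)) *v x)" by blast
  qed
  have "x \<bullet> (Q *v x) \<noteq> 0" if x: "x \<noteq> 0" for x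
  proof
    assume 0: "x \<bullet> (Q *v x) = 0"
    define y where "y = Q *v x"
    have "inj ((*v) Q)" using inv by (simp add: invertible_eq_bij bij_is_inj)
    then have "y \<noteq> 0" using x injD[of "(*v) Q" x 0] by (auto simp: y_def)
    then have yy: "y \<bullet> y > 0" by simp
    define z where "z = y \<bullet> (Q *v y)"
    have z: "z \<ge> 0" unfolding z_def by (rule nonneg)
    define r where "r = (y \<bullet> y) / (z + 1)"
    have r: "r > 0" using yy z by (simp add: r_def)
    \<comment> \<open>A small step from \<open>x\<close> against the gradient direction \<open>y\<close> would make the form negative.\<close>
    have "0 \<le> (x + (- r) *\<^sub>R y) \<bullet> (Q *v (x + (- r) *\<^sub>R y))" by (rule nonneg)
    also have "\<dots> = x \<bullet> (Q *v x) + 2 * (((- r) *\<^sub>R y) \<bullet> (Q *v x)) + ((- r) *\<^sub>R y) \<bullet> (Q *v ((- r) *\<^sub>R y))"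
      by (rule inner_linear_add_square) (use symmetric_inner[OF tr] in auto)
    also have "((- r) *\<^sub>R y) \<bullet> (Q *v ((- r) *\<^sub>R y)) = r * r * z"
      by (simp add: z_def linear_scale[OF matrix_vector_mul_linear] linear_neg[OF matrix_vector_mul_linear])
    also have "((- r) *\<^sub>R y) \<bullet> (Q *v x) = - r * (y \<bullet> y)" by (simp add: y_def)
    finally have "2 * r * (y \<bullet> y) \<le> r * (r * z)" using 0 by simp
    then have "2 * (y \<bullet> y) \<le> r * z" using r by simp
    also have "\<dots> \<le> y \<bullet> y" using z yy by (simp add: r_def field_simps)
    finally show False using yy by simp
  qed
  with nonneg have "0 < x \<bullet> (Q *v x)" if "x \<noteq> 0" for x using that by (metis order_le_less)
  with tr show ?thesis by (simp add: posdef_def)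
qed

text \<open>
  With \<open>x = T\<inverse> y\<close>, the difference \<open>S\<^sub>n\<inverse> y - x\<close> is \<open>S\<^sub>n\<inverse> (T x - S\<^sub>n x)\<close>, and coercivity bounds the
  inverses uniformly.
\<close>

lemma matrix_inv_tendsto:
  fixes S :: "nat \<Rightarrow> real ^ 'p ^ 'p"
  assumes T: "posdef T" and lim: "S \<longlonglongrightarrow> T" and S: "eventually (\<lambda>n. posdef (S n)) sequentially"
  shows "(\<lambda>n. matrix_inv (S n) *v y) \<longlonglongrightarrow> matrix_inv T *v y"
proof -
  obtain \<kappa> where k: "\<kappa> > 0" "\<And>x. \<kappa> * (norm x)\<^sup>2 \<le> x \<bullet> (T *v x)"
    and ev: "eventually (\<lambda>n. \<forall>x. \<kappa> * (norm x)\<^sup>2 \<le> x \<bullet> (S n *v x)) sequentially"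
    using posdef_coercive_eventually[OF T lim] by blast
  define x where "x = matrix_inv T *v y"
  have "(\<lambda>n. (1 / \<kappa>) * norm (T *v x - S n *v x)) \<longlonglongrightarrow> (1 / \<kappa>) * norm (T *v x - T *v x)"
    by (intro tendsto_intros tendsto_matrix_vector_mult lim)
  then have 0: "(\<lambda>n. (1 / \<kappa>) * norm (T *v x - S n *v x)) \<longlonglongrightarrow> 0" by simp
  have "(\<lambda>n. matrix_inv (S n) *v y - x) \<longlonglongrightarrow> 0"
  proof (rule Lim_null_comparison[OF _ 0])
    show "eventually (\<lambda>n. norm (matrix_inv (S n) *v y - x) \<le> (1 / \<kappa>) * norm (T *v x - S n *v x)) sequentially"
      using ev S
    proof eventually_elim
      fix n assume c: "\<forall>x. \<kappa> * (norm x)\<^sup>2 \<le> x \<bullet> (S n *v x)" and pd: "posdef (S n)"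
      define d where "d = matrix_inv (S n) *v y - x"
      have "S n *v d = y - S n *v x"
        by (simp add: d_def matrix_vector_mult_diff_distrib posdef_mult_matrix_inv[OF pd])
      also have "y = T *v x" by (simp add: x_def posdef_mult_matrix_inv[OF T])
      finally have Sd: "S n *v d = T *v x - S n *v x" .
      have "\<kappa> * (norm d)\<^sup>2 \<le> d \<bullet> (S n *v d)" using c by blast
      also have "\<dots> \<le> norm d * norm (T *v x - S n *v x)" unfolding Sd by (rule norm_cauchy_schwarz)
      finally have "norm d * (\<kappa> * norm d) \<le> norm d * norm (T *v x - S n *v x)"
        by (simp add: power2_eq_square ac_simps)
      then have "\<kappa> * norm d \<le> norm (T *v x - S n *v x)"
        by (cases "d = 0") auto
      then show "norm (matrix_inv (S n) *v y - x) \<le> (1 / \<kappa>) * norm (T *v x - S n *v x)"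
        using k(1) by (simp add: d_def field_simps)
    qed
  qed
  then show ?thesis unfolding x_def by (rule LIM_zero_cancel)
qed

lemma unique_zero_index:
  fixes r :: "bool ^ 'p"
  assumes "model_size r = CARD('p) - 1"
  shows "\<not> r $ zero_index r"
proof -
  have "card (- {i. r $ i}) = CARD('p) - model_size r"
    by (simp add: Compl_eq_Diff_UNIV card_Diff_subset model_size_def)
  also have "\<dots> = 1" using assms zero_less_card_finite[where 'a = 'p] by linarith
  finally obtain i where "- {i. r $ i} = {i}" by (rule card_1_singletonE)
  then have "\<And>j. \<not> r $ j \<longleftrightarrow> j = i" by auto
  then show ?thesis unfolding zero_index_def by (intro theI[of "\<lambda>j. \<not> r $ j" i]) auto
qed

text \<open>
  One design, one selector and one true parameter. All statements concern the laws of the sample at the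
  local parameters \<open>\<theta> + (g / sqrt n) e\<close>, with \<open>e\<close> the axis that the submodel excludes.
\<close>

locale selection_model =
  fixes X :: "nat \<Rightarrow> nat \<Rightarrow> real ^ 'p" and Q :: "real ^ 'p ^ 'p" and R :: "(bool ^ 'p) set"
    and rhat :: "nat \<Rightarrow> (nat \<Rightarrow> real) \<Rightarrow> bool ^ 'p" and rs :: "bool ^ 'p" and \<theta> :: "real ^ 'p"
    and A :: "real ^ 'p ^ 'k" and t :: "real ^ 'k" and \<sigma> c :: real
  assumes design: "regular_design X Q"
    and full_in: "full_model \<in> R"
    and procedure: "selection_procedure R rhat"
    and size_rs: "model_size rs = CARD('p) - 1"
    and sel_constant: "selection_constant X rhat rs c"
    and theta: "\<theta> \<in> submodel rs" and nonzero: "num_nonzero \<theta> = CARD('p) - 1"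
    and \<sigma>: "0 < \<sigma>"
begin

definition "idx = zero_index rs"
definition "G n = (1 / real n) *\<^sub>R gram n (X n)"
definition "\<tau> = \<sigma> * sqrt (matrix_inv Q $ idx $ idx)"
definition "local_param g n = \<theta> + (g / sqrt (real n)) *\<^sub>R axis idx 1"
definition "law g n = sample_law n (X n) (local_param g n) \<sigma>"
definition "deviation g n Y = sqrt (real n) *\<^sub>R (lse n (X n) Y - local_param g n)"
definition "full_selected n = {Y \<in> space (sample_space n). rhat n Y = full_model}"
definition "full_cdf g n = cond_cdf n (X n) R (rhat n) A (local_param g n) \<sigma> t full_model"

abbreviation "limit_law \<equiv> normal_law ((1 / \<sigma>\<^sup>2) *\<^sub>R Q)"

lemma c: "c > 0" using sel_constant by (simp add: selection_constant_def)

lemma Q: "posdef Q" by (rule regular_design_posdef[OF design])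

lemma G_tendsto: "G \<longlonglongrightarrow> Q"
  using design by (simp add: regular_design_def G_def[abs_def])

lemma gram_posdef: "n > CARD('p) \<Longrightarrow> posdef (gram n (X n))"
  using design by (intro full_rank_imp_posdef_gram) (auto simp: regular_design_def)

lemma G_posdef: "n > CARD('p) \<Longrightarrow> posdef (G n)"
  unfolding G_def by (intro posdef_scale gram_posdef) auto

lemma theta_idx: "\<theta> $ idx = 0"
  using theta unique_zero_index[OF size_rs] by (auto simp: submodel_def idx_def)

lemma inv_Q_idx_pos: "matrix_inv Q $ idx $ idx > 0"
proof -
  define x where "x = matrix_inv Q *v axis idx 1"
  have Qx: "Q *v x = axis idx 1" by (simp add: x_def posdef_mult_matrix_inv[OF Q])
  then have "x \<noteq> 0" by (metis axis_eq_0_iff matrix_vector_mult_0_right zero_neq_one)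
  then have "0 < x \<bullet> (Q *v x)" using Q by (simp add: posdef_def)
  also have "\<dots> = x $ idx" by (simp add: Qx inner_axis)
  also have "\<dots> = matrix_inv Q $ idx $ idx" by (simp add: x_def matrix_vector_mul_component inner_axis)
  finally show ?thesis .
qed

lemma \<tau>_pos: "\<tau> > 0" using inv_Q_idx_pos \<sigma> by (simp add: \<tau>_def)

lemma S_posdef: "posdef ((1 / \<sigma>\<^sup>2) *\<^sub>R Q)" using \<sigma> by (intro posdef_scale Q) auto

lemma S_mult_inv: "((1 / \<sigma>\<^sup>2) *\<^sub>R Q) *v (\<sigma>\<^sup>2 *\<^sub>R (matrix_inv Q *v axis idx 1)) = axis idx 1"
  using \<sigma> by (simp add: scaleR_matrix_vector_assoc[symmetric] linear_scale[OF matrix_vector_mul_linear] posdef_mult_matrix_inv[OF Q])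

lemma \<tau>_square: "\<tau>\<^sup>2 = (\<sigma>\<^sup>2 *\<^sub>R (matrix_inv Q *v axis idx 1)) $ idx"
  using inv_Q_idx_pos by (simp add: \<tau>_def power_mult_distrib matrix_vector_mul_component inner_axis)

lemma limit_prob_selected:
  "measure limit_law (selected (c * \<tau>) idx g) = measure std_normal_distribution {x. c \<le> \<bar>x + g / \<tau>\<bar>}"
  by (rule prob_selected[OF S_posdef S_mult_inv \<tau>_pos \<tau>_square])

lemma prob_space_law: "prob_space (law g n)"
  unfolding law_def by (rule prob_space_sample_law[OF \<sigma>])

lemma sets_law [measurable_cong, simp]: "sets (law g n) = sets (sample_space n)"
  and space_law [simp]: "space (law g n) = space (sample_space n)"
  by (simp_all add: law_def)

lemma deviation_measurable [measurable]: "deviation g n \<in> borel_measurable (sample_space n)"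
  unfolding deviation_def[abs_def] by measurable

lemma selected_model_measurable: "n > CARD('p) \<Longrightarrow> {Y \<in> space (sample_space n). rhat n Y = r} \<in> sets (sample_space n)" if "r \<in> R"
  using procedure that measurable_sets[of "rhat n" "sample_space n" "count_space R" "{r}"]
  by (auto simp: selection_procedure_def vimage_def Int_def conj_commute)

lemma full_selected_measurable: "n > CARD('p) \<Longrightarrow> full_selected n \<in> sets (sample_space n)"
  unfolding full_selected_def using selected_model_measurable[OF full_in] .

lemma distr_deviation:
  assumes n: "n > CARD('p)"
  shows "distr (law g n) borel (deviation g n) = normal_law ((1 / \<sigma>\<^sup>2) *\<^sub>R G n)"
proof -
  have "sqrt (real n) > 0" using n by simp
  from lse_normal[OF gram_posdef[OF n] \<sigma> this, of "local_param g n"] show ?thesis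
    by (simp add: law_def deviation_def[abs_def] G_def mult.commute)
qed

lemma deviation_tendsto:
  assumes B[measurable]: "B \<in> sets borel"
  shows "(\<lambda>n. measure (law g n) {Y \<in> space (sample_space n). deviation g n Y \<in> B}) \<longlonglongrightarrow> measure limit_law B"
proof -
  have "(\<lambda>n. measure (normal_law ((1 / \<sigma>\<^sup>2) *\<^sub>R G n)) B) \<longlonglongrightarrow> measure limit_law B"
    by (intro normal_law_tendsto S_posdef tendsto_intros G_tendsto B)
  moreover have "eventually (\<lambda>n. measure (normal_law ((1 / \<sigma>\<^sup>2) *\<^sub>R G n)) B
      = measure (law g n) {Y \<in> space (sample_space n). deviation g n Y \<in> B}) sequentially"
    using eventually_gt_at_top[of "CARD('p)"]
  proof eventually_elim
    fix n assume n: "n > CARD('p)"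
    show "measure (normal_law ((1 / \<sigma>\<^sup>2) *\<^sub>R G n)) B
      = measure (law g n) {Y \<in> space (sample_space n). deviation g n Y \<in> B}"
      unfolding distr_deviation[OF n, of g, symmetric]
      by (subst measure_distr) (auto intro!: arg_cong2[where f = measure])
  qed
  ultimately show ?thesis by (rule Lim_transform_eventually)
qed

text \<open>
  The factor of \<open>sample_law_diff_le\<close> for two local parameters at distance \<open>x / sqrt n\<close>.
\<close>

definition "tv_bound x n = sqrt (exp (x\<^sup>2 * G n $ idx $ idx / \<sigma>\<^sup>2) - 1)"

lemma tv_bound_tendsto:
  "tv_bound x \<longlonglongrightarrow> sqrt (exp (x\<^sup>2 * Q $ idx $ idx / \<sigma>\<^sup>2) - 1)"
  unfolding tv_bound_def[abs_def] using \<sigma> by (intro tendsto_intros tendsto_vec_nth G_tendsto) auto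

lemma law_diff_le:
  assumes n: "n > CARD('p)" and E: "E \<in> sets (sample_space n)"
  shows "\<bar>measure (law b n) E - measure (law a n) E\<bar> \<le> tv_bound (b - a) n * sqrt (measure (law a n) E)"
proof -
  define h where "h = ((b - a) / sqrt (real n)) *\<^sub>R (axis idx 1 :: real ^ 'p)"
  have "local_param b n = local_param a n + h"
    by (simp add: local_param_def h_def diff_divide_distrib scaleR_diff_left)
  moreover have "(\<Sum>m<n. (X n m \<bullet> h)\<^sup>2) = (b - a)\<^sup>2 * G n $ idx $ idx"
  proof -
    have "(\<Sum>m<n. (X n m \<bullet> h)\<^sup>2) = h \<bullet> (gram n (X n) *v h)"
      by (simp add: gram_inner power2_eq_square)
    also have "\<dots> = ((b - a) / sqrt (real n))\<^sup>2 * gram n (X n) $ idx $ idx"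
      by (simp add: h_def linear_scale[OF matrix_vector_mul_linear] matrix_vector_mul_component inner_axis power2_eq_square)
    finally show ?thesis using n by (simp add: G_def power_divide)
  qed
  ultimately show ?thesis
    using sample_law_diff_le[OF \<sigma> E, of "X n" "local_param a n" h] by (simp add: law_def tv_bound_def)
qed

lemma contiguous:
  assumes E: "eventually (\<lambda>n. E n \<in> sets (sample_space n)) sequentially"
    and lim: "(\<lambda>n. measure (law a n) (E n)) \<longlonglongrightarrow> 0"
  shows "(\<lambda>n. measure (law b n) (E n)) \<longlonglongrightarrow> 0"
proof -
  let ?u = "\<lambda>n. measure (law a n) (E n) + tv_bound (b - a) n * sqrt (measure (law a n) (E n))"
  have "?u \<longlonglongrightarrow> 0 + sqrt (exp ((b - a)\<^sup>2 * Q $ idx $ idx / \<sigma>\<^sup>2) - 1) * sqrt 0"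
    by (intro tendsto_intros tv_bound_tendsto lim)
  then have u: "?u \<longlonglongrightarrow> 0" by simp
  show ?thesis
  proof (rule tendsto_sandwich[OF _ _ tendsto_const u])
    show "\<forall>\<^sub>F n in sequentially. measure (law b n) (E n) \<le> ?u n"
      using E eventually_gt_at_top[of "CARD('p)"]
    proof eventually_elim
      case (elim n)
      show ?case using abs_le_D1[OF law_diff_le[OF elim(2,1), of b a]] by (simp only: diff_le_eq add.commute)
    qed
  qed simp
qed

lemma local_param_0 [simp]: "local_param 0 n = \<theta>"
  by (simp add: local_param_def)

lemma ssr_theta:
  assumes n: "n > CARD('p)"
  shows "ssr n (X n) Y (lse n (X n) Y)
    = (\<Sum>m<n. (Y m - X n m \<bullet> \<theta>)\<^sup>2) - deviation 0 n Y \<bullet> (G n *v deviation 0 n Y)"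
proof -
  let ?d = "lse n (X n) Y - \<theta>"
  have "deviation 0 n Y \<bullet> (G n *v deviation 0 n Y) = ?d \<bullet> (gram n (X n) *v ?d)"
  proof -
    have "deviation 0 n Y \<bullet> (G n *v deviation 0 n Y)
        = (sqrt (real n) * sqrt (real n)) * (1 / real n) * (?d \<bullet> (gram n (X n) *v ?d))"
      by (simp only: deviation_def local_param_0 G_def scaleR_matrix_vector_assoc[symmetric]
          linear_scale[OF matrix_vector_mul_linear] inner_scaleR_left inner_scaleR_right mult.assoc mult.left_commute)
    then show ?thesis using n by simp
  qed
  also have "\<dots> = (\<theta> - lse n (X n) Y) \<bullet> (gram n (X n) *v (\<theta> - lse n (X n) Y))"
  proof -
    have "\<theta> - lse n (X n) Y = - ?d" by simp
    then show ?thesis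
      by (simp only: linear_neg[OF matrix_vector_mul_linear] inner_minus_left inner_minus_right minus_minus)
  qed
  finally show ?thesis
    using ssr_decomp[OF gram_posdef[OF n], of Y \<theta>] by (simp add: ssr_def)
qed

lemma sigma_hat_eq:
  "n > CARD('p) \<Longrightarrow> sigma_hat n (X n) Y = sqrt (ssr n (X n) Y (lse n (X n) Y) / (real n - real CARD('p)))"
  by (simp add: sigma_hat_def restricted_lse_full[OF gram_posdef])

lemma sigma_hat_measurable:
  assumes n: "n > CARD('p)" shows "sigma_hat n (X n) \<in> borel_measurable (sample_space n)"
proof -
  have [measurable]: "lse n (X n) \<in> borel_measurable (sample_space n)" by (rule lse_measurable)
  have "(\<lambda>Y. sqrt (ssr n (X n) Y (lse n (X n) Y) / (real n - real CARD('p)))) \<in> borel_measurable (sample_space n)"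
    unfolding ssr_def by measurable
  then show ?thesis by (simp add: sigma_hat_eq[OF n, symmetric])
qed

text \<open>
  The residual sum of squares is the sum of the squared errors minus a quadratic form in the scaled
  error of least squares. The first part obeys a law of large numbers; the second is bounded in
  probability and disappears after division by the degrees of freedom.
\<close>

lemma sigma_hat_consistent:
  assumes \<epsilon>: "\<epsilon> > 0"
  shows "(\<lambda>n. measure (law 0 n) {Y \<in> space (sample_space n). \<epsilon> \<le> \<bar>sigma_hat n (X n) Y - \<sigma>\<bar>}) \<longlonglongrightarrow> 0"
proof (rule tendstoI)
  fix \<eta> :: real assume \<eta>: "\<eta> > 0"
  interpret N: prob_space limit_law by (rule prob_space_normal_law[OF S_posdef])
  \<comment> \<open>If the root of \<open>a\<close> is \<open>\<epsilon>\<close>-far from \<open>\<sigma>\<close>, then \<open>a\<close> is \<open>\<epsilon> \<sigma>\<close>-far from \<open>\<sigma>\<^sup>2\<close>. Of this distance the mean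
     square error accounts for at most two quarters (its weight \<open>n / (n - P)\<close> is at most two), the
     degrees of freedom for one and the quadratic form for one.\<close>
  define \<zeta> where "\<zeta> = \<epsilon> * \<sigma> / 4"
  have z: "\<zeta> > 0" using \<epsilon> \<sigma> by (simp add: \<zeta>_def)
  have "(\<lambda>r. measure limit_law {w. real r \<le> norm w}) \<longlonglongrightarrow> measure limit_law (\<Inter>r. {w. real r \<le> norm w})"
    by (intro N.finite_Lim_measure_decseq) (auto simp: decseq_def)
  moreover have "(\<Inter>r. {w :: real ^ 'p. real r \<le> norm w}) = {}"
    by (auto simp: not_le) (meson reals_Archimedean2 not_le)
  ultimately have "(\<lambda>r. measure limit_law {w. real r \<le> norm w}) \<longlonglongrightarrow> 0" by simp
  then obtain r :: nat where r: "measure limit_law {w. real r \<le> norm w} < \<eta> / 2"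
    using order_tendstoD(2)[of _ 0 sequentially "\<eta> / 2"] \<eta> by (auto simp: eventually_sequentially)
  define D where "D = (\<lambda>n. {Y \<in> space (sample_space n). deviation 0 n Y \<in> {w. real r \<le> norm w}})"
  define V where "V = (\<lambda>n. {Y \<in> space (sample_space n). \<zeta> \<le> \<bar>(\<Sum>m<n. (Y m - X n m \<bullet> \<theta>)\<^sup>2) / n - \<sigma>\<^sup>2\<bar>})"
  have evD: "eventually (\<lambda>n. measure (law 0 n) (D n) < \<eta> / 2) sequentially"
    unfolding D_def by (rule order_tendstoD(2)[OF deviation_tendsto r]) measurable
  have evV: "eventually (\<lambda>n. measure (law 0 n) (V n) < \<eta> / 2) sequentially"
  proof -
    have "(\<lambda>n. 2 * \<sigma> ^ 4 / (real n * \<zeta>\<^sup>2)) \<longlonglongrightarrow> 0"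
      using lim_const_over_n[of "2 * \<sigma> ^ 4 / \<zeta>\<^sup>2"] by (simp add: mult.commute)
    then have "eventually (\<lambda>n. 2 * \<sigma> ^ 4 / (real n * \<zeta>\<^sup>2) < \<eta> / 2) sequentially"
      by (rule order_tendstoD(2)) (use \<eta> in simp)
    with eventually_gt_at_top[of 0] show ?thesis
    proof eventually_elim
      case (elim n)
      then show ?case
        using noise_square_mean_deviation[OF \<sigma> elim(1) z, of "X n" \<theta>] by (simp add: V_def law_def)
    qed
  qed
  have vanish: "(\<lambda>n. a / (real n - real CARD('p))) \<longlonglongrightarrow> 0" for a
    by (rule LIMSEQ_offset[where k = "CARD('p)"]) (simp add: lim_const_over_n)
  have "(\<lambda>n. \<Sum>i\<in>UNIV. \<Sum>j\<in>UNIV. \<bar>G n $ i $ j\<bar>) \<longlonglongrightarrow> (\<Sum>i\<in>UNIV. \<Sum>j\<in>UNIV. \<bar>Q $ i $ j\<bar>)"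
    by (intro tendsto_intros G_tendsto)
  from tendsto_mult[OF this vanish[of "(real r)\<^sup>2"]]
  have "(\<lambda>n. (\<Sum>i\<in>UNIV. \<Sum>j\<in>UNIV. \<bar>G n $ i $ j\<bar>) * ((real r)\<^sup>2 / (real n - real CARD('p)))) \<longlonglongrightarrow> 0" by simp
  then have evG: "eventually (\<lambda>n. (\<Sum>i\<in>UNIV. \<Sum>j\<in>UNIV. \<bar>G n $ i $ j\<bar>) * ((real r)\<^sup>2 / (real n - real CARD('p))) < \<zeta>) sequentially"
    by (rule order_tendstoD(2)) (rule z)
  have evP: "eventually (\<lambda>n. real CARD('p) * \<sigma>\<^sup>2 / (real n - real CARD('p)) < \<zeta>) sequentially"
    by (rule order_tendstoD(2)[OF vanish z])
  show "eventually (\<lambda>n. dist (measure (law 0 n) {Y \<in> space (sample_space n). \<epsilon> \<le> \<bar>sigma_hat n (X n) Y - \<sigma>\<bar>}) 0 < \<eta>) sequentially"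
    using evD evV evG evP eventually_gt_at_top[of "2 * CARD('p)"]
  proof eventually_elim
    case (elim n)
    then have n: "n > CARD('p)" by simp
    interpret L: prob_space "law 0 n" by (rule prob_space_law)
    define f where "f = real n - real CARD('p)"
    have f: "f > 0" "real n \<le> 2 * f" using elim(5) by (auto simp: f_def)
    have meas: "D n \<in> sets (law 0 n)" "V n \<in> sets (law 0 n)"
      unfolding D_def V_def by measurable
    have sub: "{Y \<in> space (sample_space n). \<epsilon> \<le> \<bar>sigma_hat n (X n) Y - \<sigma>\<bar>} \<subseteq> D n \<union> V n"
    proof
      fix Y assume "Y \<in> {Y \<in> space (sample_space n). \<epsilon> \<le> \<bar>sigma_hat n (X n) Y - \<sigma>\<bar>}"
      then have Y: "Y \<in> space (sample_space n)" and far: "\<epsilon> \<le> \<bar>sigma_hat n (X n) Y - \<sigma>\<bar>" by auto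
      show "Y \<in> D n \<union> V n"
      proof (rule ccontr)
        assume "Y \<notin> D n \<union> V n"
        then have d: "norm (deviation 0 n Y) < r" and v: "\<bar>(\<Sum>m<n. (Y m - X n m \<bullet> \<theta>)\<^sup>2) / n - \<sigma>\<^sup>2\<bar> < \<zeta>"
          using Y by (auto simp: D_def V_def)
        define q where "q = deviation 0 n Y \<bullet> (G n *v deviation 0 n Y)"
        define e where "e = (\<Sum>m<n. (Y m - X n m \<bullet> \<theta>)\<^sup>2) / n - \<sigma>\<^sup>2"
        define a where "a = ssr n (X n) Y (lse n (X n) Y) / f"
        have a0: "a \<ge> 0" using f by (simp add: a_def ssr_def sum_nonneg)
        have sh: "sigma_hat n (X n) Y = sqrt a" by (simp add: sigma_hat_eq[OF n] a_def f_def)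
        have "\<bar>q\<bar> \<le> (\<Sum>i\<in>UNIV. \<Sum>j\<in>UNIV. \<bar>G n $ i $ j\<bar>) * (norm (deviation 0 n Y))\<^sup>2"
          unfolding q_def by (rule abs_quadratic_form_le)
        also have "\<dots> \<le> (\<Sum>i\<in>UNIV. \<Sum>j\<in>UNIV. \<bar>G n $ i $ j\<bar>) * (real r)\<^sup>2"
          using d by (intro mult_left_mono power_mono sum_nonneg) auto
        finally have "\<bar>q\<bar> / f \<le> (\<Sum>i\<in>UNIV. \<Sum>j\<in>UNIV. \<bar>G n $ i $ j\<bar>) * (real r)\<^sup>2 / f"
          using f(1) by (intro divide_right_mono) auto
        also have "\<dots> < \<zeta>" using elim(3) by (simp add: f_def)
        finally have q: "\<bar>q\<bar> / f < \<zeta>" .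
        have "ssr n (X n) Y (lse n (X n) Y) = real n * (e + \<sigma>\<^sup>2) - q"
          using n by (simp add: ssr_theta[OF n] q_def e_def)
        then have "a - \<sigma>\<^sup>2 = (real n / f) * e + real CARD('p) * \<sigma>\<^sup>2 / f - q / f"
        proof -
          assume ssr: "ssr n (X n) Y (lse n (X n) Y) = real n * (e + \<sigma>\<^sup>2) - q"
          have "a * f = real n * (e + \<sigma>\<^sup>2) - q" using f(1) ssr by (simp add: a_def)
          then have "(a - \<sigma>\<^sup>2) * f = real n * e + real CARD('p) * \<sigma>\<^sup>2 - q"
            by (simp add: f_def algebra_simps)
          then have "a - \<sigma>\<^sup>2 = (real n * e + real CARD('p) * \<sigma>\<^sup>2 - q) / f"
            using f(1) by (simp add: eq_divide_eq)
          then show ?thesis by (simp add: add_divide_distrib diff_divide_distrib)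
        qed
        moreover have "\<bar>x + y - z\<bar> \<le> \<bar>x\<bar> + \<bar>y\<bar> + \<bar>z\<bar>" for x y z :: real by linarith
        ultimately have b0: "\<bar>a - \<sigma>\<^sup>2\<bar> \<le> \<bar>(real n / f) * e\<bar> + \<bar>real CARD('p) * \<sigma>\<^sup>2 / f\<bar> + \<bar>q / f\<bar>"
          by (simp only:)
        have "real n / f \<le> 2" using f by (simp add: divide_le_eq)
        then have "(real n / f) * \<bar>e\<bar> \<le> 2 * \<bar>e\<bar>" by (intro mult_right_mono) auto
        then have b1: "\<bar>(real n / f) * e\<bar> \<le> 2 * \<bar>e\<bar>" using f(1) by (simp add: abs_mult)
        have b2: "\<bar>real CARD('p) * \<sigma>\<^sup>2 / f\<bar> < \<zeta>"
          using elim(4) f(1) unfolding f_def[symmetric] by simp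
        have b3: "\<bar>q / f\<bar> < \<zeta>" using q f(1) by simp
        have b4: "\<bar>e\<bar> < \<zeta>" using v by (simp only: e_def)
        have comb: "x < 4 * z" if "x \<le> x1 + x2 + x3" "x1 \<le> 2 * x4" "x2 < z" "x3 < z" "x4 < z"
          for x x1 x2 x3 x4 z :: real using that by simp
        have lt: "\<bar>a - \<sigma>\<^sup>2\<bar> < \<epsilon> * \<sigma>"
          using comb[OF b0 b1 b2 b3 b4] by (simp add: \<zeta>_def)
        have "sqrt a * sqrt a = a" using a0 by simp
        moreover have "(sqrt a - \<sigma>) * (sqrt a + \<sigma>) = sqrt a * sqrt a - \<sigma>\<^sup>2"
          by algebra
        ultimately have fac: "a - \<sigma>\<^sup>2 = (sqrt a - \<sigma>) * (sqrt a + \<sigma>)" by simp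
        have "\<bar>a - \<sigma>\<^sup>2\<bar> = \<bar>sqrt a - \<sigma>\<bar> * (sqrt a + \<sigma>)"
          unfolding fac abs_mult using a0 \<sigma> by simp
        moreover have "\<epsilon> * \<sigma> \<le> \<bar>sqrt a - \<sigma>\<bar> * (sqrt a + \<sigma>)"
          using far \<epsilon> a0 \<sigma> by (intro mult_mono) (auto simp: sh)
        ultimately show False using lt by linarith
      qed
    qed
    have "measure (law 0 n) {Y \<in> space (sample_space n). \<epsilon> \<le> \<bar>sigma_hat n (X n) Y - \<sigma>\<bar>} \<le> measure (law 0 n) (D n \<union> V n)"
      by (rule L.finite_measure_mono[OF sub sets.Un[OF meas]])
    also have "\<dots> \<le> measure (law 0 n) (D n) + measure (law 0 n) (V n)"
      using meas by (rule measure_Un_le)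
    finally have "measure (law 0 n) {Y \<in> space (sample_space n). \<epsilon> \<le> \<bar>sigma_hat n (X n) Y - \<sigma>\<bar>} < \<eta>"
      using elim(1,2) by linarith
    then show ?case by (simp add: dist_real_def)
  qed
qed

end

section \<open>Selecting the full model\<close>

lemma gaussian_null:
  assumes L: "linear L" and B: "B \<in> null_sets lborel"
  shows "measure (gaussian L) B = 0"
proof -
  have [measurable]: "L \<in> borel_measurable borel" by (rule borel_measurable_linear[OF L])
  have "absolutely_continuous lborel (gaussian L)"
    unfolding gaussian_def by (rule absolutely_continuousI_density) measurable
  with B have "B \<in> null_sets (gaussian L)" by (auto simp: absolutely_continuous_def)
  then show ?thesis by (simp add: measure_def null_setsD1)
qed

lemma hyperplane_null: "{w :: real ^ 'p. w $ i = a} \<in> null_sets lborel"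
proof -
  have "negligible {w :: real ^ 'p. axis i 1 \<bullet> w = a}"
    by (rule negligible_hyperplane) (auto simp: axis_eq_0_iff)
  then have "{w :: real ^ 'p. w $ i = a} \<in> null_sets lebesgue"
    by (simp add: negligible_iff_null_sets)
  then show ?thesis by (subst (asm) null_sets_completion_iff) auto
qed

context selection_model
begin

definition "threshold = c * \<tau>"

lemma threshold_pos: "threshold > 0" using c \<tau>_pos by (simp add: threshold_def)

definition "q_root n = sqrt (matrix_inv (G n) $ idx $ idx)"

lemma q_root_tendsto: "q_root \<longlonglongrightarrow> sqrt (matrix_inv Q $ idx $ idx)"
proof -
  have "eventually (\<lambda>n. posdef (G n)) sequentially"
    using eventually_gt_at_top[of "CARD('p)"] by eventually_elim (rule G_posdef)
  from matrix_inv_tendsto[OF Q G_tendsto this, of "axis idx 1"]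
  have "(\<lambda>n. (matrix_inv (G n) *v axis idx 1) $ idx) \<longlonglongrightarrow> (matrix_inv Q *v axis idx 1) $ idx"
    by (rule tendsto_vec_nth)
  then show ?thesis
    unfolding q_root_def[abs_def] by (intro tendsto_real_sqrt) (simp add: matrix_vector_mul_component inner_axis)
qed

lemma t_statistic_eq:
  assumes n: "n > CARD('p)"
  shows "t_statistic n (X n) idx Y = deviation 0 n Y $ idx / (sigma_hat n (X n) Y * q_root n)"
  by (simp add: t_statistic_def restricted_lse_full[OF gram_posdef[OF n]] deviation_def theta_idx q_root_def G_def)

lemma deviation_shift: "n > 0 \<Longrightarrow> deviation 0 n Y $ idx = deviation g n Y $ idx + g"
  by (simp add: deviation_def local_param_def algebra_simps)

definition "t_rejects n = {Y \<in> space (sample_space n). c \<le> \<bar>t_statistic n (X n) idx Y\<bar>}"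
definition "z_rejects n = {Y \<in> space (sample_space n). deviation 0 n Y \<in> selected threshold idx 0}"

lemma t_rejects_measurable:
  assumes n: "n > CARD('p)" shows "t_rejects n \<in> sets (sample_space n)"
proof -
  note sigma_hat_measurable[OF n, measurable]
  show ?thesis unfolding t_rejects_def t_statistic_eq[OF n] by measurable
qed

lemma z_rejects_measurable: "z_rejects n \<in> sets (sample_space n)"
  unfolding z_rejects_def by measurable

text \<open>
  The bands around the critical value shrink to two hyperplanes, which are null sets.
\<close>

lemma limit_near_threshold:
  assumes \<eta>: "\<eta> > 0"
  obtains \<delta> where "\<delta> > 0" "\<delta> < threshold"
    "measure limit_law {w. \<bar>\<bar>w $ idx\<bar> - threshold\<bar> \<le> \<delta>} < \<eta>"
proof -
  interpret N: prob_space limit_law by (rule prob_space_normal_law[OF S_posdef])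
  define B where "B = (\<lambda>k::nat. {w :: real ^ 'p. \<bar>\<bar>w $ idx\<bar> - threshold\<bar> \<le> threshold / (real k + 2)})"
  have B: "B k \<in> sets borel" for k unfolding B_def by measurable
  have "(\<lambda>k. measure limit_law (B k)) \<longlonglongrightarrow> measure limit_law (\<Inter>k. B k)"
    using B threshold_pos
    by (intro N.finite_Lim_measure_decseq) (auto simp: decseq_def B_def elim!: order.trans intro!: divide_left_mono)
  moreover have "measure limit_law (\<Inter>k. B k) = 0"
  proof -
    have "(\<Inter>k. B k) \<subseteq> {w. w $ idx = threshold} \<union> {w. w $ idx = - threshold}"
    proof
      fix w assume w: "w \<in> (\<Inter>k. B k)"
      have "\<bar>\<bar>w $ idx\<bar> - threshold\<bar> \<le> 0"
      proof (rule LIMSEQ_le_const)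
        show "(\<lambda>k. threshold / (real k + 2)) \<longlonglongrightarrow> 0" by real_asymp
        show "\<exists>N. \<forall>k\<ge>N. \<bar>\<bar>w $ idx\<bar> - threshold\<bar> \<le> threshold / (real k + 2)"
          using w by (auto simp: B_def)
      qed
      then show "w \<in> {w. w $ idx = threshold} \<union> {w. w $ idx = - threshold}" by auto
    qed
    then have "measure limit_law (\<Inter>k. B k) \<le> measure limit_law ({w. w $ idx = threshold} \<union> {w. w $ idx = - threshold})"
      by (intro N.finite_measure_mono) auto
    also have "\<dots> = 0"
      by (rule gaussian_null) (auto intro!: null_sets.Un hyperplane_null)
    finally show ?thesis by (simp add: measure_le_0_iff)
  qed
  ultimately have "eventually (\<lambda>k. measure limit_law (B k) < \<eta>) sequentially"
    using \<eta> by (intro order_tendstoD(2)) auto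
  then obtain k where "measure limit_law (B k) < \<eta>" by (auto simp: eventually_sequentially)
  then show ?thesis
    using that[of "threshold / (real k + 2)"] threshold_pos by (simp add: B_def divide_less_eq)
qed

text \<open>
  Replacing the standard error by its limit moves the critical value by less than \<open>\<delta>\<close> unless \<open>sigma_hat\<close>
  is off, so the two tests can disagree only if the estimate falls into a thin band around the critical
  value.
\<close>

lemma t_rejects_approx:
  "(\<lambda>n. measure (law 0 n) (sym_diff (t_rejects n) (z_rejects n))) \<longlonglongrightarrow> 0"
proof (rule tendstoI)
  fix \<eta> :: real assume \<eta>: "\<eta> > 0"
  obtain \<delta> where d: "\<delta> > 0" "\<delta> < threshold"
    and near: "measure limit_law {w. \<bar>\<bar>w $ idx\<bar> - threshold\<bar> \<le> \<delta>} < \<eta> / 2"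
    using limit_near_threshold[of "\<eta> / 2"] \<eta> by auto
  define q where "q = sqrt (matrix_inv Q $ idx $ idx)"
  have thr: "threshold = c * (\<sigma> * q)" by (simp add: threshold_def \<tau>_def q_def)
  have q: "q > 0" using inv_Q_idx_pos by (simp add: q_def)
  define \<epsilon> where "\<epsilon> = \<delta> / (2 * c * (q + 1))"
  have e: "\<epsilon> > 0" using d c q by (simp add: \<epsilon>_def)
  define D where "D = (\<lambda>n. {Y \<in> space (sample_space n). deviation 0 n Y \<in> {w. \<bar>\<bar>w $ idx\<bar> - threshold\<bar> \<le> \<delta>}})"
  define V where "V = (\<lambda>n. {Y \<in> space (sample_space n). \<epsilon> \<le> \<bar>sigma_hat n (X n) Y - \<sigma>\<bar>})"
  have evD: "eventually (\<lambda>n. measure (law 0 n) (D n) < \<eta> / 2) sequentially"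
    unfolding D_def by (rule order_tendstoD(2)[OF deviation_tendsto near]) measurable
  have evV: "eventually (\<lambda>n. measure (law 0 n) (V n) < \<eta> / 2) sequentially"
    unfolding V_def by (rule order_tendstoD(2)[OF sigma_hat_consistent[OF e]]) (use \<eta> in simp)
  have "(\<lambda>n. \<bar>q_root n - q\<bar>) \<longlonglongrightarrow> \<bar>q - q\<bar>"
    unfolding q_def by (intro tendsto_intros q_root_tendsto)
  then have evq: "eventually (\<lambda>n. \<bar>q_root n - q\<bar> < min 1 (\<delta> / (2 * c * \<sigma>))) sequentially"
    using d c \<sigma> by (intro order_tendstoD(2)) auto
  show "eventually (\<lambda>n. dist (measure (law 0 n) (sym_diff (t_rejects n) (z_rejects n))) 0 < \<eta>) sequentially"
    using evD evV evq eventually_gt_at_top[of "CARD('p)"]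
  proof eventually_elim
    case (elim n)
    note n = elim(4)
    interpret L: prob_space "law 0 n" by (rule prob_space_law)
    note sigma_hat_measurable[OF n, measurable]
    have meas: "D n \<in> sets (law 0 n)" "V n \<in> sets (law 0 n)"
      unfolding D_def V_def by measurable
    have sub: "sym_diff (t_rejects n) (z_rejects n) \<subseteq> D n \<union> V n"
    proof
      fix Y assume Y: "Y \<in> sym_diff (t_rejects n) (z_rejects n)"
      then have sp: "Y \<in> space (sample_space n)" by (auto simp: t_rejects_def z_rejects_def)
      show "Y \<in> D n \<union> V n"
      proof (rule ccontr)
        assume "Y \<notin> D n \<union> V n"
        then have far: "\<delta> < \<bar>\<bar>deviation 0 n Y $ idx\<bar> - threshold\<bar>"
          and close: "\<bar>sigma_hat n (X n) Y - \<sigma>\<bar> < \<epsilon>" using sp by (auto simp: D_def V_def)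
        define h where "h = sigma_hat n (X n) Y"
        define p where "p = q_root n"
        have p: "\<bar>p - q\<bar> < 1" "\<bar>p - q\<bar> < \<delta> / (2 * c * \<sigma>)" using elim(3) by (auto simp: p_def)
        have "\<bar>c * (h * p) - threshold\<bar> = c * \<bar>(h - \<sigma>) * p + \<sigma> * (p - q)\<bar>"
        proof -
          have "c * (h * p) - threshold = c * ((h - \<sigma>) * p + \<sigma> * (p - q))"
            by (simp add: thr algebra_simps)
          then show ?thesis using c by (simp add: abs_mult)
        qed
        also have "\<dots> \<le> c * (\<bar>h - \<sigma>\<bar> * \<bar>p\<bar> + \<sigma> * \<bar>p - q\<bar>)"
          using c \<sigma> by (intro mult_left_mono order.trans[OF abs_triangle_ineq]) (auto simp: abs_mult)
        also have "\<dots> < c * (\<epsilon> * (q + 1) + \<sigma> * (\<delta> / (2 * c * \<sigma>)))"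
        proof -
          have "\<bar>h - \<sigma>\<bar> * \<bar>p\<bar> \<le> \<epsilon> * (q + 1)"
            using close p(1) e q by (intro mult_mono) (auto simp: h_def)
          moreover have "\<sigma> * \<bar>p - q\<bar> < \<sigma> * (\<delta> / (2 * c * \<sigma>))"
            using p(2) \<sigma> by (intro mult_strict_left_mono)
          ultimately show ?thesis using c by (intro mult_strict_left_mono) auto
        qed
        also have "\<dots> = \<delta>"
        proof -
          have "q + 1 \<noteq> 0" using q by simp
          then have "\<epsilon> * (q + 1) = \<delta> / (2 * c)" by (simp add: \<epsilon>_def)
          moreover have "\<sigma> * (\<delta> / (2 * c * \<sigma>)) = \<delta> / (2 * c)" using \<sigma> by simp
          ultimately show ?thesis using c by simp
        qed
        finally have cl: "\<bar>c * (h * p) - threshold\<bar> < \<delta>" .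
        then have "c * (h * p) > 0" using d by linarith
        then have hp: "h * p > 0" using c by (simp add: zero_less_mult_iff)
        have "Y \<in> t_rejects n \<longleftrightarrow> c * (h * p) \<le> \<bar>deviation 0 n Y $ idx\<bar>"
          using sp hp by (simp add: t_rejects_def t_statistic_eq[OF n] h_def p_def abs_divide pos_le_divide_eq)
        moreover have "Y \<in> z_rejects n \<longleftrightarrow> threshold \<le> \<bar>deviation 0 n Y $ idx\<bar>"
          using sp by (simp add: z_rejects_def selected_def)
        ultimately show False using Y far cl by auto
      qed
    qed
    have "measure (law 0 n) (sym_diff (t_rejects n) (z_rejects n)) \<le> measure (law 0 n) (D n \<union> V n)"
      by (rule L.finite_measure_mono[OF sub sets.Un[OF meas]])
    also have "\<dots> \<le> measure (law 0 n) (D n) + measure (law 0 n) (V n)"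
      using meas by (intro measure_Un_le)
    finally show ?case using elim by simp
  qed
qed

text \<open>
  At \<open>g = 0\<close> this is the requirement on the constant \<open>c\<close>, with the t-statistic replaced by the
  normalized estimate. That requirement concerns a fixed parameter; contiguity extends it to the
  parameters that move with \<open>n\<close>.
\<close>

lemma full_selected_approx:
  "(\<lambda>n. measure (law g n) (sym_diff (full_selected n) (z_rejects n))) \<longlonglongrightarrow> 0"
proof (rule contiguous[where a = 0])
  show "eventually (\<lambda>n. sym_diff (full_selected n) (z_rejects n) \<in> sets (sample_space n)) sequentially"
    using eventually_gt_at_top[of "CARD('p)"]
    by eventually_elim (intro sets.Un sets.Diff full_selected_measurable z_rejects_measurable)
  have 1: "(\<lambda>n. measure (law 0 n) (sym_diff (full_selected n) (t_rejects n))) \<longlonglongrightarrow> 0"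
    using sel_constant theta nonzero \<sigma>
    by (simp add: selection_constant_def law_def full_selected_def t_rejects_def idx_def)
  have 2: "(\<lambda>n. measure (law 0 n) (sym_diff (full_selected n) (t_rejects n))
      + measure (law 0 n) (sym_diff (t_rejects n) (z_rejects n))) \<longlonglongrightarrow> 0"
    using tendsto_add[OF 1 t_rejects_approx] by simp
  show "(\<lambda>n. measure (law 0 n) (sym_diff (full_selected n) (z_rejects n))) \<longlonglongrightarrow> 0"
  proof (rule tendsto_sandwich[OF _ _ tendsto_const 2])
    show "\<forall>\<^sub>F n in sequentially. measure (law 0 n) (sym_diff (full_selected n) (z_rejects n))
      \<le> measure (law 0 n) (sym_diff (full_selected n) (t_rejects n))
        + measure (law 0 n) (sym_diff (t_rejects n) (z_rejects n))"
      using eventually_gt_at_top[of "CARD('p)"]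
    proof eventually_elim
      case (elim n)
      interpret L: prob_space "law 0 n" by (rule prob_space_law)
      have m: "full_selected n \<in> sets (law 0 n)" "t_rejects n \<in> sets (law 0 n)" "z_rejects n \<in> sets (law 0 n)"
        using full_selected_measurable[OF elim] t_rejects_measurable[OF elim] z_rejects_measurable by auto
      have "measure (law 0 n) (sym_diff (full_selected n) (z_rejects n))
        \<le> measure (law 0 n) (sym_diff (full_selected n) (t_rejects n) \<union> sym_diff (t_rejects n) (z_rejects n))"
        using m by (intro L.finite_measure_mono sets.Un sets.Diff) auto
      also have "\<dots> \<le> measure (law 0 n) (sym_diff (full_selected n) (t_rejects n))
        + measure (law 0 n) (sym_diff (t_rejects n) (z_rejects n))"
        using m by (intro measure_Un_le sets.Un sets.Diff)
      finally show ?case .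
    qed
  qed simp
qed

lemma z_rejects_eq:
  "n > 0 \<Longrightarrow> z_rejects n = {Y \<in> space (sample_space n). deviation g n Y \<in> selected threshold idx g}"
  using deviation_shift[of n _ g] by (auto simp: z_rejects_def selected_def)

lemma selected_event_tendsto:
  assumes B: "B \<in> sets borel"
  shows "(\<lambda>n. measure (law g n) ({Y \<in> space (sample_space n). deviation g n Y \<in> B} \<inter> full_selected n))
    \<longlonglongrightarrow> measure limit_law (B \<inter> selected threshold idx g)"
proof -
  note B[measurable]
  define E where "E = (\<lambda>n. {Y \<in> space (sample_space n). deviation g n Y \<in> B})"
  have E: "E n \<in> sets (sample_space n)" for n unfolding E_def by measurable
  have lim: "(\<lambda>n. measure (law g n) {Y \<in> space (sample_space n). deviation g n Y \<in> B \<inter> selected threshold idx g})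
      \<longlonglongrightarrow> measure limit_law (B \<inter> selected threshold idx g)"
    by (rule deviation_tendsto) measurable
  have "(\<lambda>n. measure (law g n) (E n \<inter> full_selected n)
      - measure (law g n) {Y \<in> space (sample_space n). deviation g n Y \<in> B \<inter> selected threshold idx g}) \<longlonglongrightarrow> 0"
  proof (rule Lim_null_comparison[OF _ full_selected_approx[of g]])
    show "\<forall>\<^sub>F n in sequentially. norm (measure (law g n) (E n \<inter> full_selected n)
        - measure (law g n) {Y \<in> space (sample_space n). deviation g n Y \<in> B \<inter> selected threshold idx g})
        \<le> measure (law g n) (sym_diff (full_selected n) (z_rejects n))"
      using eventually_gt_at_top[of "CARD('p)"]
    proof eventually_elim
      case (elim n)
      interpret L: prob_space "law g n" by (rule prob_space_law)
      have n: "n > 0" using elim by simp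
      have eq: "{Y \<in> space (sample_space n). deviation g n Y \<in> B \<inter> selected threshold idx g} = E n \<inter> z_rejects n"
        by (auto simp: E_def z_rejects_eq[OF n, of g])
      define F where "F = full_selected n"
      define Z where "Z = z_rejects n"
      have m: "F \<in> sets (law g n)" "Z \<in> sets (law g n)" "E n \<in> sets (law g n)"
        using full_selected_measurable[OF elim] z_rejects_measurable E by (auto simp: F_def Z_def)
      have half: "measure (law g n) (E n \<inter> U) \<le> measure (law g n) (E n \<inter> V) + measure (law g n) (sym_diff F Z)"
        if "U \<subseteq> V \<union> sym_diff F Z" "U \<in> sets (law g n)" "V \<in> sets (law g n)" for U V
      proof -
        have "measure (law g n) (E n \<inter> U) \<le> measure (law g n) ((E n \<inter> V) \<union> sym_diff F Z)"
          using that m by (intro L.finite_measure_mono sets.Un sets.Diff sets.Int) auto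
        also have "\<dots> \<le> measure (law g n) (E n \<inter> V) + measure (law g n) (sym_diff F Z)"
          using that m by (intro measure_Un_le sets.Un sets.Diff sets.Int) auto
        finally show ?thesis .
      qed
      have "\<bar>measure (law g n) (E n \<inter> F) - measure (law g n) (E n \<inter> Z)\<bar> \<le> measure (law g n) (sym_diff F Z)"
      proof (rule abs_leI)
        have "F \<subseteq> Z \<union> sym_diff F Z" "Z \<subseteq> F \<union> sym_diff F Z" by blast+
        from half[OF this(1) m(1,2)] half[OF this(2) m(2,1)]
        show "measure (law g n) (E n \<inter> F) - measure (law g n) (E n \<inter> Z) \<le> measure (law g n) (sym_diff F Z)"
          "- (measure (law g n) (E n \<inter> F) - measure (law g n) (E n \<inter> Z)) \<le> measure (law g n) (sym_diff F Z)"
          by linarith+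
      qed
      then show ?case by (simp only: eq F_def Z_def real_norm_def)
    qed
  qed
  from tendsto_add[OF this lim] show ?thesis by (simp add: E_def)
qed

lemma full_selected_prob_tendsto:
  "(\<lambda>n. measure (law g n) (full_selected n)) \<longlonglongrightarrow> measure limit_law (selected threshold idx g)"
proof -
  have "{Y \<in> space (sample_space n). deviation g n Y \<in> UNIV} \<inter> full_selected n = full_selected n" for n
    by (auto simp: full_selected_def)
  then show ?thesis using selected_event_tendsto[of UNIV g] by simp
qed

lemma limit_selected_ge: "2 * (1 - std_normal_cdf c) \<le> measure limit_law (selected threshold idx g)"
  unfolding threshold_def limit_prob_selected by (rule std_normal_shifted_two_sided[OF c])

lemma limit_selected_0: "measure limit_law (selected threshold idx 0) = 2 * (1 - std_normal_cdf c)"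
  unfolding threshold_def limit_prob_selected using std_normal_two_sided[OF c] by simp

abbreviation "limit_cdf \<equiv> limit_cond_cdf ((1 / \<sigma>\<^sup>2) *\<^sub>R Q) A t threshold idx"

lemma pms_full_selected:
  assumes n: "n > CARD('p)" and Y: "rhat n Y = full_model"
  shows "pms_estimator n (X n) R (rhat n) Y = lse n (X n) Y"
proof -
  have "pms_estimator n (X n) R (rhat n) Y
      = (\<Sum>r\<in>R. if r = full_model then restricted_lse n (X n) r Y else 0)"
    unfolding pms_estimator_def Y by (intro sum.cong refl) auto
  also have "\<dots> = lse n (X n) Y"
    using full_in by (simp add: restricted_lse_full[OF gram_posdef[OF n]])
  finally show ?thesis .
qed

lemma full_cdf_tendsto: "(\<lambda>n. full_cdf g n) \<longlonglongrightarrow> limit_cdf g"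
proof -
  have pos: "measure limit_law (selected threshold idx g) > 0"
    by (rule less_le_trans[OF _ limit_selected_ge]) (intro mult_pos_pos std_normal_upper_tail_pos, simp)
  have "(\<lambda>n. measure (law g n) ({Y \<in> space (sample_space n). deviation g n Y \<in> target_event A t} \<inter> full_selected n)
        / measure (law g n) (full_selected n)) \<longlonglongrightarrow> limit_cdf g"
    unfolding limit_cond_cdf_def
    by (intro tendsto_divide selected_event_tendsto full_selected_prob_tendsto) (use pos in auto)
  moreover have "eventually (\<lambda>n. measure (law g n) ({Y \<in> space (sample_space n). deviation g n Y \<in> target_event A t} \<inter> full_selected n)
        / measure (law g n) (full_selected n) = full_cdf g n) sequentially"
    using eventually_gt_at_top[of "CARD('p)"] order_tendstoD(1)[OF full_selected_prob_tendsto pos]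
  proof eventually_elim
    case (elim n)
    have sel: "{Y \<in> space (sample_law n (X n) (local_param g n) \<sigma>). rhat n Y = full_model} = full_selected n"
      by (simp add: full_selected_def)
    have tgt: "{Y \<in> space (sample_law n (X n) (local_param g n) \<sigma>).
        sqrt (real n) *\<^sub>R (A *v (pms_estimator n (X n) R (rhat n) Y - local_param g n)) \<le> t \<and> rhat n Y = full_model}
      = {Y \<in> space (sample_space n). deviation g n Y \<in> target_event A t} \<inter> full_selected n"
      using pms_full_selected[OF elim(1)]
      by (auto simp: full_selected_def target_event_def deviation_def linear_scale[OF matrix_vector_mul_linear])
    show ?case
      using elim(2) unfolding full_cdf_def cond_cdf_def cond_prob_def sel tgt law_def by simp
  qed
  ultimately show ?thesis by (rule Lim_transform_eventually)
qed

end

section \<open>Lower bounds for the estimation error\<close>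

lemma liminf_ereal_ge:
  assumes lim: "f \<longlonglongrightarrow> (l :: real)" and ev: "eventually (\<lambda>n. ereal (f n) \<le> u n) sequentially"
  shows "ereal l \<le> liminf u"
proof -
  have "ereal l = liminf (\<lambda>n. ereal (f n))"
    using lim by (intro lim_imp_Liminf[symmetric]) auto
  also have "\<dots> \<le> liminf u" by (rule Liminf_mono[OF ev])
  finally show ?thesis .
qed

context selection_model
begin

lemma miss_prob_ge:
  assumes n: "n > CARD('p)" and K: "K \<in> estimators n"
  shows "measure (law g n) {Y \<in> full_selected n. \<delta> < \<bar>K Y - full_cdf g n\<bar>}
    \<le> miss_prob n (X n) R (rhat n) A (local_param g n) \<sigma> t K \<delta>"
    and "{Y \<in> full_selected n. \<delta> < \<bar>K Y - a\<bar>} \<in> sets (sample_space n)"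
proof -
  interpret L: prob_space "law g n" by (rule prob_space_law)
  have K[measurable]: "K \<in> borel_measurable (sample_space n)" using K by (simp add: estimators_def)
  let ?C = "cond_cdf_selected n (X n) R (rhat n) A (local_param g n) \<sigma> t"
  have "?C Y = full_cdf g n" if "Y \<in> full_selected n" for Y
  proof -
    have "?C Y = (\<Sum>r\<in>R. if r = full_model then full_cdf g n else 0)"
      unfolding cond_cdf_selected_def using that
      by (intro sum.cong refl) (auto simp: full_selected_def full_cdf_def)
    then show ?thesis using full_in by simp
  qed
  then have sub: "{Y \<in> full_selected n. \<delta> < \<bar>K Y - full_cdf g n\<bar>} \<subseteq> {Y \<in> space (sample_space n). \<delta> < \<bar>K Y - ?C Y\<bar>}"
    by (auto simp: full_selected_def)
  have "(\<lambda>Y. of_bool (rhat n Y = r) :: real) \<in> borel_measurable (sample_space n)" if "r \<in> R" for r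
  proof -
    have "(\<lambda>Y. of_bool (rhat n Y = r) :: real) \<in> borel_measurable (sample_space n)
      \<longleftrightarrow> (indicator {Y \<in> space (sample_space n). rhat n Y = r} :: _ \<Rightarrow> real) \<in> borel_measurable (sample_space n)"
      by (rule measurable_cong) (auto simp: indicator_def)
    then show ?thesis using selected_model_measurable[OF that n] by simp
  qed
  then have C[measurable]: "?C \<in> borel_measurable (sample_space n)"
    unfolding cond_cdf_selected_def[abs_def] by (intro borel_measurable_sum borel_measurable_times borel_measurable_const)
  have "measure (law g n) {Y \<in> full_selected n. \<delta> < \<bar>K Y - full_cdf g n\<bar>}
    \<le> measure (law g n) {Y \<in> space (sample_space n). \<delta> < \<bar>K Y - ?C Y\<bar>}"
    by (rule L.finite_measure_mono[OF sub]) measurable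
  then show "measure (law g n) {Y \<in> full_selected n. \<delta> < \<bar>K Y - full_cdf g n\<bar>}
    \<le> miss_prob n (X n) R (rhat n) A (local_param g n) \<sigma> t K \<delta>"
    by (simp add: miss_prob_def law_def)
  note full_selected_measurable[OF n, measurable]
  have "{Y \<in> full_selected n. \<delta> < \<bar>K Y - a\<bar>} = full_selected n \<inter> {Y \<in> space (sample_space n). \<delta> < \<bar>K Y - a\<bar>}"
    by (auto simp: full_selected_def)
  also have "\<dots> \<in> sets (sample_space n)" by measurable
  finally show "{Y \<in> full_selected n. \<delta> < \<bar>K Y - a\<bar>} \<in> sets (sample_space n)" .
qed

lemma local_max_ge:
  assumes n: "n > 0" and g: "\<bar>g\<bar> < \<rho>"
  shows "ereal (miss_prob n (X n) R (rhat n) A (local_param g n) \<sigma> t K \<delta>)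
    \<le> local_max_miss_prob n (X n) R (rhat n) A \<theta> \<sigma> t \<rho> K \<delta>"
  unfolding local_max_miss_prob_def
proof (rule SUP_upper, rule CollectI)
  have "norm (local_param g n - \<theta>) = \<bar>g\<bar> / sqrt (real n)"
    by (simp add: local_param_def norm_axis_1)
  also have "\<dots> < \<rho> / sqrt (real n)" using g n by (intro divide_strict_right_mono) auto
  finally show "norm (local_param g n - \<theta>) < \<rho> / sqrt (real n)" .
qed

text \<open>
  For late \<open>n\<close> the values \<open>full_cdf a n\<close> and \<open>full_cdf b n\<close> are more than \<open>2 \<delta>\<close> apart, so no number is
  \<open>\<delta>\<close>-close to both. The constant three leaves room for the passage from the limits.
\<close>

lemma full_selected_covered:
  assumes sep: "3 * \<delta> \<le> \<bar>limit_cdf a - limit_cdf b\<bar>" and \<delta>: "\<delta> > 0"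
  shows "eventually (\<lambda>n. \<forall>K \<in> estimators n. measure (law a n) (full_selected n)
    \<le> miss_prob n (X n) R (rhat n) A (local_param a n) \<sigma> t K \<delta>
      + measure (law a n) {Y \<in> full_selected n. \<delta> < \<bar>K Y - full_cdf b n\<bar>}) sequentially"
proof -
  have "(\<lambda>n. \<bar>full_cdf a n - full_cdf b n\<bar>) \<longlonglongrightarrow> \<bar>limit_cdf a - limit_cdf b\<bar>"
    by (intro tendsto_intros full_cdf_tendsto)
  then have "eventually (\<lambda>n. 2 * \<delta> < \<bar>full_cdf a n - full_cdf b n\<bar>) sequentially"
    by (rule order_tendstoD(1)) (use sep \<delta> in simp)
  with eventually_gt_at_top[of "CARD('p)"] show ?thesis
  proof (eventually_elim, intro ballI)
    fix n K assume n: "CARD('p) < n" and far: "2 * \<delta> < \<bar>full_cdf a n - full_cdf b n\<bar>" and K: "K \<in> estimators n"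
    interpret L: prob_space "law a n" by (rule prob_space_law)
    let ?E = "\<lambda>g. {Y \<in> full_selected n. \<delta> < \<bar>K Y - full_cdf g n\<bar>}"
    have E: "?E g \<in> sets (law a n)" for g using miss_prob_ge(2)[OF n K] by simp
    have "full_selected n \<subseteq> ?E a \<union> ?E b"
    proof
      fix Y assume "Y \<in> full_selected n"
      moreover have "\<delta> < \<bar>K Y - full_cdf a n\<bar> \<or> \<delta> < \<bar>K Y - full_cdf b n\<bar>" using far by linarith
      ultimately show "Y \<in> ?E a \<union> ?E b" by blast
    qed
    then have "measure (law a n) (full_selected n) \<le> measure (law a n) (?E a \<union> ?E b)"
      by (rule L.finite_measure_mono) (intro sets.Un E)
    also have "\<dots> \<le> measure (law a n) (?E a) + measure (law a n) (?E b)" by (intro measure_Un_le E)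
    also have "measure (law a n) (?E a) \<le> miss_prob n (X n) R (rhat n) A (local_param a n) \<sigma> t K \<delta>"
      by (rule miss_prob_ge(1)[OF n K])
    finally show "measure (law a n) (full_selected n)
      \<le> miss_prob n (X n) R (rhat n) A (local_param a n) \<sigma> t K \<delta> + measure (law a n) (?E b)" by simp
  qed
qed

text \<open>
  At \<open>\<theta>\<close> the estimator is close to \<open>full_cdf 0 n\<close> whenever the full model is selected; by contiguity this
  remains so at the local parameter \<open>g\<close>, where the target is \<open>full_cdf g n\<close>. It is therefore missed on
  almost the whole event that the full model is selected.
\<close>

theorem consistent_estimator_fails:
  assumes g: "\<bar>g\<bar> < \<rho>" and sep: "3 * \<delta> \<le> \<bar>limit_cdf g - limit_cdf 0\<bar>" and \<delta>: "\<delta> > 0"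
    and K: "\<forall>n > CARD('p). K n \<in> estimators n"
    and cons: "\<forall>\<delta> > 0. (\<lambda>n. miss_prob n (X n) R (rhat n) A \<theta> \<sigma> t (K n) \<delta>) \<longlonglongrightarrow> 0"
  shows "liminf (\<lambda>n. local_max_miss_prob n (X n) R (rhat n) A \<theta> \<sigma> t \<rho> (K n) \<delta>)
    \<ge> ereal (2 * (1 - std_normal_cdf c))"
proof -
  let ?E = "\<lambda>n. {Y \<in> full_selected n. \<delta> < \<bar>K n Y - full_cdf 0 n\<bar>}"
  have E0: "(\<lambda>n. measure (law 0 n) (?E n)) \<longlonglongrightarrow> 0"
  proof (rule tendsto_sandwich[OF _ _ tendsto_const cons[rule_format, OF \<delta>]])
    show "\<forall>\<^sub>F n in sequentially. measure (law 0 n) (?E n) \<le> miss_prob n (X n) R (rhat n) A \<theta> \<sigma> t (K n) \<delta>"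
      using eventually_gt_at_top[of "CARD('p)"]
    proof eventually_elim
      case (elim n)
      show ?case using miss_prob_ge(1)[OF elim K[rule_format, OF elim], of 0 \<delta>] by simp
    qed
  qed simp
  have Eg: "(\<lambda>n. measure (law g n) (?E n)) \<longlonglongrightarrow> 0"
  proof (rule contiguous[OF _ E0])
    show "\<forall>\<^sub>F n in sequentially. ?E n \<in> sets (sample_space n)"
      using eventually_gt_at_top[of "CARD('p)"]
    proof eventually_elim
      case (elim n)
      show ?case by (rule miss_prob_ge(2)[OF elim K[rule_format, OF elim]])
    qed
  qed
  have "(\<lambda>n. measure (law g n) (full_selected n) - measure (law g n) (?E n))
      \<longlonglongrightarrow> measure limit_law (selected threshold idx g) - 0"
    by (intro tendsto_diff full_selected_prob_tendsto Eg)
  then have lim: "(\<lambda>n. measure (law g n) (full_selected n) - measure (law g n) (?E n))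
      \<longlonglongrightarrow> measure limit_law (selected threshold idx g)" by simp
  have "ereal (2 * (1 - std_normal_cdf c)) \<le> ereal (measure limit_law (selected threshold idx g))"
    using limit_selected_ge[of g] by (simp only: ereal_less_eq)
  also have "\<dots> \<le> liminf (\<lambda>n. local_max_miss_prob n (X n) R (rhat n) A \<theta> \<sigma> t \<rho> (K n) \<delta>)"
  proof (rule liminf_ereal_ge[OF lim])
    show "\<forall>\<^sub>F n in sequentially. ereal (measure (law g n) (full_selected n) - measure (law g n) (?E n))
        \<le> local_max_miss_prob n (X n) R (rhat n) A \<theta> \<sigma> t \<rho> (K n) \<delta>"
      using full_selected_covered[OF sep \<delta>] eventually_gt_at_top[of "CARD('p)"]
    proof eventually_elim
      case (elim n)
      have "measure (law g n) (full_selected n) - measure (law g n) (?E n)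
        \<le> miss_prob n (X n) R (rhat n) A (local_param g n) \<sigma> t (K n) \<delta>"
        using bspec[OF elim(1) K[rule_format, OF elim(2)]] by (simp only: diff_le_eq)
      then have "ereal (measure (law g n) (full_selected n) - measure (law g n) (?E n))
        \<le> ereal (miss_prob n (X n) R (rhat n) A (local_param g n) \<sigma> t (K n) \<delta>)"
        by (simp only: ereal_less_eq)
      also have "\<dots> \<le> local_max_miss_prob n (X n) R (rhat n) A \<theta> \<sigma> t \<rho> (K n) \<delta>"
        by (rule local_max_ge[OF _ g]) (use elim(2) in simp)
      finally show ?case .
    qed
  qed
  finally show ?thesis .
qed

text \<open>
  Two-point argument. The events of missing the target for \<open>a\<close> and of missing the target for \<open>b\<close>
  together cover the selection of the full model. Measured under the laws at \<open>a\<close> and \<open>b\<close>, respectively,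
  their probabilities add up to at least the probability of that event, less the total variation
  between the two laws; the larger one is at least half of this.
\<close>

theorem every_estimator_fails:
  assumes a: "\<bar>a\<bar> < \<rho>" and b: "\<bar>b\<bar> < \<rho>"
    and sep: "3 * \<delta> \<le> \<bar>limit_cdf a - limit_cdf b\<bar>" and \<delta>: "\<delta> > 0"
  shows "liminf (\<lambda>n. INF K \<in> estimators n. local_max_miss_prob n (X n) R (rhat n) A \<theta> \<sigma> t \<rho> K \<delta>)
    \<ge> ereal (1 - std_normal_cdf c - sqrt (exp ((b - a)\<^sup>2 * Q $ idx $ idx / \<sigma>\<^sup>2) - 1) / 2)"
proof -
  let ?tv = "sqrt (exp ((b - a)\<^sup>2 * Q $ idx $ idx / \<sigma>\<^sup>2) - 1)"
  have sym: "tv_bound (a - b) n = tv_bound (b - a) n" for n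
    by (simp add: tv_bound_def power2_commute)
  have lim: "(\<lambda>n. (measure (law a n) (full_selected n) - tv_bound (b - a) n) / 2)
      \<longlonglongrightarrow> (measure limit_law (selected threshold idx a) - ?tv) / 2"
    by (intro tendsto_intros full_selected_prob_tendsto tv_bound_tendsto) simp
  have "2 * (1 - std_normal_cdf c) - ?tv \<le> measure limit_law (selected threshold idx a) - ?tv"
    using limit_selected_ge[of a] by (rule diff_right_mono)
  then have "ereal (1 - std_normal_cdf c - ?tv / 2) \<le> ereal ((measure limit_law (selected threshold idx a) - ?tv) / 2)"
    unfolding ereal_less_eq by (simp add: field_simps)
  also have "\<dots> \<le> liminf (\<lambda>n. INF K \<in> estimators n. local_max_miss_prob n (X n) R (rhat n) A \<theta> \<sigma> t \<rho> K \<delta>)"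
  proof (rule liminf_ereal_ge[OF lim])
    show "\<forall>\<^sub>F n in sequentially. ereal ((measure (law a n) (full_selected n) - tv_bound (b - a) n) / 2)
        \<le> (INF K \<in> estimators n. local_max_miss_prob n (X n) R (rhat n) A \<theta> \<sigma> t \<rho> K \<delta>)"
      using full_selected_covered[OF sep \<delta>] eventually_gt_at_top[of "CARD('p)"]
    proof (eventually_elim, intro INF_greatest)
      fix n K assume cov: "\<forall>K \<in> estimators n. measure (law a n) (full_selected n)
          \<le> miss_prob n (X n) R (rhat n) A (local_param a n) \<sigma> t K \<delta>
            + measure (law a n) {Y \<in> full_selected n. \<delta> < \<bar>K Y - full_cdf b n\<bar>}"
        and n: "CARD('p) < n" and K: "K \<in> estimators n"
      interpret Lb: prob_space "law b n" by (rule prob_space_law)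
      let ?E = "{Y \<in> full_selected n. \<delta> < \<bar>K Y - full_cdf b n\<bar>}"
      let ?m = "\<lambda>g. miss_prob n (X n) R (rhat n) A (local_param g n) \<sigma> t K \<delta>"
      let ?M = "local_max_miss_prob n (X n) R (rhat n) A \<theta> \<sigma> t \<rho> K \<delta>"
      have tv0: "0 \<le> tv_bound (b - a) n"
      proof -
        have "0 \<le> G n $ idx $ idx" by (simp add: G_def gram_def sum_nonneg)
        then show ?thesis by (simp add: tv_bound_def)
      qed
      have "\<bar>measure (law a n) ?E - measure (law b n) ?E\<bar> \<le> tv_bound (a - b) n * sqrt (measure (law b n) ?E)"
        by (rule law_diff_le[OF n miss_prob_ge(2)[OF n K]])
      also have "\<dots> \<le> tv_bound (b - a) n * 1"
        unfolding sym by (intro mult_left_mono tv0) (simp add: Lb.prob_le_1)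
      finally have diff: "\<bar>measure (law a n) ?E - measure (law b n) ?E\<bar> \<le> tv_bound (b - a) n" by simp
      have "measure (law b n) ?E \<le> ?m b" by (rule miss_prob_ge(1)[OF n K])
      moreover have "measure (law a n) (full_selected n) \<le> ?m a + measure (law a n) ?E"
        using cov K by (rule bspec)
      ultimately have sum: "measure (law a n) (full_selected n) - tv_bound (b - a) n \<le> ?m a + ?m b"
        using abs_le_D1[OF diff] by linarith
      have n0: "n > 0" using n by simp
      have "ereal ((measure (law a n) (full_selected n) - tv_bound (b - a) n) / 2) \<le> ereal (max (?m a) (?m b))"
        unfolding ereal_less_eq using sum by (simp add: max_def)
      also have "\<dots> = max (ereal (?m a)) (ereal (?m b))" by (simp add: max_def)
      also have "\<dots> \<le> ?M" by (intro max.boundedI local_max_ge[OF n0] a b)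
      finally show "ereal ((measure (law a n) (full_selected n) - tv_bound (b - a) n) / 2) \<le> ?M" .
    qed
  qed
  finally show ?thesis .
qed

lemma full_selected_limit:
  "(\<lambda>n. \<P>(Y in sample_law n (X n) \<theta> \<sigma>. rhat n Y = full_model)) \<longlonglongrightarrow> 2 * (1 - std_normal_cdf c)"
  using full_selected_prob_tendsto[of 0] by (simp add: limit_selected_0 law_def full_selected_def)

end

definition limiting_cdf ::
  "real ^ 'p ^ 'p \<Rightarrow> real \<Rightarrow> real \<Rightarrow> real ^ 'p ^ 'k \<Rightarrow> real ^ 'k \<Rightarrow> 'p \<Rightarrow> real \<Rightarrow> real" where
  "limiting_cdf Q \<sigma> c A t i =
     limit_cond_cdf ((1 / \<sigma>\<^sup>2) *\<^sub>R Q) A t (c * (\<sigma> * sqrt (matrix_inv Q $ i $ i))) i"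

definition tv_limit :: "real ^ 'p ^ 'p \<Rightarrow> real \<Rightarrow> 'p \<Rightarrow> real \<Rightarrow> real" where
  "tv_limit Q \<sigma> i x = sqrt (exp (x\<^sup>2 * Q $ i $ i / \<sigma>\<^sup>2) - 1)"

text \<open>
  What \<open>\<delta>\<close> and \<open>\<rho>\<close> have to provide at the index \<open>i\<close>. The first clause serves consistent estimators. The
  second serves arbitrary estimators at the fixed \<open>\<delta>\<close>, with laws close enough to leave a positive
  bound. In the third the separation may depend on \<open>\<eta>\<close>, in exchange for laws as close as desired.
\<close>

definition separating ::
  "real ^ 'p ^ 'p \<Rightarrow> real \<Rightarrow> real \<Rightarrow> real ^ 'p ^ 'k \<Rightarrow> real ^ 'k \<Rightarrow> 'p \<Rightarrow> real \<Rightarrow> real \<Rightarrow> bool" where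
  "separating Q \<sigma> c A t i \<delta> \<rho> \<longleftrightarrow>
     (\<exists>g. \<bar>g\<bar> < \<rho> \<and> 3 * \<delta> \<le> \<bar>limiting_cdf Q \<sigma> c A t i g - limiting_cdf Q \<sigma> c A t i 0\<bar>) \<and>
     (\<exists>a b. \<bar>a\<bar> < \<rho> \<and> \<bar>b\<bar> < \<rho> \<and> 3 * \<delta> \<le> \<bar>limiting_cdf Q \<sigma> c A t i a - limiting_cdf Q \<sigma> c A t i b\<bar> \<and>
        tv_limit Q \<sigma> i (b - a) \<le> 1 - std_normal_cdf c) \<and>
     (\<forall>\<eta> > 0. \<exists>a b. \<bar>a\<bar> < \<rho> \<and> \<bar>b\<bar> < \<rho> \<and> limiting_cdf Q \<sigma> c A t i a \<noteq> limiting_cdf Q \<sigma> c A t i b \<and>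
        tv_limit Q \<sigma> i (b - a) \<le> \<eta>)"

lemma separating_mono:
  assumes "separating Q \<sigma> c A t i \<delta> \<rho>" "\<delta>' \<le> \<delta>" "\<rho> \<le> \<rho>'"
  shows "separating Q \<sigma> c A t i \<delta>' \<rho>'"
proof -
  have r: "\<And>x. \<bar>x\<bar> < \<rho> \<Longrightarrow> \<bar>x\<bar> < \<rho>'" and d: "\<And>x. 3 * \<delta> \<le> x \<Longrightarrow> 3 * \<delta>' \<le> x"
    using assms(2,3) by auto
  show ?thesis
    using assms(1) unfolding separating_def by (meson r d)
qed

lemma ex_separating:
  fixes Q :: "real ^ 'p ^ 'p" and A :: "real ^ 'p ^ 'k"
  assumes Q: "posdef Q" and \<sigma>: "\<sigma> > 0" and c: "c > 0" and A: "rank A = CARD('k)"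
    and cor: "A *v (matrix_inv Q *v axis i 1) \<noteq> 0"
  shows "\<exists>\<delta> > 0. \<exists>\<rho> > 0. separating Q \<sigma> c A t i \<delta> \<rho>"
proof -
  let ?H = "limiting_cdf Q \<sigma> c A t i"
  define v where "v = \<sigma>\<^sup>2 *\<^sub>R (matrix_inv Q *v axis i 1)"
  have S: "posdef ((1 / \<sigma>\<^sup>2) *\<^sub>R Q)" using \<sigma> by (intro posdef_scale Q) simp
  have Sv: "((1 / \<sigma>\<^sup>2) *\<^sub>R Q) *v v = axis i 1"
    using \<sigma> by (simp add: v_def scaleR_matrix_vector_assoc[symmetric] linear_scale[OF matrix_vector_mul_linear] posdef_mult_matrix_inv[OF Q])
  have "v \<noteq> 0" using Sv by (auto simp: axis_eq_0_iff)
  then have "0 < v \<bullet> (((1 / \<sigma>\<^sup>2) *\<^sub>R Q) *v v)" using S unfolding posdef_def by blast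
  then have v: "v $ i > 0" unfolding Sv by (simp add: inner_axis)
  then have inv: "matrix_inv Q $ i $ i > 0"
    using \<sigma> by (simp add: v_def matrix_vector_mul_component inner_axis zero_less_mult_iff)
  have Av: "A *v v \<noteq> 0" using cor \<sigma> by (simp add: v_def linear_scale[OF matrix_vector_mul_linear])
  have s: "c * (\<sigma> * sqrt (matrix_inv Q $ i $ i)) > 0" using c \<sigma> inv by simp
  obtain g where g: "?H g \<noteq> ?H 0"
    using limit_cond_cdf_not_constant[OF S Sv v Av A s] unfolding limiting_cdf_def by blast
  define \<rho> where "\<rho> = \<bar>g\<bar> + 1"
  have tv0: "(\<lambda>x. tv_limit Q \<sigma> i x) \<midarrow>0\<rightarrow> 0"
  proof -
    have "isCont (\<lambda>x. tv_limit Q \<sigma> i x) 0"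
      unfolding tv_limit_def using \<sigma> by (intro continuous_intros) auto
    then show ?thesis by (simp add: isCont_def tv_limit_def)
  qed
  have close: "\<exists>a b. \<bar>a\<bar> < \<rho> \<and> \<bar>b\<bar> < \<rho> \<and> ?H a \<noteq> ?H b \<and> tv_limit Q \<sigma> i (b - a) \<le> \<eta>" if \<eta>: "\<eta> > 0" for \<eta>
  proof -
    obtain d where d: "d > 0" "\<And>x. x \<noteq> 0 \<Longrightarrow> \<bar>x\<bar> < d \<Longrightarrow> \<bar>tv_limit Q \<sigma> i x\<bar> < \<eta>"
      using LIM_D[OF tv0 \<eta>] by auto
    obtain a b where ab: "\<bar>a\<bar> \<le> \<bar>g\<bar>" "\<bar>b\<bar> \<le> \<bar>g\<bar>" "\<bar>b - a\<bar> < d" "?H a \<noteq> ?H b"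
      using neighbours_differ[of ?H g d, OF g d(1)] by blast
    have "b - a \<noteq> 0" using ab(4) by auto
    from d(2)[OF this ab(3)] ab show ?thesis
      by (intro exI[of _ a] exI[of _ b]) (auto simp: \<rho>_def)
  qed
  obtain a b where ab: "\<bar>a\<bar> < \<rho>" "\<bar>b\<bar> < \<rho>" "?H a \<noteq> ?H b" "tv_limit Q \<sigma> i (b - a) \<le> 1 - std_normal_cdf c"
    using close[OF std_normal_upper_tail_pos[of c]] by blast
  define \<delta> where "\<delta> = min \<bar>?H g - ?H 0\<bar> \<bar>?H a - ?H b\<bar> / 3"
  have "\<delta> > 0" using g ab(3) by (simp add: \<delta>_def)
  moreover have "\<rho> > 0" by (simp add: \<rho>_def)
  moreover have "separating Q \<sigma> c A t i \<delta> \<rho>"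
    unfolding separating_def
  proof (intro conjI)
    show "\<exists>g. \<bar>g\<bar> < \<rho> \<and> 3 * \<delta> \<le> \<bar>?H g - ?H 0\<bar>"
      by (rule exI[of _ g]) (simp add: \<rho>_def \<delta>_def)
    show "\<exists>a b. \<bar>a\<bar> < \<rho> \<and> \<bar>b\<bar> < \<rho> \<and> 3 * \<delta> \<le> \<bar>?H a - ?H b\<bar> \<and> tv_limit Q \<sigma> i (b - a) \<le> 1 - std_normal_cdf c"
      by (rule exI[of _ a], rule exI[of _ b]) (use ab in \<open>simp add: \<delta>_def\<close>)
    show "\<forall>\<eta> > 0. \<exists>a b. \<bar>a\<bar> < \<rho> \<and> \<bar>b\<bar> < \<rho> \<and> ?H a \<noteq> ?H b \<and> tv_limit Q \<sigma> i (b - a) \<le> \<eta>"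
      using close by blast
  qed
  ultimately show ?thesis by blast
qed

text \<open>
  The constants may depend on \<open>Q\<close>, \<open>\<sigma>\<close>, \<open>c\<close>, \<open>A\<close> and \<open>t\<close>, but not on the submodel and hence not on its
  index \<open>i\<close>. Being separating is preserved when \<open>\<delta>\<close> shrinks and \<open>\<rho>\<close> grows, so a minimum and a maximum
  over the finitely many indices suffice.
\<close>

lemma uniform_separating:
  fixes Q :: "real ^ 'p ^ 'p" and A :: "real ^ 'p ^ 'k"
  assumes \<sigma>: "\<sigma> > 0" and A: "rank A = CARD('k)"
  shows "\<exists>\<delta> > 0. \<exists>\<rho> > 0. \<forall>i. posdef Q \<longrightarrow> c > 0 \<longrightarrow>
    A *v (matrix_inv Q *v axis i 1) \<noteq> 0 \<longrightarrow> separating Q \<sigma> c A t i \<delta> \<rho>"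
proof -
  let ?P = "\<lambda>i. posdef Q \<and> c > 0 \<and> A *v (matrix_inv Q *v axis i 1) \<noteq> 0"
  have "\<forall>i. \<exists>d r. d > 0 \<and> r > 0 \<and> (?P i \<longrightarrow> separating Q \<sigma> c A t i d r)"
  proof
    fix i
    show "\<exists>d r. d > 0 \<and> r > 0 \<and> (?P i \<longrightarrow> separating Q \<sigma> c A t i d r)"
    proof (cases "?P i")
      case True
      then show ?thesis using ex_separating[OF _ \<sigma> _ A, of Q c i t] by blast
    next
      case False
      then show ?thesis by (intro exI[of _ 1]) auto
    qed
  qed
  then obtain d r where dr: "\<And>i. d i > 0" "\<And>i. r i > 0" "\<And>i. ?P i \<Longrightarrow> separating Q \<sigma> c A t i (d i) (r i)"
    by metis
  define \<delta> where "\<delta> = Min (range d)"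
  define \<rho> where "\<rho> = Max (range r)"
  have d: "\<delta> > 0" unfolding \<delta>_def using dr(1) by (subst Min_gr_iff) auto
  have r: "r i \<le> \<rho>" "\<delta> \<le> d i" for i by (simp_all add: \<rho>_def \<delta>_def)
  have \<rho>: "\<rho> > 0" by (rule less_le_trans[OF dr(2)[of undefined] r(1)])
  show ?thesis
    by (intro exI[of _ \<delta>] exI[of _ \<rho>] conjI d \<rho> allI impI)
       (rule separating_mono[OF dr(3) r(2) r(1)], simp)
qed

theorem theorem3p1:
  fixes A :: "real ^ 'p ^ 'k" and Q :: "real ^ 'p ^ 'p"
    and t :: "real ^ 'k" and \<sigma> c :: real
  assumes "rank A = CARD('k)" and "0 < \<sigma>"
  shows "\<exists>\<delta>\<^sub>0 > 0. \<exists>\<rho>\<^sub>0 > 0.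
    \<forall>(X :: nat \<Rightarrow> nat \<Rightarrow> real ^ 'p) (R :: (bool ^ 'p) set)
      (rhat :: nat \<Rightarrow> (nat \<Rightarrow> real) \<Rightarrow> bool ^ 'p) (rs :: bool ^ 'p) (\<theta> :: real ^ 'p).
      regular_design X Q \<longrightarrow>
      full_model \<in> R \<longrightarrow>
      selection_procedure R rhat \<longrightarrow>
      standing_condition X R rhat \<longrightarrow>
      rs \<in> R \<longrightarrow> model_size rs = CARD('p) - 1 \<longrightarrow>
      selection_constant X rhat rs c \<longrightarrow>
      A *v (matrix_inv Q *v axis (zero_index rs) 1) \<noteq> 0 \<longrightarrow>
      \<theta> \<in> submodel rs \<longrightarrow> num_nonzero \<theta> = CARD('p) - 1 \<longrightarrow>
      (\<forall>K :: nat \<Rightarrow> (nat \<Rightarrow> real) \<Rightarrow> real.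
         (\<forall>n > CARD('p). K n \<in> estimators n) \<longrightarrow>
         (\<forall>\<delta> > 0. (\<lambda>n. miss_prob n (X n) R (rhat n) A \<theta> \<sigma> t (K n) \<delta>) \<longlonglongrightarrow> 0) \<longrightarrow>
         liminf (\<lambda>n. local_max_miss_prob n (X n) R (rhat n) A \<theta> \<sigma> t \<rho>\<^sub>0 (K n) \<delta>\<^sub>0)
           \<ge> ereal (2 * (1 - std_normal_cdf c))) \<and>
      2 * (1 - std_normal_cdf c) > 0 \<and>
      liminf (\<lambda>n. INF K \<in> estimators n.
         local_max_miss_prob n (X n) R (rhat n) A \<theta> \<sigma> t \<rho>\<^sub>0 K \<delta>\<^sub>0) > 0 \<and>
      (SUP \<delta> \<in> {0<..}. liminf (\<lambda>n. INF K \<in> estimators n.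
         local_max_miss_prob n (X n) R (rhat n) A \<theta> \<sigma> t \<rho>\<^sub>0 K \<delta>))
           \<ge> ereal (1 - std_normal_cdf c) \<and>
      1 - std_normal_cdf c > 0 \<and>
      (\<lambda>n. \<P>(Y in sample_law n (X n) \<theta> \<sigma>. rhat n Y = full_model))
         \<longlonglongrightarrow> 2 * (1 - std_normal_cdf c)"
proof -
  obtain \<delta>\<^sub>0 \<rho>\<^sub>0 where pos: "\<delta>\<^sub>0 > 0" "\<rho>\<^sub>0 > 0"
    and sep: "\<And>i. posdef Q \<Longrightarrow> c > 0 \<Longrightarrow> A *v (matrix_inv Q *v axis i 1) \<noteq> 0 \<Longrightarrow> separating Q \<sigma> c A t i \<delta>\<^sub>0 \<rho>\<^sub>0"
    using uniform_separating[OF assms(2,1), of Q c t] by blast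
  show ?thesis
  proof (rule exI[of _ \<delta>\<^sub>0], rule conjI[OF pos(1)], rule exI[of _ \<rho>\<^sub>0], rule conjI[OF pos(2)], intro allI impI)
    fix X R rhat rs \<theta>
    assume "regular_design X Q" "full_model \<in> R" "selection_procedure R rhat"
      "standing_condition X R rhat" "rs \<in> R" "model_size rs = CARD('p) - 1"
      "selection_constant X rhat rs c" and cor: "A *v (matrix_inv Q *v axis (zero_index rs) 1) \<noteq> 0"
      and "\<theta> \<in> submodel rs" "num_nonzero \<theta> = CARD('p) - 1"
    then interpret selection_model X Q R rhat rs \<theta> A t \<sigma> c
      by unfold_locales (use assms in auto)
    let ?p = "1 - std_normal_cdf c"
    let ?L = "\<lambda>\<delta>. liminf (\<lambda>n. INF K \<in> estimators n. local_max_miss_prob n (X n) R (rhat n) A \<theta> \<sigma> t \<rho>\<^sub>0 K \<delta>)"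
    have H: "limiting_cdf Q \<sigma> c A t idx = limit_cdf"
      by (simp add: limiting_cdf_def threshold_def \<tau>_def)
    have "separating Q \<sigma> c A t idx \<delta>\<^sub>0 \<rho>\<^sub>0" using sep[OF Q c] cor by (simp add: idx_def)
    then obtain g a b where g: "\<bar>g\<bar> < \<rho>\<^sub>0" "3 * \<delta>\<^sub>0 \<le> \<bar>limit_cdf g - limit_cdf 0\<bar>"
      and ab: "\<bar>a\<bar> < \<rho>\<^sub>0" "\<bar>b\<bar> < \<rho>\<^sub>0" "3 * \<delta>\<^sub>0 \<le> \<bar>limit_cdf a - limit_cdf b\<bar>" "tv_limit Q \<sigma> idx (b - a) \<le> ?p"
      and close: "\<And>\<eta>. \<eta> > 0 \<Longrightarrow> \<exists>a b. \<bar>a\<bar> < \<rho>\<^sub>0 \<and> \<bar>b\<bar> < \<rho>\<^sub>0 \<and> limit_cdf a \<noteq> limit_cdf b \<and> tv_limit Q \<sigma> idx (b - a) \<le> \<eta>"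
      unfolding separating_def H by blast
    have p: "?p > 0" by (rule std_normal_upper_tail_pos)
    have fails: "ereal (?p - tv_limit Q \<sigma> idx (b - a) / 2) \<le> ?L \<delta>"
      if "\<bar>a\<bar> < \<rho>\<^sub>0" "\<bar>b\<bar> < \<rho>\<^sub>0" "3 * \<delta> \<le> \<bar>limit_cdf a - limit_cdf b\<bar>" "\<delta> > 0" for a b \<delta>
      unfolding tv_limit_def by (rule every_estimator_fails[OF that])
    have "0 < ereal (?p - tv_limit Q \<sigma> idx (b - a) / 2)" using ab(4) p by simp
    also have "\<dots> \<le> ?L \<delta>\<^sub>0" by (rule fails[OF ab(1-3) pos(1)])
    finally have claim2: "0 < ?L \<delta>\<^sub>0" .
    have claim3: "ereal ?p \<le> (SUP \<delta> \<in> {0<..}. ?L \<delta>)"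
    proof (rule ereal_le_epsilon2)
      fix \<eta> :: real assume \<eta>: "\<eta> > 0"
      obtain a b where ab: "\<bar>a\<bar> < \<rho>\<^sub>0" "\<bar>b\<bar> < \<rho>\<^sub>0" "limit_cdf a \<noteq> limit_cdf b" "tv_limit Q \<sigma> idx (b - a) \<le> \<eta>"
        using close[OF \<eta>] by blast
      define \<delta> where "\<delta> = \<bar>limit_cdf a - limit_cdf b\<bar> / 3"
      have \<delta>: "\<delta> > 0" using ab(3) by (simp add: \<delta>_def)
      have "ereal (?p - tv_limit Q \<sigma> idx (b - a) / 2) \<le> ?L \<delta>"
        by (rule fails[OF ab(1,2) _ \<delta>]) (simp add: \<delta>_def)
      also have "\<dots> \<le> (SUP \<delta> \<in> {0<..}. ?L \<delta>)" using \<delta> by (intro SUP_upper) simp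
      finally have "ereal (?p - tv_limit Q \<sigma> idx (b - a) / 2) + ereal \<eta> \<le> (SUP \<delta> \<in> {0<..}. ?L \<delta>) + ereal \<eta>"
        by (rule add_right_mono)
      moreover have "ereal ?p \<le> ereal (?p - tv_limit Q \<sigma> idx (b - a) / 2) + ereal \<eta>"
        using ab(4) \<eta> by simp
      ultimately show "ereal ?p \<le> (SUP \<delta> \<in> {0<..}. ?L \<delta>) + ereal \<eta>" by (rule order.trans[rotated])
    qed
    have claim1: "\<forall>K. (\<forall>n > CARD('p). K n \<in> estimators n) \<longrightarrow>
         (\<forall>\<delta> > 0. (\<lambda>n. miss_prob n (X n) R (rhat n) A \<theta> \<sigma> t (K n) \<delta>) \<longlonglongrightarrow> 0) \<longrightarrow>
         liminf (\<lambda>n. local_max_miss_prob n (X n) R (rhat n) A \<theta> \<sigma> t \<rho>\<^sub>0 (K n) \<delta>\<^sub>0)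
           \<ge> ereal (2 * (1 - std_normal_cdf c))"
      using consistent_estimator_fails[OF g pos(1)] by blast
    show "(\<forall>K :: nat \<Rightarrow> (nat \<Rightarrow> real) \<Rightarrow> real.
         (\<forall>n > CARD('p). K n \<in> estimators n) \<longrightarrow>
         (\<forall>\<delta> > 0. (\<lambda>n. miss_prob n (X n) R (rhat n) A \<theta> \<sigma> t (K n) \<delta>) \<longlonglongrightarrow> 0) \<longrightarrow>
         liminf (\<lambda>n. local_max_miss_prob n (X n) R (rhat n) A \<theta> \<sigma> t \<rho>\<^sub>0 (K n) \<delta>\<^sub>0)
           \<ge> ereal (2 * (1 - std_normal_cdf c))) \<and>
      2 * (1 - std_normal_cdf c) > 0 \<and>
      liminf (\<lambda>n. INF K \<in> estimators n.
         local_max_miss_prob n (X n) R (rhat n) A \<theta> \<sigma> t \<rho>\<^sub>0 K \<delta>\<^sub>0) > 0 \<and>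
      (SUP \<delta> \<in> {0<..}. liminf (\<lambda>n. INF K \<in> estimators n.
         local_max_miss_prob n (X n) R (rhat n) A \<theta> \<sigma> t \<rho>\<^sub>0 K \<delta>))
           \<ge> ereal (1 - std_normal_cdf c) \<and>
      1 - std_normal_cdf c > 0 \<and>
      (\<lambda>n. \<P>(Y in sample_law n (X n) \<theta> \<sigma>. rhat n Y = full_model))
         \<longlonglongrightarrow> 2 * (1 - std_normal_cdf c)"
      using p by (intro conjI claim1 claim2 claim3 full_selected_limit) simp_all
  qed
qed

end
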